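(* Let $E=C(\mathbb{S})$ be the Banach space of continuous real-valued functions on the unit circle $\mathbb{S}=\mathbb{R}/2\pi\mathbb{Z}$ and let $A=\frac{d}{d\theta}$ be the generator of the rotation group $(S(t))_{t\in\mathbb{R}}$ on $E$, $S(t)f=f(\cdot+t)$. Assume that the real-valued L\'evy process $Y$ has trajectories with unbounded variation. Then there exists $f\in E$ such that almost surely the mild solution to the problem $$dX(t)=AX(t)\,dt+f\,dY(t),\ t\ge0,\qquad X(0)=0,$$ does not take values in $E$.
   Context: Functions on $\mathbb{S}$ are identified with $2\pi$-periodic functions on $\mathbb{R}$; $\tilde f$ denotes the $2\pi$-periodic function corresponding to $f$. The mild solution is $X(t)=\int_0^tS(t-s)f\,dY(s)$, i.e. the process given by $X(t,z)=\int_0^t\tilde f(z+t-s)\,dY(s)$, $z\in[0,2\pi]$. *)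

theory Defs
  imports "HOL-Probability.Probability"
begin

(* C(S): functions on the circle R/2piZ are identified with 2pi-periodic functions on R. *)
definition circle_continuous :: "(real \<Rightarrow> real) set" where
  "circle_continuous = {f. continuous_on UNIV f \<and> (\<forall>x. f (x + 2 * pi) = f x)}"

(* The rotation group S(t) generated by d/dtheta. *)
definition rotation :: "real \<Rightarrow> (real \<Rightarrow> real) \<Rightarrow> real \<Rightarrow> real" where
  "rotation t f = (\<lambda>z. f (z + t))"

definition cadlag :: "(real \<Rightarrow> real) \<Rightarrow> bool" where
  "cadlag y \<longleftrightarrow>
     (\<forall>t\<ge>0. (y \<longlongrightarrow> y t) (at_right t)) \<and>
     (\<forall>t>0. \<exists>l. (y \<longlongrightarrow> l) (at_left t))"

(* The time set is [0,\<infinity>); the values Y t for t < 0 are never constrained. *)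
locale levy_process = prob_space M
  for M :: "'w measure" and Y :: "real \<Rightarrow> 'w \<Rightarrow> real" +
  assumes random_variable: "t \<ge> 0 \<Longrightarrow> Y t \<in> borel_measurable M"
    and starts_at_zero: "AE \<omega> in M. Y 0 \<omega> = 0"
    and independent_increments:
      "mono p \<Longrightarrow> p 0 \<ge> 0 \<Longrightarrow>
         indep_vars (\<lambda>_. borel) (\<lambda>i \<omega>. Y (p (Suc i)) \<omega> - Y (p i) \<omega>) {..<n::nat}"
    and stationary_increments:
      "s \<ge> 0 \<Longrightarrow> h \<ge> 0 \<Longrightarrow>
         distr M borel (\<lambda>\<omega>. Y (s + h) \<omega> - Y s \<omega>) = distr M borel (\<lambda>\<omega>. Y h \<omega> - Y 0 \<omega>)"
    and stochastically_continuous: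
      "t \<ge> 0 \<Longrightarrow> \<epsilon> > 0 \<Longrightarrow>
         ((\<lambda>s. prob {\<omega> \<in> space M. \<bar>Y s \<omega> - Y t \<omega>\<bar> > \<epsilon>}) \<longlongrightarrow> 0) (at t within {0..})"
    and cadlag_paths: "AE \<omega> in M. cadlag (\<lambda>t. Y t \<omega>)"

(* p 0 \<le> ... \<le> p n are the nodes; repeated nodes are harmless. *)
definition interval_partition :: "real \<Rightarrow> real \<Rightarrow> nat \<Rightarrow> (nat \<Rightarrow> real) \<Rightarrow> bool" where
  "interval_partition a b n p \<longleftrightarrow> p 0 = a \<and> p n = b \<and> (\<forall>i<n. p i \<le> p (Suc i))"

definition bounded_variation_on :: "real \<Rightarrow> real \<Rightarrow> (real \<Rightarrow> real) \<Rightarrow> bool" where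
  "bounded_variation_on a b y \<longleftrightarrow>
     (\<exists>B. \<forall>n p. interval_partition a b n p \<longrightarrow> (\<Sum>i<n. \<bar>y (p (Suc i)) - y (p i)\<bar>) \<le> B)"

(* A trajectory on [0,\<infinity>) has bounded variation if it does so on compact time intervals.
   (Total variation over the whole half-line would be the wrong notion: it is infinite for
   a Poisson process.) *)
definition locally_bounded_variation :: "(real \<Rightarrow> real) \<Rightarrow> bool" where
  "locally_bounded_variation y \<longleftrightarrow> (\<forall>T>0. bounded_variation_on 0 T y)"

(* The integral of a deterministic integrand g over [a,b] against dY: the limit in probability,
   as the mesh tends to 0, of the integrals of the left-endpoint step approximations of g.
   For continuous g this is the usual stochastic integral. It determines I up to null sets. *)
definition has_stochastic_integral ::
  "'w measure \<Rightarrow> (real \<Rightarrow> 'w \<Rightarrow> real) \<Rightarrow> (real \<Rightarrow> real) \<Rightarrow> real \<Rightarrow> real \<Rightarrow> ('w \<Rightarrow> real) \<Rightarrow> bool" where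
  "has_stochastic_integral M Y g a b I \<longleftrightarrow>
     I \<in> borel_measurable M \<and>
     (\<forall>\<epsilon>>0. \<exists>\<delta>>0. \<forall>n p.
        interval_partition a b n p \<and> (\<forall>i<n. p (Suc i) - p i < \<delta>) \<longrightarrow>
        measure M {\<omega> \<in> space M.
          \<bar>(\<Sum>i<n. g (p i) * (Y (p (Suc i)) \<omega> - Y (p i) \<omega>)) - I \<omega>\<bar> > \<epsilon>} < \<epsilon>)"

(* X t z \<omega> is the value at z of X(t). Each X t z is determined only up to a null set, so a
   mild solution is any version of the random field of the stochastic integrals. *)
definition mild_solution ::
  "'w measure \<Rightarrow> (real \<Rightarrow> 'w \<Rightarrow> real) \<Rightarrow> (real \<Rightarrow> real) \<Rightarrow> (real \<Rightarrow> real \<Rightarrow> 'w \<Rightarrow> real) \<Rightarrow> bool" where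
  "mild_solution M Y f X \<longleftrightarrow>
     (\<forall>t\<ge>0. \<forall>z\<in>{0..2*pi}.
        has_stochastic_integral M Y (\<lambda>s. rotation (t - s) f z) 0 t (X t z))"

(* A function on [0,2pi], taken as a function on the circle, is an element of C(S). *)
definition in_circle_continuous :: "(real \<Rightarrow> real) \<Rightarrow> bool" where
  "in_circle_continuous x \<longleftrightarrow> (\<exists>g\<in>circle_continuous. \<forall>z\<in>{0..2*pi}. x z = g z)"

end

theory Submission
  imports Defs
begin

text \<open>At time \<open>2\<pi>\<close> the mild solution is \<open>z \<mapsto> \<integral> f (z +
2\<pi> - s) dY s\<close>, the convolution on the circle of \<open>f\<close> with the random set
function \<open>dY\<close> on \<open>[0,2\<pi>]\<close>. If the paths had bounded variation,
\<open>dY\<close> would be a measure and the convolution would be continuous and bounded by a random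
multiple of \<open>sup \<bar>f\<bar>\<close>. When the variation is infinite this bound fails in the
strongest way: for every \<open>R\<close> there is a continuous \<open>g\<close> with
\<open>\<bar>g\<bar> \<le> 1\<close> whose convolution exceeds \<open>R\<close> in modulus somewhere
on a finite set of points, with probability as close to 1 as desired
(\<open>resonant_function\<close>). A Baire category argument in the Banach space of periodic
continuous functions (\<open>Baire_closed_subspace\<close>, \<open>resonates_dense_interior\<close>)
then yields a single \<open>f\<close> that does this for every \<open>R\<close>, so that \<open>X
(2\<pi>)\<close> is almost surely unbounded on the circle, whereas a continuous function on the
circle is bounded.

The function \<open>g\<close> is explicit. Cut the circle into \<open>m\<close> windows and let
\<open>g\<close> be, on the \<open>a\<close>-th window, a bump times a cosine of frequency \<open>q
^ (a + 1)\<close>, where \<open>q\<close> is a large multiple of 4. A translation of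
\<open>g\<close> by a small amount hardly moves the bumps, but it turns the phases of the cosines,
and since the frequencies are so far apart the \<open>m\<close> phases can be set independently to
any multiples of \<open>\<pi>/2\<close> (\<open>carrier_wave_translate\<close>). Let \<open>U
a\<close> and \<open>V a\<close> be the cosine and sine integrals over the \<open>a\<close>-th
window. Choosing the phases according to the path, some translate of \<open>g\<close> has integral
about \<open>\<Sum>a. max \<bar>U a\<bar> \<bar>V a\<bar>\<close>. The summands belong to disjoint
windows, so they are independent, and by an exponential Chebyshev bound the sum is large as soon as
\<open>\<Sum>a. E (min 1 (\<bar>U a\<bar> + \<bar>V a\<bar>))\<close> is
(\<open>resonance_prob\<close>).

Those expectations are bounded below by comparison with \<open>Y\<close> itself. Truncate the fine
increments by \<open>sin\<close> and centre them. For sums of independent centred variables,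
deleting summands or shrinking weights does not increase the mean absolute value
(\<open>contraction_principle\<close>), so the weighted sums dominate, up to a constant factor, the
plain sum over the middle half of the window, which is an increment of \<open>Y\<close>
(\<open>sector_comparison\<close>). Truncation and centring cost only a multiple of the length of
the window. Hence the sum over the windows is at least a constant times \<open>m E (min 1 \<bar>Y
(\<pi>/m) - Y 0\<bar>)\<close>, up to a bounded error. Along \<open>m = 2 ^ k\<close> this is
unbounded: otherwise the dyadic sums of \<open>min 1 \<bar>dY\<bar>\<close>, which increase under
refinement, would have a finite limit almost surely, and the paths would be of bounded variation
(\<open>locally_bounded_variation_if_truncated_means_bounded\<close>).

All estimates on increments come from one fact about the characteristic function \<open>\<phi>
h\<close> of an increment over a time \<open>h\<close>: \<open>\<bar>1 - \<phi> h u\<bar>\<close> is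
at most \<open>C h\<close> for \<open>\<bar>u\<bar> \<le> 1\<close>, with a factor in place of
\<open>C\<close> that tends to 0 with \<open>u\<close> (\<open>\<phi>_lipschitz\<close>,
\<open>\<phi>_small\<close>). The same fact shows that step integrands that are uniformly small have
small integrals in probability, which gives the existence of the integrals.\<close>

section \<open>Convergence and union bounds in probability\<close>

lemma (in prob_space) prob_abs_sum_gt:
  fixes f g :: "'a \<Rightarrow> real"
  assumes [measurable]: "f \<in> borel_measurable M" "g \<in> borel_measurable M"
  shows "prob {\<omega> \<in> space M. x + y < \<bar>f \<omega> + g \<omega>\<bar>}
    \<le> prob {\<omega> \<in> space M. x < \<bar>f \<omega>\<bar>} + prob {\<omega> \<in> space M. y < \<bar>g \<omega>\<bar>}"
proof -
  have "prob {\<omega> \<in> space M. x + y < \<bar>f \<omega> + g \<omega>\<bar>}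
      \<le> prob ({\<omega> \<in> space M. x < \<bar>f \<omega>\<bar>} \<union> {\<omega> \<in> space M. y < \<bar>g \<omega>\<bar>})"
    by (intro finite_measure_mono) auto
  also have "\<dots> \<le> prob {\<omega> \<in> space M. x < \<bar>f \<omega>\<bar>} + prob {\<omega> \<in> space M. y < \<bar>g \<omega>\<bar>}"
    by (intro measure_Un_le) auto
  finally show ?thesis .
qed

text \<open>Dominated convergence applied to the indicators of the exceptional sets.\<close>
lemma (in prob_space) AE_tendsto_imp_prob_tendsto:
  fixes f :: "nat \<Rightarrow> 'a \<Rightarrow> real"
  assumes [measurable]: "\<And>k. f k \<in> borel_measurable M" "g \<in> borel_measurable M"
    and lim: "AE \<omega> in M. (\<lambda>k. f k \<omega>) \<longlonglongrightarrow> g \<omega>" and \<eta>: "0 < \<eta>"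
  shows "(\<lambda>k. prob {\<omega> \<in> space M. \<eta> < \<bar>f k \<omega> - g \<omega>\<bar>}) \<longlonglongrightarrow> 0"
proof -
  have "(\<lambda>k. expectation (\<lambda>\<omega>. indicator {\<omega> \<in> space M. \<eta> < \<bar>f k \<omega> - g \<omega>\<bar>} \<omega>)) \<longlonglongrightarrow> expectation (\<lambda>\<omega>. 0::real)"
  proof (rule integral_dominated_convergence[where w="\<lambda>_. 1"])
    show "AE \<omega> in M. (\<lambda>k. indicator {\<omega> \<in> space M. \<eta> < \<bar>f k \<omega> - g \<omega>\<bar>} \<omega>) \<longlonglongrightarrow> (0::real)"
      using lim
    proof eventually_elim
      case (elim \<omega>)
      from tendstoD[OF this \<eta>]
      have "\<forall>\<^sub>F k in sequentially. indicator {\<omega> \<in> space M. \<eta> < \<bar>f k \<omega> - g \<omega>\<bar>} \<omega> = (0::real)"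
        by eventually_elim (auto simp: dist_real_def indicator_def)
      then show ?case by (rule tendsto_eventually)
    qed
  qed (auto simp: indicator_def)
  then show ?thesis by (simp add: Int_def conj_commute cong: conj_cong)
qed

text \<open>If \<open>A\<close> is bounded by \<open>R\<close> on a finite set then so is
\<open>B\<close> by \<open>R + 1\<close>, unless \<open>A\<close> and \<open>B\<close> differ by
more than 1 at some point. In this form lower bounds for suprema are passed from one approximation
of the solution to the next.\<close>
lemma (in prob_space) prob_all_le_perturb:
  fixes A B :: "'i \<Rightarrow> 'a \<Rightarrow> real" and R \<eta> :: real
  assumes fin: "finite Z" and [measurable]: "\<And>z. z \<in> Z \<Longrightarrow> A z \<in> borel_measurable M"
    "\<And>z. z \<in> Z \<Longrightarrow> B z \<in> borel_measurable M"
    and \<eta>: "\<And>z. z \<in> Z \<Longrightarrow> prob {\<omega> \<in> space M. 1 < \<bar>B z \<omega> - A z \<omega>\<bar>} \<le> \<eta>"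
  shows "prob {\<omega> \<in> space M. \<forall>z\<in>Z. \<bar>A z \<omega>\<bar> \<le> R}
    \<le> prob {\<omega> \<in> space M. \<forall>z\<in>Z. \<bar>B z \<omega>\<bar> \<le> R + 1} + card Z * \<eta>"
proof -
  let ?D = "\<lambda>z. {\<omega> \<in> space M. 1 < \<bar>B z \<omega> - A z \<omega>\<bar>}"
  have "prob {\<omega> \<in> space M. \<forall>z\<in>Z. \<bar>A z \<omega>\<bar> \<le> R}
    \<le> prob ({\<omega> \<in> space M. \<forall>z\<in>Z. \<bar>B z \<omega>\<bar> \<le> R + 1} \<union> (\<Union>z\<in>Z. ?D z))"
  proof (rule finite_measure_mono)
    show "{\<omega> \<in> space M. \<forall>z\<in>Z. \<bar>A z \<omega>\<bar> \<le> R}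
      \<subseteq> {\<omega> \<in> space M. \<forall>z\<in>Z. \<bar>B z \<omega>\<bar> \<le> R + 1} \<union> (\<Union>z\<in>Z. ?D z)"
    proof safe
      fix \<omega> z assume "\<omega> \<in> space M" "\<forall>z\<in>Z. \<bar>A z \<omega>\<bar> \<le> R" "\<omega> \<notin> (\<Union>z\<in>Z. ?D z)" "z \<in> Z"
      then have "\<bar>B z \<omega> - A z \<omega>\<bar> \<le> 1" "\<bar>A z \<omega>\<bar> \<le> R" by auto
      then show "\<bar>B z \<omega>\<bar> \<le> R + 1" by linarith
    qed
  qed (use fin in \<open>auto intro!: sets.Un sets.finite_UN\<close>)
  also have "\<dots> \<le> prob {\<omega> \<in> space M. \<forall>z\<in>Z. \<bar>B z \<omega>\<bar> \<le> R + 1} + prob (\<Union>z\<in>Z. ?D z)"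
    using fin by (intro measure_Un_le sets.finite_UN) auto
  also have "prob (\<Union>z\<in>Z. ?D z) \<le> (\<Sum>z\<in>Z. prob (?D z))"
    by (intro measure_UNION_le fin) auto
  also have "\<dots> \<le> card Z * \<eta>" using sum_bounded_above[of Z "\<lambda>z. prob (?D z)" \<eta>] \<eta> by simp
  finally show ?thesis by simp
qed

section \<open>Sums of independent random variables\<close>

text \<open>Conditionally on \<open>S\<close> this is Jensen's inequality. The proof avoids
conditioning: \<open>\<bar>S + Z\<bar>\<close> is at least \<open>sgn S * (S + Z)\<close>, and
\<open>sgn S\<close> is independent of the centred variable \<open>Z\<close>.\<close>
lemma (in prob_space) expectation_abs_le_add_centered:
  fixes S Z :: "'a \<Rightarrow> real"
  assumes ind: "indep_var borel Z borel S"
    and S: "integrable M S" and Z: "integrable M Z" and centered: "expectation Z = 0"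
  shows "expectation (\<lambda>\<omega>. \<bar>S \<omega>\<bar>) \<le> expectation (\<lambda>\<omega>. \<bar>S \<omega> + Z \<omega>\<bar>)"
proof -
  have [measurable]: "S \<in> borel_measurable M" "Z \<in> borel_measurable M"
    using S Z by auto
  have sgn: "integrable M (\<lambda>\<omega>. sgn (S \<omega>))"
    by (rule integrable_const_bound[where B=1]) (auto simp: sgn_if)
  have ind': "indep_var borel Z borel (\<lambda>\<omega>. sgn (S \<omega>))"
    using indep_var_compose[OF ind, of id borel sgn borel] by (simp add: comp_def)
  have int: "integrable M (\<lambda>\<omega>. Z \<omega> * sgn (S \<omega>))"
    by (rule indep_var_integrable[OF ind' Z sgn])
  have prod: "expectation (\<lambda>\<omega>. Z \<omega> * sgn (S \<omega>)) = 0"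
    using indep_var_lebesgue_integral[OF ind' Z sgn] centered by simp
  have "expectation (\<lambda>\<omega>. \<bar>S \<omega>\<bar>) = expectation (\<lambda>\<omega>. \<bar>S \<omega>\<bar> + Z \<omega> * sgn (S \<omega>))"
    using S int prod by simp
  also have "\<dots> \<le> expectation (\<lambda>\<omega>. \<bar>S \<omega> + Z \<omega>\<bar>)"
    using S Z int by (intro integral_mono) (auto simp: sgn_if)
  finally show ?thesis .
qed

lemma (in prob_space) indep_vars_scale:
  fixes X :: "'i \<Rightarrow> 'a \<Rightarrow> real"
  assumes "indep_vars (\<lambda>_. borel) X I"
  shows "indep_vars (\<lambda>_. borel) (\<lambda>i \<omega>. c i * X i \<omega>) I"
  using indep_vars_compose2[OF assms, of "\<lambda>i x. c i * x" "\<lambda>_. borel"] by simp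

text \<open>Shrink the weights one at a time. As a function of a single weight the mean is convex
and, by \<open>expectation_abs_le_add_centered\<close>, minimal at 0, hence it increases on
\<open>[0,1]\<close>.\<close>
lemma (in prob_space) contraction_principle:
  fixes X :: "'i \<Rightarrow> 'a \<Rightarrow> real"
  assumes fin: "finite I" and ind: "indep_vars (\<lambda>_. borel) X I"
    and int: "\<And>i. i \<in> I \<Longrightarrow> integrable M (X i)"
    and centered: "\<And>i. i \<in> I \<Longrightarrow> expectation (X i) = 0"
    and t: "\<And>i. i \<in> I \<Longrightarrow> 0 \<le> t i \<and> t i \<le> 1"
  shows "expectation (\<lambda>\<omega>. \<bar>\<Sum>i\<in>I. t i * X i \<omega>\<bar>) \<le> expectation (\<lambda>\<omega>. \<bar>\<Sum>i\<in>I. X i \<omega>\<bar>)"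
proof -
  define u where "u J i = (if i \<in> J then t i else 1)" for J i
  have "expectation (\<lambda>\<omega>. \<bar>\<Sum>i\<in>I. u J i * X i \<omega>\<bar>) \<le> expectation (\<lambda>\<omega>. \<bar>\<Sum>i\<in>I. X i \<omega>\<bar>)"
    if "J \<subseteq> I" for J
    using finite_subset[OF that fin] that
  proof (induction J rule: finite_induct)
    case empty
    then show ?case by (simp add: u_def)
  next
    case (insert j J)
    define S where "S \<omega> = (\<Sum>i\<in>I - {j}. u J i * X i \<omega>)" for \<omega>
    have j: "j \<in> I" "insert j (I - {j}) = I" using insert by auto
    have "indep_vars (\<lambda>_. borel) (\<lambda>i \<omega>. u J i * X i \<omega>) (insert j (I - {j}))"
      using indep_vars_scale[OF ind, of "u J"] j by simp
    from indep_vars_sum[OF _ _ this] fin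
    have ind': "indep_var borel (X j) borel S"
      using insert by (simp add: S_def[abs_def] u_def)
    have intS: "integrable M S"
      unfolding S_def[abs_def] by (intro Bochner_Integration.integrable_sum integrable_mult_right int) auto
    have intX: "integrable M (X j)" using int j by simp
    have split: "(\<Sum>i\<in>I. u (insert j J) i * X i \<omega>) = S \<omega> + t j * X j \<omega>"
      "(\<Sum>i\<in>I. u J i * X i \<omega>) = S \<omega> + X j \<omega>" for \<omega>
      using insert fin j unfolding S_def
      by (auto simp: sum.remove[of I j] u_def add.commute intro!: sum.cong)
    have "expectation (\<lambda>\<omega>. \<bar>S \<omega> + t j * X j \<omega>\<bar>)
        \<le> expectation (\<lambda>\<omega>. (1 - t j) * \<bar>S \<omega>\<bar> + t j * \<bar>S \<omega> + X j \<omega>\<bar>)"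
    proof (intro integral_mono)
      fix \<omega>
      have "\<bar>S \<omega> + t j * X j \<omega>\<bar> = \<bar>(1 - t j) * S \<omega> + t j * (S \<omega> + X j \<omega>)\<bar>"
        by (simp add: algebra_simps)
      also have "\<dots> \<le> (1 - t j) * \<bar>S \<omega>\<bar> + t j * \<bar>S \<omega> + X j \<omega>\<bar>"
        using t[OF j(1)] by (intro order_trans[OF abs_triangle_ineq]) (simp add: abs_mult)
      finally show "\<bar>S \<omega> + t j * X j \<omega>\<bar> \<le> (1 - t j) * \<bar>S \<omega>\<bar> + t j * \<bar>S \<omega> + X j \<omega>\<bar>" .
    qed (use intS intX in auto)
    also have "\<dots> = (1 - t j) * expectation (\<lambda>\<omega>. \<bar>S \<omega>\<bar>) + t j * expectation (\<lambda>\<omega>. \<bar>S \<omega> + X j \<omega>\<bar>)"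
      using intS intX by simp
    also have "\<dots> \<le> (1 - t j) * expectation (\<lambda>\<omega>. \<bar>S \<omega> + X j \<omega>\<bar>) + t j * expectation (\<lambda>\<omega>. \<bar>S \<omega> + X j \<omega>\<bar>)"
      using t[OF j(1)] expectation_abs_le_add_centered[OF ind' intS intX centered[OF j(1)]]
      by (intro add_right_mono mult_left_mono) auto
    also have "\<dots> = expectation (\<lambda>\<omega>. \<bar>S \<omega> + X j \<omega>\<bar>)"
      by (simp add: algebra_simps)
    finally show ?case
      using insert unfolding split by force
  qed
  from this[of I] show ?thesis by (simp add: u_def cong: sum.cong)
qed

lemma (in prob_space) expectation_square_sum_centered:
  fixes X :: "'i \<Rightarrow> 'a \<Rightarrow> real"
  assumes fin: "finite I" and ind: "indep_vars (\<lambda>_. borel) X I"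
    and bnd: "\<And>i \<omega>. i \<in> I \<Longrightarrow> \<bar>X i \<omega>\<bar> \<le> B"
    and centered: "\<And>i. i \<in> I \<Longrightarrow> expectation (X i) = 0"
  shows "expectation (\<lambda>\<omega>. (\<Sum>i\<in>I. X i \<omega>)\<^sup>2) = (\<Sum>i\<in>I. expectation (\<lambda>\<omega>. (X i \<omega>)\<^sup>2))"
  using fin ind bnd centered
proof (induction I rule: finite_induct)
  case empty
  then show ?case by simp
next
  case (insert j I)
  define S where "S \<omega> = (\<Sum>i\<in>I. X i \<omega>)" for \<omega>
  have rv: "X i \<in> borel_measurable M" if "i \<in> insert j I" for i
    using insert(4) that by (auto simp: indep_vars_def)
  then have [measurable]: "S \<in> borel_measurable M" "X j \<in> borel_measurable M"
    unfolding S_def[abs_def] by auto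
  have bS: "\<bar>S \<omega>\<bar> \<le> real (card I) * B" for \<omega>
    unfolding S_def using insert(5)
    by (intro order_trans[OF sum_abs] order_trans[OF sum_bounded_above]) auto
  have bX: "\<bar>X j \<omega>\<bar> \<le> B" for \<omega> using insert(5) by auto
  have sq: "(S \<omega>)\<^sup>2 \<le> (real (card I) * B)\<^sup>2" "(X j \<omega>)\<^sup>2 \<le> B\<^sup>2" for \<omega>
    using bS[of \<omega>] bX[of \<omega>] by (auto simp: abs_le_square_iff[symmetric])
  have int: "integrable M S" "integrable M (X j)"
    "integrable M (\<lambda>\<omega>. (S \<omega>)\<^sup>2)" "integrable M (\<lambda>\<omega>. (X j \<omega>)\<^sup>2)"
    by (rule integrable_const_bound, use bS bX sq in force, measurable)+
  have ind': "indep_var borel (X j) borel S"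
    using indep_vars_sum[OF insert(1,2,4)] by (simp add: S_def[abs_def])
  have int2: "integrable M (\<lambda>\<omega>. X j \<omega> * S \<omega>)"
    by (rule indep_var_integrable[OF ind' int(2,1)])
  have zero: "expectation (\<lambda>\<omega>. X j \<omega> * S \<omega>) = 0"
    using indep_var_lebesgue_integral[OF ind' int(2,1)] insert(6)[of j] by simp
  have "expectation (\<lambda>\<omega>. (\<Sum>i\<in>insert j I. X i \<omega>)\<^sup>2)
     = expectation (\<lambda>\<omega>. (X j \<omega>)\<^sup>2 + (S \<omega>)\<^sup>2 + 2 * (X j \<omega> * S \<omega>))"
    using insert(1,2) by (simp add: S_def power2_sum algebra_simps)
  also have "\<dots> = expectation (\<lambda>\<omega>. (X j \<omega>)\<^sup>2) + expectation (\<lambda>\<omega>. (S \<omega>)\<^sup>2)"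
    using int int2 zero by simp
  also have "expectation (\<lambda>\<omega>. (S \<omega>)\<^sup>2) = (\<Sum>i\<in>I. expectation (\<lambda>\<omega>. (X i \<omega>)\<^sup>2))"
    unfolding S_def
    using insert.IH[OF indep_vars_subset[OF insert(4)] insert(5) insert(6)] by auto
  finally show ?case using insert(1,2) by simp
qed

text \<open>The exponential Chebyshev bound, with \<open>exp (- q) \<le> 1 - q / 2\<close> on
\<open>[0,1]\<close>. A sum of independent variables in \<open>[0,1]\<close> is large with high
probability as soon as its mean is.\<close>
lemma (in prob_space) prob_sum_le_exp:
  fixes Q :: "'i \<Rightarrow> 'a \<Rightarrow> real"
  assumes fin: "finite I" and ind: "indep_vars (\<lambda>_. borel) Q I"
    and bnd: "\<And>i \<omega>. i \<in> I \<Longrightarrow> 0 \<le> Q i \<omega> \<and> Q i \<omega> \<le> 1"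
  shows "prob {\<omega> \<in> space M. (\<Sum>i\<in>I. Q i \<omega>) \<le> R} \<le> exp (R - (\<Sum>i\<in>I. expectation (Q i)) / 2)"
proof -
  have rv [measurable]: "Q i \<in> borel_measurable M" if "i \<in> I" for i
    using ind that by (auto simp: indep_vars_def)
  have intQ: "integrable M (Q i)" if "i \<in> I" for i
    using bnd that by (intro integrable_const_bound[where B=1]) auto
  have ind': "indep_vars (\<lambda>_. borel) (\<lambda>i \<omega>. exp (- Q i \<omega>)) I"
    using indep_vars_compose2[OF ind, of "\<lambda>i x. exp (- x)" "\<lambda>_. borel"] by simp
  have inte: "integrable M (\<lambda>\<omega>. exp (- Q i \<omega>))" if "i \<in> I" for i
    using bnd that by (intro integrable_const_bound[where B=1]) auto
  have intp: "integrable M (\<lambda>\<omega>. \<Prod>i\<in>I. exp (- Q i \<omega>))"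
    by (rule indep_vars_integrable[OF fin ind' inte])
  have factor: "expectation (\<lambda>\<omega>. exp (- Q i \<omega>)) \<le> exp (- expectation (Q i) / 2)" if i: "i \<in> I" for i
  proof -
    have "expectation (\<lambda>\<omega>. exp (- Q i \<omega>)) \<le> expectation (\<lambda>\<omega>. 1 - Q i \<omega> / 2)"
    proof (intro integral_mono)
      fix \<omega>
      have q: "0 \<le> Q i \<omega>" "Q i \<omega> \<le> 1" using bnd i by auto
      have "1 \<le> (1 + Q i \<omega>) * (1 - Q i \<omega> / 2)"
        using mult_left_le[OF q(2,1)] q by (simp add: algebra_simps)
      also have "\<dots> \<le> exp (Q i \<omega>) * (1 - Q i \<omega> / 2)"
        using q by (intro mult_right_mono exp_ge_add_one_self) auto
      finally show "exp (- Q i \<omega>) \<le> 1 - Q i \<omega> / 2"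
        by (simp add: exp_minus field_simps)
    qed (use intQ inte i in auto)
    also have "\<dots> = 1 - expectation (Q i) / 2"
      using intQ i by (simp add: prob_space)
    also have "\<dots> \<le> exp (- expectation (Q i) / 2)"
      using exp_ge_add_one_self[of "- expectation (Q i) / 2"] by simp
    finally show ?thesis .
  qed
  have "prob {\<omega> \<in> space M. (\<Sum>i\<in>I. Q i \<omega>) \<le> R}
      \<le> prob {\<omega> \<in> space M. exp (- R) \<le> (\<Prod>i\<in>I. exp (- Q i \<omega>))}"
    using fin by (intro finite_measure_mono) (auto simp: exp_sum[symmetric] sum_negf)
  also have "\<dots> \<le> expectation (\<lambda>\<omega>. \<Prod>i\<in>I. exp (- Q i \<omega>)) / exp (- R)"
    by (intro integral_Markov_inequality_measure[where A="{}"] intp) (auto intro!: prod_nonneg)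
  also have "expectation (\<lambda>\<omega>. \<Prod>i\<in>I. exp (- Q i \<omega>)) = (\<Prod>i\<in>I. expectation (\<lambda>\<omega>. exp (- Q i \<omega>)))"
    by (rule indep_vars_lebesgue_integral[OF fin ind' inte])
  also have "\<dots> \<le> (\<Prod>i\<in>I. exp (- expectation (Q i) / 2))"
    using factor by (intro prod_mono) auto
  also have "\<dots> = exp (- (\<Sum>i\<in>I. expectation (Q i)) / 2)"
    using fin by (simp add: exp_sum[symmetric] sum_negf sum_divide_distrib)
  also have "exp (- (\<Sum>i\<in>I. expectation (Q i)) / 2) / exp (- R) = exp (R - (\<Sum>i\<in>I. expectation (Q i)) / 2)"
    by (simp add: exp_diff[symmetric])
  finally show ?thesis
    by (simp add: divide_right_mono)
qed

lemma abs_sin_diff_le: "\<bar>x - sin x\<bar> \<le> (x::real)\<^sup>2"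
proof -
  have "\<bar>sin x - (\<Sum>m<2. sin_coeff m * x ^ m)\<bar> \<le> inverse (fact 2) * \<bar>x\<bar> ^ 2"
    by (rule Maclaurin_sin_bound)
  moreover have "(\<Sum>m<2. sin_coeff m * x ^ m) = x"
    by (simp add: numeral_2_eq_2 sin_coeff_def)
  ultimately have "\<bar>sin x - x\<bar> \<le> x\<^sup>2 / 2" by simp
  moreover have "0 \<le> x\<^sup>2" by simp
  ultimately show ?thesis unfolding abs_le_iff by linarith
qed

lemma sin_square_le: "(sin x)\<^sup>2 \<le> min 1 ((x::real)\<^sup>2)"
proof -
  have "(sin x)\<^sup>2 \<le> x\<^sup>2"
    using abs_sin_x_le_abs_x[of x] by (simp add: abs_le_square_iff)
  then show ?thesis by (simp add: abs_square_le_1)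
qed

lemma min_1_abs_sum_le:
  fixes x :: "'i \<Rightarrow> real"
  assumes "finite I"
  shows "min 1 \<bar>\<Sum>i\<in>I. x i\<bar> \<le> (\<Sum>i\<in>I. min 1 \<bar>x i\<bar>)"
  using assms by (induction I rule: finite_induct) (auto simp: min_def split: if_splits)

text \<open>Replacing \<open>X i\<close> by \<open>sin (X i)\<close> and subtracting the mean
changes the sum by little when the \<open>X i\<close> are small: pointwise \<open>\<bar>x - sin
x\<bar> \<le> x\<^sup>2\<close>, and the means are at most \<open>v i\<close>. In the second bound
\<open>W\<close> stands without truncation because its second moment is at most
\<open>\<Sum>i\<in>I. v i\<close>. What is gained is that \<open>W\<close> is a sum of independent
centred variables, to which the contraction principle applies.\<close>
lemma (in prob_space) truncated_sum_vs_centered_sum: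
  fixes X :: "'i \<Rightarrow> 'a \<Rightarrow> real" and c :: "'i \<Rightarrow> real"
  assumes fin: "finite I" and ind: "indep_vars (\<lambda>_. borel) X I"
    and c: "\<And>i. i \<in> I \<Longrightarrow> \<bar>c i\<bar> \<le> 1"
    and v: "\<And>i. i \<in> I \<Longrightarrow> expectation (\<lambda>\<omega>. min 1 ((X i \<omega>)\<^sup>2)) \<le> v i"
      "\<And>i. i \<in> I \<Longrightarrow> \<bar>expectation (\<lambda>\<omega>. sin (X i \<omega>))\<bar> \<le> v i"
  defines "W \<equiv> \<lambda>\<omega>. \<Sum>i\<in>I. c i * (sin (X i \<omega>) - expectation (\<lambda>\<omega>. sin (X i \<omega>)))"
  shows "expectation (\<lambda>\<omega>. min 1 \<bar>\<Sum>i\<in>I. c i * X i \<omega>\<bar>) \<le> expectation (\<lambda>\<omega>. \<bar>W \<omega>\<bar>) + 2 * (\<Sum>i\<in>I. v i)"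
    and "expectation (\<lambda>\<omega>. \<bar>W \<omega>\<bar>) \<le> expectation (\<lambda>\<omega>. min 1 \<bar>\<Sum>i\<in>I. c i * X i \<omega>\<bar>) + 3 * (\<Sum>i\<in>I. v i)"
proof -
  define \<beta> where "\<beta> i = expectation (\<lambda>\<omega>. sin (X i \<omega>))" for i
  define U where "U \<omega> = (\<Sum>i\<in>I. c i * X i \<omega>)" for \<omega>
  define V where "V \<omega> = (\<Sum>i\<in>I. min 1 ((X i \<omega>)\<^sup>2) + v i)" for \<omega>
  have rv [measurable]: "X i \<in> borel_measurable M" if "i \<in> I" for i
    using ind that by (auto simp: indep_vars_def)
  have [measurable]: "U \<in> borel_measurable M" "W \<in> borel_measurable M" "V \<in> borel_measurable M"
    unfolding U_def[abs_def] W_def V_def[abs_def] by measurable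
  have intm: "integrable M (\<lambda>\<omega>. min 1 ((X i \<omega>)\<^sup>2))" if "i \<in> I" for i
    using that by (intro integrable_const_bound[where B=1]) auto
  have ints: "integrable M (\<lambda>\<omega>. sin (X i \<omega>))" if "i \<in> I" for i
    using that by (intro integrable_const_bound[where B=1]) auto
  have intss: "integrable M (\<lambda>\<omega>. (sin (X i \<omega>))\<^sup>2)" if "i \<in> I" for i
    using that by (intro integrable_const_bound[where B=1]) (auto simp: abs_square_le_1)
  have intU: "integrable M (\<lambda>\<omega>. min 1 \<bar>U \<omega>\<bar>)" "integrable M (\<lambda>\<omega>. min 1 \<bar>W \<omega>\<bar>)"
    by (auto intro!: integrable_const_bound[where B=1])
  have intV: "integrable M V"
    unfolding V_def[abs_def] using intm by (intro Bochner_Integration.integrable_sum) auto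
  have EV: "expectation V \<le> 2 * (\<Sum>i\<in>I. v i)"
  proof -
    have "expectation V = (\<Sum>i\<in>I. expectation (\<lambda>\<omega>. min 1 ((X i \<omega>)\<^sup>2)) + v i)"
      unfolding V_def using intm by (subst Bochner_Integration.integral_sum) (auto simp: prob_space)
    also have "\<dots> \<le> (\<Sum>i\<in>I. v i + v i)"
      using v by (intro sum_mono add_right_mono) auto
    finally show ?thesis by (simp add: sum_distrib_left)
  qed
  have \<beta>1: "\<bar>\<beta> i\<bar> \<le> 1" if "i \<in> I" for i
  proof -
    have "\<bar>\<beta> i\<bar> \<le> expectation (\<lambda>\<omega>. \<bar>sin (X i \<omega>)\<bar>)"
      unfolding \<beta>_def by (rule integral_abs_bound)
    also have "\<dots> \<le> expectation (\<lambda>\<omega>. 1)"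
      using ints[OF that] by (intro integral_mono) auto
    finally show ?thesis by (simp add: prob_space)
  qed
  have bW: "\<bar>c i * (sin (X i \<omega>) - \<beta> i)\<bar> \<le> 2" if "i \<in> I" for i \<omega>
  proof -
    have "\<bar>c i\<bar> * \<bar>sin (X i \<omega>) - \<beta> i\<bar> \<le> 1 * 2"
      using c[OF that] \<beta>1[OF that] abs_sin_le_one[of "X i \<omega>"] by (intro mult_mono) linarith+
    then show ?thesis by (simp add: abs_mult)
  qed
  have bW': "\<bar>W \<omega>\<bar> \<le> (\<Sum>i\<in>I. 2)" for \<omega>
    unfolding W_def \<beta>_def[symmetric]
    by (rule order_trans[OF sum_abs sum_mono]) (use bW in auto)
  have intW: "integrable M W"
    using bW' by (intro integrable_const_bound[where B="\<Sum>i\<in>I. 2"]) auto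
  have intW2: "integrable M (\<lambda>\<omega>. (W \<omega>)\<^sup>2)"
  proof (rule integrable_const_bound[where B="(\<Sum>i\<in>I. 2)\<^sup>2"], rule AE_I2)
    fix \<omega> show "norm ((W \<omega>)\<^sup>2) \<le> (\<Sum>i\<in>I. 2)\<^sup>2"
      using power_mono[OF bW'[of \<omega>], of 2] by simp
  qed measurable
  have close: "min 1 \<bar>U \<omega> - W \<omega>\<bar> \<le> V \<omega>" for \<omega>
  proof -
    have "U \<omega> - W \<omega> = (\<Sum>i\<in>I. c i * (X i \<omega> - sin (X i \<omega>) + \<beta> i))"
      unfolding U_def W_def \<beta>_def by (simp add: sum_subtractf[symmetric] algebra_simps)
    then have "min 1 \<bar>U \<omega> - W \<omega>\<bar> \<le> (\<Sum>i\<in>I. min 1 \<bar>c i * (X i \<omega> - sin (X i \<omega>) + \<beta> i)\<bar>)"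
      using min_1_abs_sum_le[OF fin] by simp
    also have "\<dots> \<le> V \<omega>" unfolding V_def
    proof (rule sum_mono)
      fix i assume i: "i \<in> I"
      have "\<bar>c i\<bar> * \<bar>X i \<omega> - sin (X i \<omega>) + \<beta> i\<bar> \<le> 1 * ((X i \<omega>)\<^sup>2 + v i)"
        using c[OF i] abs_sin_diff_le[of "X i \<omega>"] v(2)[OF i]
        by (intro mult_mono order_trans[OF abs_triangle_ineq add_mono]) (auto simp: \<beta>_def)
      moreover have "0 \<le> v i" using v(2)[OF i] by linarith
      ultimately show "min 1 \<bar>c i * (X i \<omega> - sin (X i \<omega>) + \<beta> i)\<bar> \<le> min 1 ((X i \<omega>)\<^sup>2) + v i"
        by (auto simp: abs_mult min_def)
    qed
    finally show ?thesis .
  qed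
  have "expectation (\<lambda>\<omega>. min 1 \<bar>U \<omega>\<bar>) \<le> expectation (\<lambda>\<omega>. \<bar>W \<omega>\<bar> + V \<omega>)"
  proof (rule integral_mono)
    fix \<omega> show "min 1 \<bar>U \<omega>\<bar> \<le> \<bar>W \<omega>\<bar> + V \<omega>"
      using close[of \<omega>] by linarith
  qed (use intU intW intV in auto)
  then show "expectation (\<lambda>\<omega>. min 1 \<bar>\<Sum>i\<in>I. c i * X i \<omega>\<bar>) \<le> expectation (\<lambda>\<omega>. \<bar>W \<omega>\<bar>) + 2 * (\<Sum>i\<in>I. v i)"
    using EV intW intV by (simp add: U_def)
  have "expectation (\<lambda>\<omega>. (W \<omega>)\<^sup>2) = (\<Sum>i\<in>I. expectation (\<lambda>\<omega>. (c i * (sin (X i \<omega>) - \<beta> i))\<^sup>2))"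
    unfolding W_def \<beta>_def[symmetric]
  proof (rule expectation_square_sum_centered[OF fin _ bW])
    show "indep_vars (\<lambda>_. borel) (\<lambda>i \<omega>. c i * (sin (X i \<omega>) - \<beta> i)) I"
      using indep_vars_compose2[OF ind, of "\<lambda>i x. c i * (sin x - \<beta> i)" "\<lambda>_. borel"] by simp
    show "expectation (\<lambda>\<omega>. c i * (sin (X i \<omega>) - \<beta> i)) = 0" if "i \<in> I" for i
      using ints[OF that] by (simp add: prob_space \<beta>_def)
  qed auto
  also have "\<dots> \<le> (\<Sum>i\<in>I. v i)"
  proof (rule sum_mono)
    fix i assume i: "i \<in> I"
    have "expectation (\<lambda>\<omega>. (c i * (sin (X i \<omega>) - \<beta> i))\<^sup>2)
        = (c i)\<^sup>2 * expectation (\<lambda>\<omega>. (sin (X i \<omega>))\<^sup>2 - 2 * \<beta> i * sin (X i \<omega>) + (\<beta> i)\<^sup>2)"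
      unfolding integral_mult_right_zero[symmetric]
      by (rule Bochner_Integration.integral_cong) (auto simp: power2_eq_square algebra_simps)
    also have "\<dots> = (c i)\<^sup>2 * (expectation (\<lambda>\<omega>. (sin (X i \<omega>))\<^sup>2) - (\<beta> i)\<^sup>2)"
      using ints[OF i] intss[OF i] by (simp add: prob_space \<beta>_def[symmetric] power2_eq_square)
    also have "\<dots> \<le> (c i)\<^sup>2 * expectation (\<lambda>\<omega>. (sin (X i \<omega>))\<^sup>2)"
      by (intro mult_left_mono) auto
    also have "\<dots> \<le> 1 * expectation (\<lambda>\<omega>. (sin (X i \<omega>))\<^sup>2)"
      using c[OF i] by (intro mult_right_mono) (auto simp: abs_square_le_1)
    also have "\<dots> \<le> 1 * expectation (\<lambda>\<omega>. min 1 ((X i \<omega>)\<^sup>2))"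
      using intm[OF i] intss[OF i] sin_square_le by (intro mult_left_mono integral_mono) auto
    finally show "expectation (\<lambda>\<omega>. (c i * (sin (X i \<omega>) - \<beta> i))\<^sup>2) \<le> v i"
      using v(1)[OF i] by simp
  qed
  finally have EW2: "expectation (\<lambda>\<omega>. (W \<omega>)\<^sup>2) \<le> (\<Sum>i\<in>I. v i)" .
  have "expectation (\<lambda>\<omega>. \<bar>W \<omega>\<bar>) \<le> expectation (\<lambda>\<omega>. min 1 \<bar>U \<omega>\<bar> + V \<omega> + (W \<omega>)\<^sup>2)"
  proof (rule integral_mono)
    fix \<omega>
    have "\<bar>W \<omega>\<bar> \<le> min 1 \<bar>W \<omega>\<bar> + (W \<omega>)\<^sup>2"
    proof (cases "\<bar>W \<omega>\<bar> \<le> 1")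
      case False
      then have "\<bar>W \<omega>\<bar> * 1 \<le> \<bar>W \<omega>\<bar> * \<bar>W \<omega>\<bar>" by (intro mult_left_mono) auto
      then show ?thesis using False by (simp add: power2_eq_square)
    qed auto
    moreover have "min 1 \<bar>W \<omega>\<bar> \<le> min 1 \<bar>U \<omega>\<bar> + min 1 \<bar>U \<omega> - W \<omega>\<bar>"
      by (auto simp: min_def)
    ultimately show "\<bar>W \<omega>\<bar> \<le> min 1 \<bar>U \<omega>\<bar> + V \<omega> + (W \<omega>)\<^sup>2"
      using close[of \<omega>] by linarith
  qed (use intU intW intV intW2 in auto)
  then show "expectation (\<lambda>\<omega>. \<bar>W \<omega>\<bar>) \<le> expectation (\<lambda>\<omega>. min 1 \<bar>\<Sum>i\<in>I. c i * X i \<omega>\<bar>) + 3 * (\<Sum>i\<in>I. v i)"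
    using EV EW2 intU intV intW2 by (simp add: U_def)
qed

text \<open>A lower bound for weighted sums by an unweighted one, for weights that need not have a
constant sign and may vanish, provided that on \<open>J\<close> one of the two weights is large. The
set \<open>J\<close> is split into four parts according to which weight is large and what its sign
is, and the contraction principle is applied to each part with the weights \<open>\<kappa> / \<bar>c
i\<bar>\<close>. For the cosine and sine of the same argument as weights the condition holds with
\<open>\<kappa> = 1/2\<close>.\<close>
lemma (in prob_space) sector_comparison:
  fixes X :: "'i \<Rightarrow> 'a \<Rightarrow> real" and c s :: "'i \<Rightarrow> real"
  assumes fin: "finite I" and ind: "indep_vars (\<lambda>_. borel) X I" and J: "J \<subseteq> I"
    and c: "\<And>i. i \<in> I \<Longrightarrow> \<bar>c i\<bar> \<le> 1" and s: "\<And>i. i \<in> I \<Longrightarrow> \<bar>s i\<bar> \<le> 1"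
    and \<kappa>: "0 < \<kappa>" "\<And>i. i \<in> J \<Longrightarrow> \<kappa> \<le> \<bar>c i\<bar> \<or> \<kappa> \<le> \<bar>s i\<bar>"
    and v: "\<And>i. i \<in> I \<Longrightarrow> expectation (\<lambda>\<omega>. min 1 ((X i \<omega>)\<^sup>2)) \<le> v i"
      "\<And>i. i \<in> I \<Longrightarrow> \<bar>expectation (\<lambda>\<omega>. sin (X i \<omega>))\<bar> \<le> v i"
  shows "\<kappa> * expectation (\<lambda>\<omega>. min 1 \<bar>\<Sum>i\<in>J. X i \<omega>\<bar>)
    \<le> 2 * (expectation (\<lambda>\<omega>. min 1 \<bar>\<Sum>i\<in>I. c i * X i \<omega>\<bar>) + expectation (\<lambda>\<omega>. min 1 \<bar>\<Sum>i\<in>I. s i * X i \<omega>\<bar>))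
       + (12 + 2 * \<kappa>) * (\<Sum>i\<in>I. v i)"
proof -
  define \<eta> where "\<eta> i \<omega> = sin (X i \<omega>) - expectation (\<lambda>\<omega>. sin (X i \<omega>))" for i \<omega>
  define E where "E A d = expectation (\<lambda>\<omega>. \<bar>\<Sum>i\<in>A. d i * \<eta> i \<omega>\<bar>)" for A d
  have rv [measurable]: "X i \<in> borel_measurable M" if "i \<in> I" for i
    using ind that by (auto simp: indep_vars_def)
  have ints: "integrable M (\<lambda>\<omega>. sin (X i \<omega>))" if "i \<in> I" for i
    using that by (intro integrable_const_bound[where B=1]) auto
  have int\<eta>: "integrable M (\<eta> i)" if "i \<in> I" for i
    unfolding \<eta>_def[abs_def] using ints[OF that] by simp
  have cen\<eta>: "expectation (\<lambda>\<omega>. d * \<eta> i \<omega>) = 0" if "i \<in> I" for i d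
    unfolding \<eta>_def[abs_def] using ints[OF that] by (simp add: prob_space)
  have ind\<eta>: "indep_vars (\<lambda>_. borel) (\<lambda>i \<omega>. d i * \<eta> i \<omega>) I" for d
    unfolding \<eta>_def
    using indep_vars_compose2[OF ind, of "\<lambda>i x. d i * (sin x - expectation (\<lambda>\<omega>. sin (X i \<omega>)))" "\<lambda>_. borel"]
    by simp
  have vpos: "0 \<le> v i" if "i \<in> I" for i using v(2)[OF that] by linarith
  have part: "\<kappa> * E A (\<lambda>_. 1) \<le> E I d"
    if A: "A \<subseteq> I" and \<sigma>: "\<bar>\<sigma>\<bar> = 1" "\<And>i. i \<in> A \<Longrightarrow> \<kappa> \<le> \<sigma> * d i" for A d and \<sigma> :: real
  proof -
    \<comment> \<open>These factors turn the weights \<open>d i\<close> into the constant \<open>\<sigma> * \<kappa>\<close> on \<open>A\<close> and into 0 elsewhere.\<close>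
    define t where "t i = (if i \<in> A then \<kappa> / (\<sigma> * d i) else 0)" for i
    have t: "0 \<le> t i \<and> t i \<le> 1" for i
      using \<sigma>(2)[of i] \<kappa>(1) by (auto simp: t_def field_simps)
    have "(\<Sum>i\<in>I. t i * (d i * \<eta> i \<omega>)) = \<sigma> * \<kappa> * (\<Sum>i\<in>A. 1 * \<eta> i \<omega>)" for \<omega>
    proof -
      have "(\<Sum>i\<in>I. t i * (d i * \<eta> i \<omega>)) = (\<Sum>i\<in>A. t i * (d i * \<eta> i \<omega>))"
        using fin A by (intro sum.mono_neutral_right) (auto simp: t_def)
      also have "\<dots> = (\<Sum>i\<in>A. \<sigma> * \<kappa> * (1 * \<eta> i \<omega>))"
      proof (rule sum.cong)
        fix i assume i: "i \<in> A"
        have "\<sigma> * \<sigma> = 1" using \<sigma>(1) by (cases "\<sigma> \<ge> 0") auto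
        moreover have "\<sigma> \<noteq> 0" "d i \<noteq> 0" using \<sigma>(2)[OF i] \<kappa>(1) by auto
        ultimately show "t i * (d i * \<eta> i \<omega>) = \<sigma> * \<kappa> * (1 * \<eta> i \<omega>)"
          using i by (simp add: t_def divide_simps)
      qed auto
      finally show ?thesis by (simp add: sum_distrib_left)
    qed
    then have "E I (\<lambda>i. t i * d i) = \<kappa> * E A (\<lambda>_. 1)"
      using \<sigma>(1) \<kappa>(1) unfolding E_def by (simp add: abs_mult mult.assoc)
    moreover have "E I (\<lambda>i. t i * d i) \<le> E I d"
      unfolding E_def mult.assoc
      using contraction_principle[OF fin ind\<eta>[of d] _ cen\<eta>, of t] int\<eta> t by auto
    ultimately show ?thesis by simp
  qed
  define J1 J2 J3 J4 where "J1 = {i\<in>J. \<kappa> \<le> c i}" and "J2 = {i\<in>J. \<kappa> \<le> - c i}"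
    and "J3 = {i\<in>J. \<bar>c i\<bar> < \<kappa> \<and> \<kappa> \<le> s i}" and "J4 = {i\<in>J. \<bar>c i\<bar> < \<kappa> \<and> \<kappa> \<le> - s i}"
  note Jdefs = J1_def J2_def J3_def J4_def
  have finJ: "finite J" using fin J finite_subset by auto
  have sub: "J1 \<subseteq> I" "J2 \<subseteq> I" "J3 \<subseteq> I" "J4 \<subseteq> I" using J by (auto simp: Jdefs)
  have split: "(\<Sum>i\<in>J. 1 * \<eta> i \<omega>)
      = (\<Sum>i\<in>J1. 1 * \<eta> i \<omega>) + (\<Sum>i\<in>J2. 1 * \<eta> i \<omega>) + (\<Sum>i\<in>J3. 1 * \<eta> i \<omega>) + (\<Sum>i\<in>J4. 1 * \<eta> i \<omega>)" for \<omega>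
  proof -
    have "J = ((J1 \<union> J2) \<union> J3) \<union> J4"
    proof (intro equalityI subsetI)
      fix i assume i: "i \<in> J"
      show "i \<in> ((J1 \<union> J2) \<union> J3) \<union> J4"
        using \<kappa>(2)[OF i] i unfolding Jdefs by (auto simp: abs_if split: if_splits)
    qed (auto simp: Jdefs)
    moreover have "finite J1" "finite J2" "finite J3" "finite J4"
      using finJ by (auto simp: Jdefs)
    moreover have "J1 \<inter> J2 = {}" "(J1 \<union> J2) \<inter> J3 = {}" "((J1 \<union> J2) \<union> J3) \<inter> J4 = {}"
      using \<kappa>(1) by (auto simp: Jdefs)
    ultimately show ?thesis
      by (simp only: sum.union_disjoint finite_Un)
  qed
  have intA: "integrable M (\<lambda>\<omega>. \<bar>\<Sum>i\<in>A. 1 * \<eta> i \<omega>\<bar>)" if "A \<subseteq> I" for A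
    using that int\<eta> by (intro integrable_abs Bochner_Integration.integrable_sum) auto
  have "E J (\<lambda>_. 1) \<le> E J1 (\<lambda>_. 1) + E J2 (\<lambda>_. 1) + E J3 (\<lambda>_. 1) + E J4 (\<lambda>_. 1)"
  proof -
    have "E J (\<lambda>_. 1) \<le> expectation (\<lambda>\<omega>. \<bar>\<Sum>i\<in>J1. 1 * \<eta> i \<omega>\<bar> + \<bar>\<Sum>i\<in>J2. 1 * \<eta> i \<omega>\<bar>
       + \<bar>\<Sum>i\<in>J3. 1 * \<eta> i \<omega>\<bar> + \<bar>\<Sum>i\<in>J4. 1 * \<eta> i \<omega>\<bar>)"
      unfolding E_def
    proof (rule integral_mono)
      fix \<omega> show "\<bar>\<Sum>i\<in>J. 1 * \<eta> i \<omega>\<bar> \<le> \<bar>\<Sum>i\<in>J1. 1 * \<eta> i \<omega>\<bar> + \<bar>\<Sum>i\<in>J2. 1 * \<eta> i \<omega>\<bar>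
       + \<bar>\<Sum>i\<in>J3. 1 * \<eta> i \<omega>\<bar> + \<bar>\<Sum>i\<in>J4. 1 * \<eta> i \<omega>\<bar>"
        unfolding split by linarith
    qed (use intA sub J in auto)
    also have "\<dots> = E J1 (\<lambda>_. 1) + E J2 (\<lambda>_. 1) + E J3 (\<lambda>_. 1) + E J4 (\<lambda>_. 1)"
      using intA[OF sub(1)] intA[OF sub(2)] intA[OF sub(3)] intA[OF sub(4)]
      unfolding E_def by simp
    finally show ?thesis .
  qed
  then have "\<kappa> * E J (\<lambda>_. 1)
      \<le> \<kappa> * E J1 (\<lambda>_. 1) + \<kappa> * E J2 (\<lambda>_. 1) + \<kappa> * E J3 (\<lambda>_. 1) + \<kappa> * E J4 (\<lambda>_. 1)"
    using \<kappa>(1) by (simp add: distrib_left[symmetric])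
  also have "\<dots> \<le> E I c + E I c + E I s + E I s"
    using part[OF sub(1), of 1 c] part[OF sub(2), of "-1" c] part[OF sub(3), of 1 s]
      part[OF sub(4), of "-1" s] by (simp add: Jdefs)
  finally have main: "\<kappa> * E J (\<lambda>_. 1) \<le> 2 * (E I c + E I s)" by simp
  have Ec: "E I c \<le> expectation (\<lambda>\<omega>. min 1 \<bar>\<Sum>i\<in>I. c i * X i \<omega>\<bar>) + 3 * (\<Sum>i\<in>I. v i)"
    unfolding E_def \<eta>_def by (rule truncated_sum_vs_centered_sum(2)[OF fin ind c v])
  have Es: "E I s \<le> expectation (\<lambda>\<omega>. min 1 \<bar>\<Sum>i\<in>I. s i * X i \<omega>\<bar>) + 3 * (\<Sum>i\<in>I. v i)"
    unfolding E_def \<eta>_def by (rule truncated_sum_vs_centered_sum(2)[OF fin ind s v])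
  have "expectation (\<lambda>\<omega>. min 1 \<bar>\<Sum>i\<in>J. 1 * X i \<omega>\<bar>) \<le> E J (\<lambda>_. 1) + 2 * (\<Sum>i\<in>J. v i)"
    unfolding E_def \<eta>_def using J v
    by (intro truncated_sum_vs_centered_sum(1)[OF finJ indep_vars_subset[OF ind J]]) auto
  also have "(\<Sum>i\<in>J. v i) \<le> (\<Sum>i\<in>I. v i)"
    using J fin vpos by (intro sum_mono2) auto
  finally have "\<kappa> * expectation (\<lambda>\<omega>. min 1 \<bar>\<Sum>i\<in>J. X i \<omega>\<bar>)
      \<le> \<kappa> * (E J (\<lambda>_. 1) + 2 * (\<Sum>i\<in>I. v i))"
    using \<kappa>(1) by simp
  also have "\<dots> = \<kappa> * E J (\<lambda>_. 1) + 2 * \<kappa> * (\<Sum>i\<in>I. v i)"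
    by (simp add: algebra_simps)
  finally show ?thesis
    using main Ec Es by (simp add: algebra_simps)
qed

section \<open>Characteristic functions near zero\<close>

text \<open>Taylor's formula on \<open>(0,2]\<close>, and \<open>\<bar>sin x\<bar> \<le> 1\<close>
beyond.\<close>
lemma min_1_square_le_one_minus_sinc:
  fixes x :: real
  assumes "x \<noteq> 0"
  shows "min 1 (x\<^sup>2) \<le> 8 * (1 - sin x / x)"
proof -
  have pos: "min 1 (x\<^sup>2) \<le> 8 * (1 - sin x / x)" if x: "x > 0" for x :: real
  proof (cases "x \<le> 2")
    case True
    have "\<bar>sin x - (\<Sum>m<5. sin_coeff m * x ^ m)\<bar> \<le> inverse (fact 5) * \<bar>x\<bar> ^ 5"
      by (rule Maclaurin_sin_bound)
    moreover have "(\<Sum>m<5. sin_coeff m * x ^ m) = x - x ^ 3 / 6"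
      by (simp add: lessThan_nat_numeral lessThan_Suc sin_coeff_def fact_numeral)
    ultimately have "sin x \<le> x - x ^ 3 / 6 + x ^ 5 / 120"
      using x abs_ge_self[of "sin x - (x - x ^ 3 / 6)"] by (simp add: fact_numeral)
    then have "sin x / x \<le> (x - x ^ 3 / 6 + x ^ 5 / 120) / x"
      using x by (intro divide_right_mono) auto
    also have "\<dots> = 1 - x\<^sup>2 * (1 / 6 - x\<^sup>2 / 120)"
      using x by (simp add: field_simps eval_nat_numeral)
    also have "\<dots> \<le> 1 - x\<^sup>2 * (1 / 8)"
    proof -
      have "x\<^sup>2 \<le> 2\<^sup>2" using True x by (intro power_mono) auto
      then have "x\<^sup>2 * (1 / 8) \<le> x\<^sup>2 * (1 / 6 - x\<^sup>2 / 120)"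
        by (intro mult_left_mono) auto
      then show ?thesis by simp
    qed
    finally show ?thesis by (simp add: min_def)
  next
    case False
    have "sin x / x \<le> 1 / x" using x by (intro divide_right_mono) auto
    also have "\<dots> \<le> 1 / 2" using False by (simp add: field_simps)
    finally show ?thesis by simp
  qed
  show ?thesis
    using pos[of x] pos[of "- x"] assms by (cases "x > 0") auto
qed

text \<open>Average \<open>1 - cos (u X)\<close>, whose mean is \<open>Re (1 - char u)\<close>, over
\<open>u \<in> [0,1]\<close>. By Fubini this is the mean of \<open>1 - sin X / X\<close>. A single
\<open>u\<close> would not do, since \<open>cos (u x) = 1\<close> for arbitrarily large
\<open>x\<close>.\<close>
lemma (in prob_space) truncated_moment_le_char:
  fixes X :: "'a \<Rightarrow> real"
  assumes [measurable]: "X \<in> borel_measurable M"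
    and B: "\<And>u. 0 \<le> u \<Longrightarrow> u \<le> 1 \<Longrightarrow> cmod (1 - char (distr M borel X) u) \<le> B"
  shows "expectation (\<lambda>\<omega>. min 1 ((X \<omega>)\<^sup>2)) \<le> 8 * B"
proof -
  define N where "N = restrict_space lborel {0..1::real}"
  interpret N: finite_measure N
    by (rule finite_measureI) (simp add: N_def space_restrict_space emeasure_restrict_space)
  interpret P: pair_sigma_finite M N ..
  interpret PF: finite_measure "M \<Otimes>\<^sub>M N"
    by (rule finite_measure_pair_measure) unfold_locales
  have [measurable]: "(\<lambda>u::real. u) \<in> borel_measurable N"
    unfolding N_def by (rule measurable_restrict_space1) simp
  have mass: "measure N (space N) = 1"
    by (simp add: N_def space_restrict_space measure_restrict_space)
  have int: "integrable (M \<Otimes>\<^sub>M N) (\<lambda>(\<omega>, u). 1 - cos (u * X \<omega>))"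
  proof (rule PF.integrable_const_bound[where B=2])
    show "(\<lambda>(\<omega>, u). 1 - cos (u * X \<omega>)) \<in> borel_measurable (M \<Otimes>\<^sub>M N)"
      by measurable
    have "\<bar>1 - cos y\<bar> \<le> 2" for y :: real
      using cos_le_one[of y] cos_ge_minus_one[of y] by linarith
    then show "AE x in M \<Otimes>\<^sub>M N. norm (case x of (\<omega>, u) \<Rightarrow> 1 - cos (u * X \<omega>)) \<le> 2"
      by (simp add: split_beta)
  qed
  have inner: "(\<integral>u. 1 - cos (u * x) \<partial>N) = 1 - sin x / x" if "x \<noteq> 0" for x
  proof -
    have "(\<integral>u. 1 - cos (u * x) \<partial>N) = (\<integral>u. (1 - cos (u * x)) * indicator {0..1} u \<partial>lborel)"
      unfolding N_def by (subst integral_restrict_space) (auto simp: mult.commute)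
    also have "\<dots> = (1 - sin (1 * x) / x) - (0 - sin (0 * x) / x)"
      using that by (intro integral_FTC_Icc_real) (auto intro!: derivative_eq_intros continuous_intros)
    finally show ?thesis by simp
  qed
  have "expectation (\<lambda>\<omega>. min 1 ((X \<omega>)\<^sup>2)) \<le> expectation (\<lambda>\<omega>. 8 * (\<integral>u. 1 - cos (u * X \<omega>) \<partial>N))"
  proof (rule integral_mono)
    show "integrable M (\<lambda>\<omega>. min 1 ((X \<omega>)\<^sup>2))"
      by (rule integrable_const_bound[where B=1]) auto
    show "integrable M (\<lambda>\<omega>. 8 * (\<integral>u. 1 - cos (u * X \<omega>) \<partial>N))"
      using P.integrable_fst'[OF int] by simp
    fix \<omega> show "min 1 ((X \<omega>)\<^sup>2) \<le> 8 * (\<integral>u. 1 - cos (u * X \<omega>) \<partial>N)"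
      using inner[of "X \<omega>"] min_1_square_le_one_minus_sinc[of "X \<omega>"] by (cases "X \<omega> = 0") auto
  qed
  also have "\<dots> = 8 * (\<integral>\<omega>. (\<integral>u. 1 - cos (u * X \<omega>) \<partial>N) \<partial>M)"
    by simp
  also have "(\<integral>\<omega>. (\<integral>u. 1 - cos (u * X \<omega>) \<partial>N) \<partial>M) = (\<integral>u. (\<integral>\<omega>. 1 - cos (u * X \<omega>) \<partial>M) \<partial>N)"
    using P.Fubini_integral[OF int] by simp
  also have "\<dots> \<le> (\<integral>u. B \<partial>N)"
  proof (rule integral_mono)
    show "integrable N (\<lambda>u. \<integral>\<omega>. 1 - cos (u * X \<omega>) \<partial>M)"
      using P.integrable_snd[OF int] by simp
    show "integrable N (\<lambda>u. B)" by simp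
    fix u assume "u \<in> space N"
    then have u: "0 \<le> u" "u \<le> 1" by (auto simp: N_def space_restrict_space)
    have i: "integrable M (\<lambda>\<omega>. iexp (u * X \<omega>))"
      using integrable_iexp[of "\<lambda>\<omega>. of_real (u * X \<omega>)"] by simp
    have "expectation (\<lambda>\<omega>. 1 - cos (u * X \<omega>)) = expectation (\<lambda>\<omega>. Re (1 - iexp (u * X \<omega>)))"
      by (simp add: Re_exp)
    also have "\<dots> = Re (1 - char (distr M borel X) u)"
      using i by (subst integral_Re) (auto simp: char_def integral_distr prob_space)
    also have "\<dots> \<le> B" using B[OF u] complex_Re_le_cmod order_trans by blast
    finally show "expectation (\<lambda>\<omega>. 1 - cos (u * X \<omega>)) \<le> B" .
  qed
  also have "\<dots> = B" using mass by simp
  finally show ?thesis by simp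
qed
text \<open>The powers stay in the half plane \<open>Re \<ge> 1/2\<close>, so the factor \<open>1 +
w + \<dots> + w^(n-1)\<close> of \<open>1 - w^n\<close> has modulus at least \<open>n/2\<close>.
This turns a bound at time \<open>n h\<close> into a bound at time \<open>h\<close> that is smaller
by a factor of order \<open>n\<close>.\<close>
lemma cmod_one_minus_le_power:
  fixes w :: complex
  assumes "\<And>k. k \<le> n \<Longrightarrow> cmod (1 - w ^ k) \<le> 1 / 2"
  shows "real n * cmod (1 - w) \<le> 2 * cmod (1 - w ^ n)"
proof -
  have "1 / 2 \<le> Re (w ^ k)" if "k \<le> n" for k
    using assms[OF that] complex_Re_le_cmod[of "1 - w ^ k"] by simp
  then have "(\<Sum>k<n. 1 / 2) \<le> (\<Sum>k<n. Re (w ^ k))"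
    by (intro sum_mono) auto
  also have "\<dots> \<le> cmod (\<Sum>k<n. w ^ k)"
    using complex_Re_le_cmod[of "\<Sum>k<n. w ^ k"] by simp
  finally have "real n / 2 \<le> cmod (\<Sum>k<n. w ^ k)" by simp
  then have "real n / 2 * cmod (1 - w) \<le> cmod (\<Sum>k<n. w ^ k) * cmod (1 - w)"
    by (intro mult_right_mono) auto
  also have "\<dots> = cmod (1 - w ^ n)"
    by (simp add: one_diff_power_eq norm_mult mult.commute)
  finally show ?thesis by simp
qed

lemma (in prob_space) char_distr_scale:
  fixes X :: "'a \<Rightarrow> real"
  assumes [measurable]: "X \<in> borel_measurable M"
  shows "char (distr M borel (\<lambda>\<omega>. c * X \<omega>)) u = char (distr M borel X) (c * u)"
  by (simp add: char_def integral_distr mult_ac)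

lemma (in prob_space) cmod_char_distr_le_1:
  fixes X :: "'a \<Rightarrow> real"
  assumes [measurable]: "X \<in> borel_measurable M"
  shows "cmod (char (distr M borel X) u) \<le> 1"
proof -
  interpret D: real_distribution "distr M borel X"
    by (simp add: real_distribution_distr)
  show ?thesis by (rule D.cmod_char_le_1)
qed

text \<open>\<open>\<bar>1 - exp (\<i> u x)\<bar>\<close> is at most \<open>\<bar>x\<bar>\<close>
and at most 2.\<close>
lemma (in prob_space) cmod_one_minus_char_le:
  fixes X :: "'a \<Rightarrow> real"
  assumes [measurable]: "X \<in> borel_measurable M" and u: "\<bar>u\<bar> \<le> 1" and \<epsilon>: "0 \<le> \<epsilon>"
  shows "cmod (1 - char (distr M borel X) u) \<le> \<epsilon> + 2 * prob {\<omega> \<in> space M. \<epsilon> < \<bar>X \<omega>\<bar>}"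
proof -
  let ?A = "{\<omega> \<in> space M. \<epsilon> < \<bar>X \<omega>\<bar>}"
  have i: "integrable M (\<lambda>\<omega>. iexp (u * X \<omega>))"
    using integrable_iexp[of "\<lambda>\<omega>. of_real (u * X \<omega>)"] by simp
  have "cmod (1 - char (distr M borel X) u) = cmod (CLINT \<omega>|M. 1 - iexp (u * X \<omega>))"
    using i by (simp add: char_def integral_distr prob_space)
  also have "\<dots> \<le> expectation (\<lambda>\<omega>. cmod (1 - iexp (u * X \<omega>)))"
    by (rule integral_norm_bound)
  also have "\<dots> \<le> expectation (\<lambda>\<omega>. \<epsilon> + 2 * indicator ?A \<omega>)"
  proof (rule integral_mono)
    show "integrable M (\<lambda>\<omega>. cmod (1 - iexp (u * X \<omega>)))" using i by simp
    fix \<omega> assume \<omega>: "\<omega> \<in> space M"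
    have 1: "cmod (1 - iexp (u * X \<omega>)) \<le> \<bar>u * X \<omega>\<bar>"
      using iexp_approx1[of "u * X \<omega>" 0] by (simp add: norm_minus_commute)
    have 2: "cmod (1 - iexp (u * X \<omega>)) \<le> 2"
      using norm_triangle_ineq4[of 1 "iexp (u * X \<omega>)"] norm_exp_i_times[of "u * X \<omega>"] by simp
    have 3: "\<bar>u * X \<omega>\<bar> \<le> 1 * \<bar>X \<omega>\<bar>"
      unfolding abs_mult using u by (intro mult_right_mono) auto
    show "cmod (1 - iexp (u * X \<omega>)) \<le> \<epsilon> + 2 * indicator ?A \<omega>"
      using 1 2 3 \<epsilon> \<omega> by (cases "\<epsilon> < \<bar>X \<omega>\<bar>") auto
  qed (auto simp: integrable_indicator_iff less_top[symmetric])
  also have "\<dots> = \<epsilon> + 2 * prob ?A"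
    by (simp add: prob_space integrable_indicator_iff less_top[symmetric])
  finally show ?thesis .
qed

lemma (in prob_space) abs_expectation_sin_le_char:
  fixes X :: "'a \<Rightarrow> real"
  assumes [measurable]: "X \<in> borel_measurable M"
  shows "\<bar>expectation (\<lambda>\<omega>. sin (X \<omega>))\<bar> \<le> cmod (1 - char (distr M borel X) 1)"
proof -
  have i: "integrable M (\<lambda>\<omega>. iexp (X \<omega>))"
    using integrable_iexp[of "\<lambda>\<omega>. of_real (X \<omega>)"] by simp
  have "expectation (\<lambda>\<omega>. sin (X \<omega>)) = expectation (\<lambda>\<omega>. Im (iexp (X \<omega>)))"
    by (simp add: Im_exp)
  also have "\<dots> = Im (char (distr M borel X) 1)"
    using i by (simp add: char_def integral_distr)
  finally show ?thesis
    using abs_Im_le_cmod[of "1 - char (distr M borel X) 1"] by simp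
qed

section \<open>Increments of a Levy process\<close>

lemma partition_nonneg:
  assumes p: "interval_partition a b n p" and i: "i \<le> n"
  shows "a \<le> p i" "p i \<le> b"
proof -
  have mono: "p i \<le> p j" if "i \<le> j" "j \<le> n" for i j
    using that by (induction j rule: dec_induct)
      (use p in \<open>auto simp: interval_partition_def intro: order_trans\<close>)
  show "a \<le> p i" "p i \<le> b"
    using mono[of 0 i] mono[of i n] p i by (auto simp: interval_partition_def)
qed

context levy_process
begin

definition \<phi> :: "real \<Rightarrow> real \<Rightarrow> complex" where
  "\<phi> h = char (distr M borel (\<lambda>\<omega>. Y h \<omega> - Y 0 \<omega>))"

lemma increment_measurable [measurable]:
  "0 \<le> s \<Longrightarrow> 0 \<le> t \<Longrightarrow> (\<lambda>\<omega>. Y t \<omega> - Y s \<omega>) \<in> borel_measurable M"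
  using random_variable by measurable

lemma char_increment:
  assumes "0 \<le> s" "s \<le> t"
  shows "char (distr M borel (\<lambda>\<omega>. Y t \<omega> - Y s \<omega>)) = \<phi> (t - s)"
  using stationary_increments[of s "t - s"] assms by (simp add: \<phi>_def)

lemma cmod_\<phi>_le_1: "0 \<le> h \<Longrightarrow> cmod (\<phi> h u) \<le> 1"
  unfolding \<phi>_def by (rule cmod_char_distr_le_1) simp

text \<open>The independence axiom speaks of globally monotone sequences of times, so the partition
is continued constantly after its last node.\<close>
lemma partition_indep:
  assumes p: "interval_partition a b n p" and a: "0 \<le> a"
  shows "indep_vars (\<lambda>_. borel) (\<lambda>i \<omega>. Y (p (Suc i)) \<omega> - Y (p i) \<omega>) {..<n}"
proof -
  define q where "q i = p (min i n)" for i
  have "q i \<le> q (Suc i)" for i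
    using p unfolding q_def interval_partition_def
    by (cases "i < n") (auto simp: min_def)
  then have "mono q" by (simp add: mono_iff_le_Suc)
  moreover have "0 \<le> q 0" using p a by (simp add: q_def interval_partition_def)
  ultimately have "indep_vars (\<lambda>_. borel) (\<lambda>i \<omega>. Y (q (Suc i)) \<omega> - Y (q i) \<omega>) {..<n}"
    by (rule independent_increments)
  then show ?thesis
    by (rule iffD1[OF indep_vars_cong, rotated -1]) (auto simp: q_def min_def)
qed

lemma char_weighted_increments:
  assumes p: "interval_partition a b n p" and a: "0 \<le> a"
  shows "char (distr M borel (\<lambda>\<omega>. \<Sum>i<n. d i * (Y (p (Suc i)) \<omega> - Y (p i) \<omega>))) u
    = (\<Prod>i<n. \<phi> (p (Suc i) - p i) (d i * u))"
proof -
  have *: "0 \<le> p i" "p i \<le> p (Suc i)" "0 \<le> p (Suc i)" if "i < n" for i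
    using partition_nonneg(1)[OF p, of i] partition_nonneg(1)[OF p, of "Suc i"] p a that
    by (auto simp: interval_partition_def)
  have "char (distr M borel (\<lambda>\<omega>. \<Sum>i<n. d i * (Y (p (Suc i)) \<omega> - Y (p i) \<omega>))) u
    = (\<Prod>i<n. char (distr M borel (\<lambda>\<omega>. d i * (Y (p (Suc i)) \<omega> - Y (p i) \<omega>))) u)"
    by (rule char_distr_sum) (rule indep_vars_scale[OF partition_indep[OF p a]])
  also have "\<dots> = (\<Prod>i<n. \<phi> (p (Suc i) - p i) (d i * u))"
    using * by (intro prod.cong) (auto simp: char_distr_scale char_increment)
  finally show ?thesis .
qed

lemma \<phi>_0: "\<phi> 0 u = 1"
  by (simp add: \<phi>_def char_def integral_distr prob_space del: distr_const)

lemma \<phi>_add: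
  assumes "0 \<le> s" "0 \<le> t"
  shows "\<phi> (s + t) u = \<phi> s u * \<phi> t u"
proof -
  define p where "p i = (if i = 0 then 0 else if i = 1 then s else s + t)" for i :: nat
  have p: "interval_partition 0 (s + t) 2 p"
    using assms by (auto simp: interval_partition_def p_def less_Suc_eq numeral_2_eq_2)
  have "(\<lambda>\<omega>. \<Sum>i<2. 1 * (Y (p (Suc i)) \<omega> - Y (p i) \<omega>)) = (\<lambda>\<omega>. Y (s + t) \<omega> - Y 0 \<omega>)"
    by (auto simp: p_def numeral_2_eq_2)
  then show ?thesis
    using char_weighted_increments[OF p, of "\<lambda>_. 1" u] by (simp add: \<phi>_def p_def numeral_2_eq_2)
qed

lemma \<phi>_power:
  assumes "0 \<le> h"
  shows "\<phi> (real k * h) u = \<phi> h u ^ k"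
proof (induction k)
  case 0
  then show ?case by (simp add: \<phi>_0)
next
  case (Suc k)
  have "\<phi> (real (Suc k) * h) u = \<phi> (h + real k * h) u" by (simp add: algebra_simps)
  also have "\<dots> = \<phi> h u ^ Suc k" using assms Suc by (simp add: \<phi>_add)
  finally show ?case .
qed

lemma cmod_one_minus_power_le:
  assumes "0 \<le> h"
  shows "cmod (1 - \<phi> h u ^ k) \<le> real k * cmod (1 - \<phi> h u)"
proof -
  have "cmod ((\<Prod>i<k. 1) - (\<Prod>i<k. \<phi> h u)) \<le> (\<Sum>i<k. cmod (1 - \<phi> h u))"
    using cmod_\<phi>_le_1[OF assms] by (intro norm_prod_diff) auto
  then show ?thesis by simp
qed

lemma \<phi>_near_zero:
  assumes \<eta>: "0 < \<eta>"
  obtains \<delta> where "0 < \<delta>" "\<And>h u. 0 \<le> h \<Longrightarrow> h \<le> \<delta> \<Longrightarrow> \<bar>u\<bar> \<le> 1 \<Longrightarrow> cmod (1 - \<phi> h u) \<le> \<eta>"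
proof -
  have "((\<lambda>s. prob {\<omega> \<in> space M. \<bar>Y s \<omega> - Y 0 \<omega>\<bar> > \<eta> / 2}) \<longlongrightarrow> 0) (at 0 within {0..})"
    using stochastically_continuous[of 0 "\<eta> / 2"] \<eta> by simp
  then have "\<forall>\<^sub>F s in at 0 within {0..}. prob {\<omega> \<in> space M. \<bar>Y s \<omega> - Y 0 \<omega>\<bar> > \<eta> / 2} < \<eta> / 4"
    by (rule order_tendstoD) (use \<eta> in auto)
  then obtain d where d: "0 < d"
    "\<And>s. s \<in> {0..} \<Longrightarrow> s \<noteq> 0 \<Longrightarrow> dist s 0 < d \<Longrightarrow> prob {\<omega> \<in> space M. \<bar>Y s \<omega> - Y 0 \<omega>\<bar> > \<eta> / 2} < \<eta> / 4"
    unfolding eventually_at by blast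
  show ?thesis
  proof (rule that[of "d / 2"])
    fix h u :: real assume h: "0 \<le> h" "h \<le> d / 2" and u: "\<bar>u\<bar> \<le> 1"
    show "cmod (1 - \<phi> h u) \<le> \<eta>"
    proof (cases "h = 0")
      case False
      have "cmod (1 - \<phi> h u) \<le> \<eta> / 2 + 2 * prob {\<omega> \<in> space M. \<eta> / 2 < \<bar>Y h \<omega> - Y 0 \<omega>\<bar>}"
        unfolding \<phi>_def using h u \<eta> by (intro cmod_one_minus_char_le) auto
      also have "\<dots> \<le> \<eta>"
        using d(2)[of h] h False d(1) by simp
      finally show ?thesis .
    qed (use \<eta> in \<open>simp add: \<phi>_0\<close>)
  qed (use d in auto)
qed

text \<open>A continuous multiplicative function of \<open>h\<close> is exponential, and near
\<open>h = 0\<close> it satisfies \<open>\<bar>1 - \<phi> h\<bar> \<le> const * h\<close>. The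
constant is needed in terms of the size of \<open>1 - \<phi>\<close> on a fixed short interval,
uniformly in \<open>u\<close>, so it is derived from \<open>cmod_one_minus_le_power\<close> rather
than from logarithms. Large \<open>h\<close> are cut into short pieces.\<close>
lemma \<phi>_linear_bound:
  obtains \<delta> where "0 < \<delta>"
    "\<And>u B h. \<bar>u\<bar> \<le> 1 \<Longrightarrow> (\<And>r. 0 \<le> r \<Longrightarrow> r \<le> \<delta> \<Longrightarrow> cmod (1 - \<phi> r u) \<le> B) \<Longrightarrow> 0 \<le> h
      \<Longrightarrow> cmod (1 - \<phi> h u) \<le> 4 / \<delta> * B * h"
proof -
  obtain \<delta> where \<delta>: "0 < \<delta>" "\<And>h u. 0 \<le> h \<Longrightarrow> h \<le> \<delta> \<Longrightarrow> \<bar>u\<bar> \<le> 1 \<Longrightarrow> cmod (1 - \<phi> h u) \<le> 1 / 2"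
    using \<phi>_near_zero[of "1 / 2"] by auto
  have small: "cmod (1 - \<phi> h u) \<le> 4 / \<delta> * B * h"
    if u: "\<bar>u\<bar> \<le> 1" and B: "\<And>r. 0 \<le> r \<Longrightarrow> r \<le> \<delta> \<Longrightarrow> cmod (1 - \<phi> r u) \<le> B" and h: "0 < h" "h \<le> \<delta>" for u B h
  proof -
    define n where "n = nat \<lfloor>\<delta> / h\<rfloor>"
    have r1: "1 \<le> \<delta> / h" using h by (simp add: field_simps)
    have n: "real n \<le> \<delta> / h" "\<delta> / h < real n + 1"
      using r1 unfolding n_def by linarith+
    have nh: "real k * h \<le> \<delta>" if "k \<le> n" for k
    proof -
      have "real k * h \<le> real n * h" using that h by (intro mult_right_mono) auto
      also have "\<dots> \<le> \<delta>" using n(1) h by (simp add: field_simps)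
      finally show ?thesis .
    qed
    have "0 < real n" using n(2) r1 by linarith
    then have "1 \<le> real n" by simp
    then have n2: "\<delta> / h \<le> 2 * real n" using n(2) by linarith
    have "real n * cmod (1 - \<phi> h u) \<le> 2 * cmod (1 - \<phi> h u ^ n)"
      using h u nh \<delta>(2) by (intro cmod_one_minus_le_power) (auto simp: \<phi>_power[symmetric])
    also have "\<dots> \<le> 2 * B"
      using B[of "real n * h"] nh[of n] h by (simp add: \<phi>_power)
    finally have "\<delta> / h * cmod (1 - \<phi> h u) \<le> 4 * B"
      using mult_right_mono[OF n2, of "cmod (1 - \<phi> h u)"] by simp
    then show ?thesis using h \<delta>(1) by (simp add: field_simps)
  qed
  show ?thesis
  proof (rule that[OF \<delta>(1)])
    fix u B h :: real
    assume u: "\<bar>u\<bar> \<le> 1" and B: "\<And>r. 0 \<le> r \<Longrightarrow> r \<le> \<delta> \<Longrightarrow> cmod (1 - \<phi> r u) \<le> B" and h: "0 \<le> h"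
    show "cmod (1 - \<phi> h u) \<le> 4 / \<delta> * B * h"
    proof (cases "h = 0")
      case False
      obtain N where N: "h / \<delta> < real N" using reals_Archimedean2 by blast
      have "0 < h / \<delta>" using h False \<delta>(1) by simp
      then have N0: "0 < real N" using N by linarith
      have hN: "0 < h / real N" "h / real N \<le> \<delta>"
        using N N0 h False \<delta>(1) by (auto simp: field_simps)
      have "cmod (1 - \<phi> h u) = cmod (1 - \<phi> (h / real N) u ^ N)"
        using \<phi>_power[of "h / real N" N u] hN N0 by simp
      also have "\<dots> \<le> real N * cmod (1 - \<phi> (h / real N) u)"
        using hN by (intro cmod_one_minus_power_le) auto
      also have "\<dots> \<le> real N * (4 / \<delta> * B * (h / real N))"
        using small[OF u B hN] by (intro mult_left_mono) auto
      also have "\<dots> = 4 / \<delta> * B * h" using N0 by simp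
      finally show ?thesis .
    qed (simp add: \<phi>_0)
  qed
qed

lemma \<phi>_lipschitz:
  obtains C where "0 < C" "\<And>h u. 0 \<le> h \<Longrightarrow> \<bar>u\<bar> \<le> 1 \<Longrightarrow> cmod (1 - \<phi> h u) \<le> C * h"
proof -
  obtain \<delta> where \<delta>: "0 < \<delta>"
    "\<And>u B h. \<bar>u\<bar> \<le> 1 \<Longrightarrow> (\<And>r. 0 \<le> r \<Longrightarrow> r \<le> \<delta> \<Longrightarrow> cmod (1 - \<phi> r u) \<le> B) \<Longrightarrow> 0 \<le> h
      \<Longrightarrow> cmod (1 - \<phi> h u) \<le> 4 / \<delta> * B * h"
    by (rule \<phi>_linear_bound) blast
  show ?thesis
  proof (rule that[of "4 / \<delta> * 2"])
    fix h u :: real assume "0 \<le> h" "\<bar>u\<bar> \<le> 1"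
    moreover have "cmod (1 - \<phi> r u) \<le> 2" if "0 \<le> r" for r
      using norm_triangle_ineq4[of 1 "\<phi> r u"] cmod_\<phi>_le_1[OF that, of u] by simp
    ultimately show "cmod (1 - \<phi> h u) \<le> 4 / \<delta> * 2 * h"
      by (intro \<delta>(2)) auto
  qed (use \<delta>(1) in auto)
qed

text \<open>Two sources of smallness are combined: on a grid of finitely many times, \<open>\<phi> t
u\<close> tends to 1 with \<open>u\<close> because characteristic functions are continuous; between
the grid points it varies little by \<open>\<phi>_near_zero\<close>, uniformly in \<open>u\<close>.
Hence \<open>1 - \<phi> t u\<close> is small uniformly in \<open>t \<in> [0,\<delta>]\<close>, and
\<open>\<phi>_linear_bound\<close> makes it linear in time.\<close>
lemma \<phi>_small:
  assumes \<eta>: "0 < \<eta>"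
  obtains r where "0 < r" "\<And>h u. 0 \<le> h \<Longrightarrow> \<bar>u\<bar> \<le> r \<Longrightarrow> cmod (1 - \<phi> h u) \<le> \<eta> * h"
proof -
  obtain \<delta> where \<delta>: "0 < \<delta>"
    "\<And>u B h. \<bar>u\<bar> \<le> 1 \<Longrightarrow> (\<And>r. 0 \<le> r \<Longrightarrow> r \<le> \<delta> \<Longrightarrow> cmod (1 - \<phi> r u) \<le> B) \<Longrightarrow> 0 \<le> h
      \<Longrightarrow> cmod (1 - \<phi> h u) \<le> 4 / \<delta> * B * h"
    by (rule \<phi>_linear_bound) blast
  define \<zeta> where "\<zeta> = \<eta> * \<delta> / 8"
  have \<zeta>: "0 < \<zeta>" using \<eta> \<delta>(1) by (simp add: \<zeta>_def)
  obtain d where d: "0 < d" "\<And>h u. 0 \<le> h \<Longrightarrow> h \<le> d \<Longrightarrow> \<bar>u\<bar> \<le> 1 \<Longrightarrow> cmod (1 - \<phi> h u) \<le> \<zeta>"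
    using \<phi>_near_zero[OF \<zeta>] by auto
  obtain N where N: "\<delta> / d < real N" using reals_Archimedean2 by blast
  interpret D: real_distribution "distr M borel (\<lambda>\<omega>. Y d \<omega> - Y 0 \<omega>)"
    using d(1) by (intro real_distribution_distr) auto
  have "((\<lambda>u. 1 - \<phi> d u) \<longlongrightarrow> 1 - \<phi> d 0) (at 0)"
    using D.isCont_char[of 0] unfolding \<phi>_def isCont_def by (intro tendsto_diff tendsto_const)
  then have "((\<lambda>u. cmod (1 - \<phi> d u)) \<longlongrightarrow> 0) (at 0)"
    using D.char_zero by (auto simp: \<phi>_def intro: tendsto_norm_zero)
  moreover have Npos: "0 < \<zeta> / (real N + 1)" using \<zeta> by simp
  ultimately have "\<forall>\<^sub>F u in at 0. cmod (1 - \<phi> d u) < \<zeta> / (real N + 1)"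
    by (rule order_tendstoD)
  then obtain s where s: "0 < s" "\<And>u. u \<noteq> 0 \<Longrightarrow> dist u 0 < s \<Longrightarrow> cmod (1 - \<phi> d u) < \<zeta> / (real N + 1)"
    unfolding eventually_at by auto
  have s': "cmod (1 - \<phi> d u) \<le> \<zeta> / (real N + 1)" if "\<bar>u\<bar> < s" for u
  proof (cases "u = 0")
    case True
    then show ?thesis using D.char_zero Npos by (simp add: \<phi>_def)
  qed (use s(2)[of u] that in simp)
  show ?thesis
  proof (rule that[of "min 1 (s / 2)"])
    fix h u :: real assume h: "0 \<le> h" and u: "\<bar>u\<bar> \<le> min 1 (s / 2)"
    have "cmod (1 - \<phi> t u) \<le> 2 * \<zeta>" if t: "0 \<le> t" "t \<le> \<delta>" for t
    proof -
      define k where "k = nat \<lfloor>t / d\<rfloor>"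
      have k: "real k \<le> t / d" "t / d < real k + 1"
        using t d(1) unfolding k_def by (auto intro: of_nat_floor)
      have kN: "real k \<le> real N"
        using k(1) N t divide_right_mono[OF t(2), of d] d(1) by linarith
      define r where "r = t - real k * d"
      have r: "0 \<le> r" "r \<le> d" using k d(1) by (auto simp: r_def field_simps)
      have "\<phi> t u = \<phi> d u ^ k * \<phi> r u"
        using \<phi>_add[of "real k * d" r u] r d(1) by (simp add: r_def \<phi>_power)
      then have "cmod (1 - \<phi> t u) = cmod ((1 - \<phi> d u ^ k) + \<phi> d u ^ k * (1 - \<phi> r u))"
        by (simp add: algebra_simps)
      also have "\<dots> \<le> cmod (1 - \<phi> d u ^ k) + cmod (\<phi> d u) ^ k * cmod (1 - \<phi> r u)"
        by (rule order_trans[OF norm_triangle_ineq]) (simp add: norm_mult norm_power)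
      also have "\<dots> \<le> real k * cmod (1 - \<phi> d u) + 1 * cmod (1 - \<phi> r u)"
        using d(1) cmod_\<phi>_le_1[of d u]
        by (intro add_mono mult_right_mono cmod_one_minus_power_le power_le_one) auto
      also have "\<dots> \<le> real N * (\<zeta> / (real N + 1)) + 1 * \<zeta>"
        using kN s'[of u] d(2)[of r u] r u s(1) by (intro add_mono mult_mono) auto
      also have "\<dots> \<le> 2 * \<zeta>" using \<zeta> by (simp add: field_simps)
      finally show ?thesis .
    qed
    then have "cmod (1 - \<phi> h u) \<le> 4 / \<delta> * (2 * \<zeta>) * h"
      using u h by (intro \<delta>(2)) auto
    also have "4 / \<delta> * (2 * \<zeta>) = \<eta>" using \<delta>(1) by (simp add: \<zeta>_def)
    finally show "cmod (1 - \<phi> h u) \<le> \<eta> * h" .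
  qed (use s(1) in auto)
qed

lemma increment_moment_bounds:
  obtains C where "0 < C"
    "\<And>s t. 0 \<le> s \<Longrightarrow> s \<le> t \<Longrightarrow> expectation (\<lambda>\<omega>. min 1 ((Y t \<omega> - Y s \<omega>)\<^sup>2)) \<le> C * (t - s)"
    "\<And>s t. 0 \<le> s \<Longrightarrow> s \<le> t \<Longrightarrow> \<bar>expectation (\<lambda>\<omega>. sin (Y t \<omega> - Y s \<omega>))\<bar> \<le> C * (t - s)"
proof -
  obtain C where C: "0 < C" "\<And>h u. 0 \<le> h \<Longrightarrow> \<bar>u\<bar> \<le> 1 \<Longrightarrow> cmod (1 - \<phi> h u) \<le> C * h"
    by (rule \<phi>_lipschitz) blast
  show ?thesis
  proof (rule that[of "8 * C"])
    fix s t :: real assume st: "0 \<le> s" "s \<le> t"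
    have "expectation (\<lambda>\<omega>. min 1 ((Y t \<omega> - Y s \<omega>)\<^sup>2)) \<le> 8 * (C * (t - s))"
      using st C(2)[of "t - s"] by (intro truncated_moment_le_char) (auto simp: char_increment)
    then show "expectation (\<lambda>\<omega>. min 1 ((Y t \<omega> - Y s \<omega>)\<^sup>2)) \<le> 8 * C * (t - s)" by simp
    have "\<bar>expectation (\<lambda>\<omega>. sin (Y t \<omega> - Y s \<omega>))\<bar> \<le> C * (t - s)"
      using abs_expectation_sin_le_char[of "\<lambda>\<omega>. Y t \<omega> - Y s \<omega>"] C(2)[of "t - s" 1] st
      by (simp add: char_increment)
    also have "\<dots> \<le> 8 * (C * (t - s))" using st C(1) by simp
    finally show "\<bar>expectation (\<lambda>\<omega>. sin (Y t \<omega> - Y s \<omega>))\<bar> \<le> 8 * C * (t - s)" by simp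
  qed (use C(1) in auto)
qed

text \<open>The characteristic function of the sum is \<open>\<Prod>i. \<phi> (h i) (d i *
u)\<close>, at distance at most \<open>\<Sum>i. \<eta> * h i = \<eta> * (b - a)\<close> from 1 by
\<open>\<phi>_small\<close>. The bound depends neither on the number of nodes nor on their position,
and this uniformity is what makes the integral of continuous functions exist.\<close>
lemma weighted_increments_small:
  assumes \<epsilon>: "0 < \<epsilon>" and ab: "0 \<le> a" "a \<le> b"
  obtains \<delta> where "0 < \<delta>"
    "\<And>n p d. interval_partition a b n p \<Longrightarrow> (\<And>i. i < n \<Longrightarrow> \<bar>d i\<bar> \<le> \<delta>) \<Longrightarrow>
       prob {\<omega> \<in> space M. \<bar>\<Sum>i<n. d i * (Y (p (Suc i)) \<omega> - Y (p i) \<omega>)\<bar> > \<epsilon>} < \<epsilon>"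
proof -
  define e where "e = min 1 \<epsilon>"
  have e: "0 < e" "e \<le> 1" "e \<le> \<epsilon>" using \<epsilon> by (auto simp: e_def)
  \<comment> \<open>Chosen so that \<open>8 * \<eta> * (b - a) \<le> e / 2\<close>, where 8 is the constant of \<open>truncated_moment_le_char\<close>.\<close>
  define \<eta> where "\<eta> = e / (16 * (b - a + 1))"
  have \<eta>: "0 < \<eta>" using e ab by (simp add: \<eta>_def)
  obtain r where r: "0 < r" "\<And>h u. 0 \<le> h \<Longrightarrow> \<bar>u\<bar> \<le> r \<Longrightarrow> cmod (1 - \<phi> h u) \<le> \<eta> * h"
    using \<phi>_small[OF \<eta>] by blast
  show ?thesis
  proof (rule that[of "r * e"])
    fix n p d assume p: "interval_partition a b n p" and d: "\<And>i. i < n \<Longrightarrow> \<bar>d i\<bar> \<le> r * e"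
    define X where "X \<omega> = (\<Sum>i<n. d i / e * (Y (p (Suc i)) \<omega> - Y (p i) \<omega>))" for \<omega>
    have pos: "0 \<le> p i" if "i \<le> n" for i using partition_nonneg(1)[OF p that] ab by linarith
    have [measurable]: "X \<in> borel_measurable M"
      unfolding X_def[abs_def] using pos by (intro borel_measurable_sum borel_measurable_times increment_measurable) auto
    have "cmod (1 - char (distr M borel X) u) \<le> e / 16" if u: "0 \<le> u" "u \<le> 1" for u
    proof -
      have bd: "\<bar>d i / e * u\<bar> \<le> r" if "i < n" for i
      proof -
        have "\<bar>d i / e\<bar> * \<bar>u\<bar> \<le> r * 1"
          using d[OF that] e u r(1) by (intro mult_mono) (auto simp: field_simps)
        then show ?thesis by (simp add: abs_mult)
      qed
      have h: "0 \<le> p (Suc i) - p i" if "i < n" for i using p that by (auto simp: interval_partition_def)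
      have "cmod ((\<Prod>i<n. 1) - (\<Prod>i<n. \<phi> (p (Suc i) - p i) (d i / e * u)))
         \<le> (\<Sum>i<n. cmod (1 - \<phi> (p (Suc i) - p i) (d i / e * u)))"
        using h cmod_\<phi>_le_1 by (intro norm_prod_diff) auto
      also have "\<dots> \<le> (\<Sum>i<n. \<eta> * (p (Suc i) - p i))"
        using r(2) bd h by (intro sum_mono) auto
      also have "\<dots> = \<eta> * (b - a)"
        using p by (simp add: sum_distrib_left[symmetric] sum_lessThan_telescope interval_partition_def)
      also have "\<dots> \<le> e / 16" using e ab by (simp add: \<eta>_def field_simps)
      finally show ?thesis
        unfolding X_def char_weighted_increments[OF p ab(1)] by simp
    qed
    then have E: "expectation (\<lambda>\<omega>. min 1 ((X \<omega>)\<^sup>2)) \<le> 8 * (e / 16)"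
      by (intro truncated_moment_le_char) auto
    have "prob {\<omega> \<in> space M. \<bar>\<Sum>i<n. d i * (Y (p (Suc i)) \<omega> - Y (p i) \<omega>)\<bar> > \<epsilon>}
        \<le> prob {\<omega> \<in> space M. min 1 ((X \<omega>)\<^sup>2) \<ge> 1}"
    proof (intro finite_measure_mono)
      have "1 \<le> (X \<omega>)\<^sup>2" if "\<epsilon> < \<bar>\<Sum>i<n. d i * (Y (p (Suc i)) \<omega> - Y (p i) \<omega>)\<bar>" for \<omega>
      proof -
        have "(\<Sum>i<n. d i * (Y (p (Suc i)) \<omega> - Y (p i) \<omega>)) = e * X \<omega>"
          using e by (simp add: X_def sum_distrib_left)
        then have "\<epsilon> < e * \<bar>X \<omega>\<bar>" using that e by (simp add: abs_mult)
        then have "e * 1 < e * \<bar>X \<omega>\<bar>" using e(3) by linarith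
        then have "1 < \<bar>X \<omega>\<bar>" using mult_less_cancel_left_pos[OF e(1)] by blast
        then have "1 \<le> \<bar>X \<omega>\<bar>\<^sup>2" by (intro one_le_power) auto
        then show ?thesis by simp
      qed
      then show "{\<omega> \<in> space M. \<epsilon> < \<bar>\<Sum>i<n. d i * (Y (p (Suc i)) \<omega> - Y (p i) \<omega>)\<bar>}
        \<subseteq> {\<omega> \<in> space M. 1 \<le> min 1 ((X \<omega>)\<^sup>2)}" by auto
    qed measurable
    also have "\<dots> \<le> expectation (\<lambda>\<omega>. min 1 ((X \<omega>)\<^sup>2)) / 1"
      by (intro integral_Markov_inequality_measure[where A="{}"] integrable_const_bound[where B=1]) auto
    also have "\<dots> < \<epsilon>" using E e by simp
    finally show "prob {\<omega> \<in> space M. \<bar>\<Sum>i<n. d i * (Y (p (Suc i)) \<omega> - Y (p i) \<omega>)\<bar> > \<epsilon>} < \<epsilon>" .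
  qed (use r e in auto)
qed

end

section \<open>Integrals of continuous functions\<close>

definition left_sum :: "(real \<Rightarrow> real) \<Rightarrow> nat \<Rightarrow> (nat \<Rightarrow> real) \<Rightarrow> (real \<Rightarrow> real) \<Rightarrow> real" where
  "left_sum g n p y = (\<Sum>i<n. g (p i) * (y (p (Suc i)) - y (p i)))"

lemma has_stochastic_integral_iff_left_sums:
  "has_stochastic_integral M Y g a b I \<longleftrightarrow> I \<in> borel_measurable M \<and>
     (\<forall>\<epsilon>>0. \<exists>\<delta>>0. \<forall>n p. interval_partition a b n p \<and> (\<forall>i<n. p (Suc i) - p i < \<delta>) \<longrightarrow>
        measure M {\<omega> \<in> space M. \<epsilon> < \<bar>left_sum g n p (\<lambda>t. Y t \<omega>) - I \<omega>\<bar>} < \<epsilon>)"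
  by (simp add: has_stochastic_integral_def left_sum_def)

text \<open>Every cell \<open>[r j, r (Suc j)]\<close> lies in the cell of \<open>p\<close> with
index \<open>\<alpha> j\<close>. The second clause is the only consequence that matters later: a
left sum over \<open>p\<close> is a sum over \<open>r\<close> with the coefficients of
\<open>p\<close>.\<close>
definition refines ::
  "nat \<Rightarrow> (nat \<Rightarrow> real) \<Rightarrow> nat \<Rightarrow> (nat \<Rightarrow> real) \<Rightarrow> (nat \<Rightarrow> nat) \<Rightarrow> bool" where
  "refines N r n p \<alpha> \<longleftrightarrow>
     (\<forall>j<N. \<alpha> j < n \<and> p (\<alpha> j) \<le> r j \<and> r j \<le> p (Suc (\<alpha> j))) \<and>
     (\<forall>g y. left_sum g n p y = (\<Sum>j<N. g (p (\<alpha> j)) * (y (r (Suc j)) - y (r j))))"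

lemma refines_append:
  assumes r: "refines N r n p \<alpha>" and p: "interval_partition a b n p"
    and rN: "r N = b" and c: "p (Suc n) = c" "b \<le> c"
  shows "refines (Suc N) (r(Suc N := c)) (Suc n) p (\<alpha>(N := n))"
  unfolding refines_def
proof (intro conjI allI impI)
  have pn: "p n = b" using p by (simp add: interval_partition_def)
  have old: "\<alpha> j < n" "p (\<alpha> j) \<le> r j" "r j \<le> p (Suc (\<alpha> j))" if "j < N" for j
    using r that by (auto simp: refines_def)
  fix j assume j: "j < Suc N"
  show "(\<alpha>(N := n)) j < Suc n" using old[of j] j by (auto simp: less_Suc_eq)
  show "p ((\<alpha>(N := n)) j) \<le> (r(Suc N := c)) j" using old[of j] j rN pn by (auto simp: less_Suc_eq)
  show "(r(Suc N := c)) j \<le> p (Suc ((\<alpha>(N := n)) j))" using old[of j] j rN c by (auto simp: less_Suc_eq)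
next
  fix g y :: "real \<Rightarrow> real"
  have "left_sum g (Suc n) p y = left_sum g n p y + g (p n) * (y c - y b)"
    using p c by (simp add: left_sum_def interval_partition_def)
  also have "left_sum g n p y = (\<Sum>j<N. g (p (\<alpha> j)) * (y (r (Suc j)) - y (r j)))"
    using r by (simp add: refines_def)
  also have "\<dots> + g (p n) * (y c - y b) = (\<Sum>j<Suc N. g (p ((\<alpha>(N := n)) j)) *
      (y ((r(Suc N := c)) (Suc j)) - y ((r(Suc N := c)) j)))"
    using rN by (simp add: fun_upd_def)
  finally show "left_sum g (Suc n) p y = (\<Sum>j<Suc N. g (p ((\<alpha>(N := n)) j)) *
      (y ((r(Suc N := c)) (Suc j)) - y ((r(Suc N := c)) j)))" .
qed

lemma refines_extend_last:
  assumes r: "refines N r (Suc m) (q(Suc m := b)) \<beta>"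
    and q: "q m \<le> b" "b \<le> q (Suc m)" and rN: "r N = b"
  shows "refines (Suc N) (r(Suc N := q (Suc m))) (Suc m) q (\<beta>(N := m))"
  unfolding refines_def
proof (intro conjI allI impI)
  have old: "\<beta> j < Suc m" "q (\<beta> j) \<le> r j" "r j \<le> q (Suc (\<beta> j))" if "j < N" for j
  proof -
    have *: "\<beta> j < Suc m" "(q(Suc m := b)) (\<beta> j) \<le> r j" "r j \<le> (q(Suc m := b)) (Suc (\<beta> j))"
      using r that by (auto simp: refines_def)
    then show "\<beta> j < Suc m" "q (\<beta> j) \<le> r j" by auto
    show "r j \<le> q (Suc (\<beta> j))" using *(3) q(2) by (cases "\<beta> j = m") auto
  qed
  fix j assume j: "j < Suc N"
  show "(\<beta>(N := m)) j < Suc m" using old[of j] j by (auto simp: less_Suc_eq)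
  show "q ((\<beta>(N := m)) j) \<le> (r(Suc N := q (Suc m))) j" using old[of j] j rN q by (auto simp: less_Suc_eq)
  show "(r(Suc N := q (Suc m))) j \<le> q (Suc ((\<beta>(N := m)) j))" using old[of j] j rN q by (auto simp: less_Suc_eq)
next
  fix g y :: "real \<Rightarrow> real"
  have \<beta>: "\<beta> j < Suc m" if "j < N" for j using r that by (auto simp: refines_def)
  have "left_sum g (Suc m) q y
      = left_sum g (Suc m) (q(Suc m := b)) y + g (q m) * (y (q (Suc m)) - y b)"
    by (simp add: left_sum_def algebra_simps)
  also have "left_sum g (Suc m) (q(Suc m := b)) y
      = (\<Sum>j<N. g ((q(Suc m := b)) (\<beta> j)) * (y (r (Suc j)) - y (r j)))"
    using r by (simp add: refines_def)
  also have "\<dots> = (\<Sum>j<N. g (q (\<beta> j)) * (y (r (Suc j)) - y (r j)))"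
    by (intro sum.cong refl) (auto dest!: \<beta>)
  also have "\<dots> + g (q m) * (y (q (Suc m)) - y b) = (\<Sum>j<Suc N. g (q ((\<beta>(N := m)) j)) *
      (y ((r(Suc N := q (Suc m))) (Suc j)) - y ((r(Suc N := q (Suc m))) j)))"
    using rN by (simp add: fun_upd_def)
  finally show "left_sum g (Suc m) q y = (\<Sum>j<Suc N. g (q ((\<beta>(N := m)) j)) *
      (y ((r(Suc N := q (Suc m))) (Suc j)) - y ((r(Suc N := q (Suc m))) j)))" .
qed

text \<open>Merge from the right end. Of the two last interior nodes \<open>p n\<close> and \<open>q
m\<close> take the larger one; between it and \<open>b\<close> neither partition has a node, so this
is the last cell of the refinement. What remains are partitions with one cell less in total, one of
them with a shortened last cell.\<close>
lemma common_refinement: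
  assumes "interval_partition a b n p" "interval_partition a b m q"
  shows "\<exists>N r \<alpha> \<beta>. interval_partition a b N r \<and> refines N r n p \<alpha> \<and> refines N r m q \<beta>"
  using assms
proof (induction "n + m" arbitrary: b n p m q rule: less_induct)
  case less
  have trivial: "refines 0 (\<lambda>_. a) k t (\<lambda>_. 0)" if "interval_partition a a k t" for k t
  proof -
    have "t i = a" if "i \<le> k" for i
      using partition_nonneg[OF \<open>interval_partition a a k t\<close> that] by simp
    then show ?thesis by (simp add: refines_def left_sum_def)
  qed
  show ?case
  proof (cases "n = 0 \<or> m = 0")
    case True
    then have "b = a" using less.prems by (auto simp: interval_partition_def)
    then show ?thesis
      using trivial less.prems
      by (intro exI[of _ 0] exI[of _ "\<lambda>_. a"] exI[of _ "\<lambda>_. 0"]) (auto simp: interval_partition_def)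
  next
    case False
    then obtain n' m' where n': "n = Suc n'" and m': "m = Suc m'"
      by (metis not0_implies_Suc)
    have step: "\<exists>N r \<alpha> \<beta>. interval_partition a b N r \<and> refines N r (Suc k) s \<alpha> \<and> refines N r (Suc l) t \<beta>"
      if s: "interval_partition a b (Suc k) s" and t: "interval_partition a b (Suc l) t"
        and kl: "Suc k + Suc l = n + m" and le: "t l \<le> s k" for k l s t
    proof -
      have s': "interval_partition a (s k) k s"
        using s by (auto simp: interval_partition_def)
      have t': "interval_partition a (s k) (Suc l) (t(Suc l := s k))"
        using t le by (auto simp: interval_partition_def)
      obtain N r \<alpha> \<beta> where r: "interval_partition a (s k) N r"
        "refines N r k s \<alpha>" "refines N r (Suc l) (t(Suc l := s k)) \<beta>"
        using less.hyps[of k "Suc l", OF _ s' t'] kl by auto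
      have ends: "s (Suc k) = b" "t (Suc l) = b" "s k \<le> b" "r N = s k"
        using s t r(1) by (auto simp: interval_partition_def)
      have "interval_partition a b (Suc N) (r(Suc N := b))"
        using r(1) ends by (auto simp: interval_partition_def less_Suc_eq)
      moreover have "refines (Suc N) (r(Suc N := b)) (Suc k) s (\<alpha>(N := k))"
        by (rule refines_append[OF r(2) s' ends(4,1,3)])
      moreover have "refines (Suc N) (r(Suc N := b)) (Suc l) t (\<beta>(N := l))"
        using refines_extend_last[OF r(3) le _ ends(4)] ends by simp
      ultimately show ?thesis by blast
    qed
    show ?thesis
    proof (cases "q m' \<le> p n'")
      case True
      then show ?thesis using step[of n' p m' q] less.prems n' m' by simp
    next
      case False
      then have "\<exists>N r \<beta> \<alpha>. interval_partition a b N r \<and> refines N r (Suc m') q \<beta> \<and> refines N r (Suc n') p \<alpha>"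
        using step[of m' q n' p] less.prems n' m' by simp
      then show ?thesis using n' m' by blast
    qed
  qed
qed

context levy_process
begin

lemma left_sum_measurable:
  assumes "interval_partition a b n p" "0 \<le> a"
  shows "(\<lambda>\<omega>. left_sum g n p (\<lambda>t. Y t \<omega>)) \<in> borel_measurable M"
proof -
  have "0 \<le> p i" if "i \<le> n" for i
    using partition_nonneg(1)[OF assms(1) that] assms(2) by linarith
  then show ?thesis
    unfolding left_sum_def by (intro borel_measurable_sum borel_measurable_times increment_measurable) auto
qed

text \<open>On the common refinement the difference of two left sums has coefficients \<open>g (p
(\<alpha> j)) - g (q (\<beta> j))\<close>, which are uniformly small by uniform continuity.\<close>
lemma left_sums_Cauchy:
  assumes ab: "0 \<le> a" "a \<le> b" and g: "continuous_on {a..b} g" and \<epsilon>: "0 < \<epsilon>"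
  obtains \<delta> where "0 < \<delta>"
    "\<And>n p m q. interval_partition a b n p \<Longrightarrow> interval_partition a b m q
      \<Longrightarrow> (\<And>i. i < n \<Longrightarrow> p (Suc i) - p i < \<delta>) \<Longrightarrow> (\<And>i. i < m \<Longrightarrow> q (Suc i) - q i < \<delta>)
      \<Longrightarrow> prob {\<omega> \<in> space M. \<bar>left_sum g n p (\<lambda>t. Y t \<omega>) - left_sum g m q (\<lambda>t. Y t \<omega>)\<bar> > \<epsilon>} < \<epsilon>"
proof -
  obtain \<eta> where \<eta>: "0 < \<eta>"
    "\<And>n p d. interval_partition a b n p \<Longrightarrow> (\<And>i. i < n \<Longrightarrow> \<bar>d i\<bar> \<le> \<eta>) \<Longrightarrow>
       prob {\<omega> \<in> space M. \<bar>\<Sum>i<n. d i * (Y (p (Suc i)) \<omega> - Y (p i) \<omega>)\<bar> > \<epsilon>} < \<epsilon>"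
    using weighted_increments_small[OF \<epsilon> ab] by blast
  have "uniformly_continuous_on {a..b} g"
    using g compact_uniformly_continuous compact_Icc by blast
  then obtain \<delta> where \<delta>: "0 < \<delta>"
    "\<And>x x'. x \<in> {a..b} \<Longrightarrow> x' \<in> {a..b} \<Longrightarrow> dist x' x < \<delta> \<Longrightarrow> dist (g x') (g x) < \<eta>"
    using \<eta>(1) unfolding uniformly_continuous_on_def by meson
  show ?thesis
  proof (rule that[OF \<delta>(1)])
    fix n p m q
    assume p: "interval_partition a b n p" and q: "interval_partition a b m q"
      and mesh: "\<And>i. i < n \<Longrightarrow> p (Suc i) - p i < \<delta>" "\<And>i. i < m \<Longrightarrow> q (Suc i) - q i < \<delta>"
    obtain N r \<alpha> \<beta> where r: "interval_partition a b N r" "refines N r n p \<alpha>" "refines N r m q \<beta>"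
      using common_refinement[OF p q] by blast
    have "\<bar>g (p (\<alpha> j)) - g (q (\<beta> j))\<bar> \<le> \<eta>" if j: "j < N" for j
    proof -
      have \<alpha>: "\<alpha> j < n" "p (\<alpha> j) \<le> r j" "r j \<le> p (Suc (\<alpha> j))" and \<beta>: "\<beta> j < m" "q (\<beta> j) \<le> r j" "r j \<le> q (Suc (\<beta> j))"
        using r j by (auto simp: refines_def)
      have "p (\<alpha> j) \<in> {a..b}" "q (\<beta> j) \<in> {a..b}"
        using partition_nonneg[OF p, of "\<alpha> j"] partition_nonneg[OF q, of "\<beta> j"] \<alpha> \<beta> by auto
      moreover have "dist (p (\<alpha> j)) (q (\<beta> j)) < \<delta>"
        using \<alpha> \<beta> mesh(1)[OF \<alpha>(1)] mesh(2)[OF \<beta>(1)] unfolding dist_real_def by linarith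
      ultimately have "dist (g (p (\<alpha> j))) (g (q (\<beta> j))) < \<eta>"
        by (intro \<delta>(2)) auto
      then show ?thesis by (simp add: dist_real_def)
    qed
    then have "prob {\<omega> \<in> space M. \<bar>\<Sum>j<N. (g (p (\<alpha> j)) - g (q (\<beta> j))) * (Y (r (Suc j)) \<omega> - Y (r j) \<omega>)\<bar> > \<epsilon>} < \<epsilon>"
      by (intro \<eta>(2) r(1)) auto
    moreover have "left_sum g n p y - left_sum g m q y
        = (\<Sum>j<N. (g (p (\<alpha> j)) - g (q (\<beta> j))) * (y (r (Suc j)) - y (r j)))" for y
      using r(2,3) by (simp add: refines_def sum_subtractf left_diff_distrib)
    ultimately show "prob {\<omega> \<in> space M. \<bar>left_sum g n p (\<lambda>t. Y t \<omega>) - left_sum g m q (\<lambda>t. Y t \<omega>)\<bar> > \<epsilon>} < \<epsilon>"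
      by simp
  qed
qed

text \<open>The left sums are Cauchy in probability. Along a sequence of partitions with rapidly
decreasing mesh they converge almost surely by Borel and Cantelli, and the Cauchy property carries
the limit over to all fine partitions.\<close>
lemma stochastic_integral_exists:
  assumes ab: "0 \<le> a" "a \<le> b" and g: "continuous_on {a..b} g"
  shows "\<exists>I. has_stochastic_integral M Y g a b I"
proof -
  define close where "close \<delta> \<epsilon> \<longleftrightarrow> 0 < \<delta> \<and> (\<forall>n p m q. interval_partition a b n p \<longrightarrow> interval_partition a b m q
      \<longrightarrow> (\<forall>i<n. p (Suc i) - p i < \<delta>) \<longrightarrow> (\<forall>i<m. q (Suc i) - q i < \<delta>)
      \<longrightarrow> prob {\<omega> \<in> space M. \<bar>left_sum g n p (\<lambda>t. Y t \<omega>) - left_sum g m q (\<lambda>t. Y t \<omega>)\<bar> > \<epsilon>} < \<epsilon>)"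
    for \<delta> \<epsilon> :: real
  have "\<exists>\<delta>. close \<delta> \<epsilon>" if \<epsilon>: "0 < \<epsilon>" for \<epsilon>
    by (rule left_sums_Cauchy[OF ab g \<epsilon>]) (auto simp: close_def)
  then obtain \<delta> where \<delta>: "\<And>\<epsilon>. 0 < \<epsilon> \<Longrightarrow> close (\<delta> \<epsilon>) \<epsilon>" by metis
  define e :: "nat \<Rightarrow> real" where "e k = (1 / 2) ^ k" for k
  have e: "0 < e k" for k by (simp add: e_def)
  \<comment> \<open>The mesh of the \<open>k\<close>-th partition must suit all tolerances \<open>e i\<close> with \<open>i \<le> k\<close>, because it is compared with its
    predecessor, and tend to 0, because it is compared with arbitrary fine partitions.\<close>
  define \<mu> where "\<mu> k = min (e k) (Min ((\<lambda>i. \<delta> (e i)) ` {..k}))" for k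
  have \<mu>: "0 < \<mu> k" "\<And>i. i \<le> k \<Longrightarrow> \<mu> k \<le> \<delta> (e i)" "\<mu> k \<le> e k" for k
    using \<delta>[OF e] e by (auto simp: \<mu>_def close_def intro: min.coboundedI2)
  have "\<exists>n>0. (b - a) / real n < \<mu> k" for k
  proof -
    obtain n where n: "(b - a) / \<mu> k < real n" using reals_Archimedean2 by blast
    have "0 \<le> (b - a) / \<mu> k" using ab \<mu>(1)[of k] by simp
    then have "0 < real n" using n by linarith
    then show ?thesis using n \<mu>(1)[of k] by (intro exI[of _ n]) (auto simp: field_simps)
  qed
  then obtain n where n: "\<And>k. 0 < n k" "\<And>k. (b - a) / real (n k) < \<mu> k" by metis
  define p where "p k i = a + (b - a) / real (n k) * real i" for k i
  have p: "interval_partition a b (n k) (p k)" for k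
    using n(1)[of k] ab unfolding interval_partition_def p_def
    by (auto intro!: mult_left_mono divide_right_mono simp del: of_nat_Suc)
  have mesh: "p k (Suc i) - p k i < \<delta> (e j)" if "j \<le> k" for i j k
  proof -
    have "p k (Suc i) - p k i = (b - a) / real (n k)" by (simp add: p_def distrib_left)
    then show ?thesis using n(2)[of k] \<mu>(2)[OF that] by linarith
  qed
  define S where "S k \<omega> = left_sum g (n k) (p k) (\<lambda>t. Y t \<omega>)" for k \<omega>
  have S [measurable]: "S k \<in> borel_measurable M" for k
    unfolding S_def[abs_def] by (rule left_sum_measurable[OF p ab(1)])
  have "AE \<omega> in M. \<forall>\<^sub>F k in sequentially. \<omega> \<in> space M - {\<omega> \<in> space M. \<bar>S k \<omega> - S (Suc k) \<omega>\<bar> > e k}"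
  proof (rule borel_cantelli_AE1)
    show "summable (\<lambda>k. prob {\<omega> \<in> space M. \<bar>S k \<omega> - S (Suc k) \<omega>\<bar> > e k})"
    proof (rule summable_comparison_test')
      show "summable e" unfolding e_def by (rule summable_geometric) simp
      show "norm (prob {\<omega> \<in> space M. \<bar>S k \<omega> - S (Suc k) \<omega>\<bar> > e k}) \<le> e k" for k
        using \<delta>[OF e[of k]] p[of k] p[of "Suc k"] mesh[of k k] mesh[of k "Suc k"]
        by (auto simp: close_def S_def less_imp_le)
    qed
  qed (auto simp: less_top[symmetric])
  then have AE: "AE \<omega> in M. convergent (\<lambda>k. S k \<omega>)"
  proof eventually_elim
    case (elim \<omega>)
    then obtain K where K: "\<And>k. K \<le> k \<Longrightarrow> \<bar>S k \<omega> - S (Suc k) \<omega>\<bar> \<le> e k"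
      by (auto simp: eventually_sequentially not_less)
    have "summable (\<lambda>k. S (Suc k) \<omega> - S k \<omega>)"
    proof (rule summable_comparison_test'[of e K])
      show "summable e" unfolding e_def by (rule summable_geometric) simp
    qed (use K in \<open>simp add: abs_minus_commute\<close>)
    then have "convergent (\<lambda>n. \<Sum>k<n. S (Suc k) \<omega> - S k \<omega>)"
      by (simp add: summable_iff_convergent)
    then have "convergent (\<lambda>n. S n \<omega> - S 0 \<omega>)"
      by (simp only: sum_lessThan_telescope[of "\<lambda>k. S k \<omega>"])
    from convergent_add[OF this convergent_const[of "S 0 \<omega>"]] show ?case by simp
  qed
  define I where "I \<omega> = lim (\<lambda>k. S k \<omega>)" for \<omega>
  have I [measurable]: "I \<in> borel_measurable M" unfolding I_def[abs_def] by measurable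
  have AEI: "AE \<omega> in M. (\<lambda>k. S k \<omega>) \<longlonglongrightarrow> I \<omega>"
    using AE by eventually_elim (simp add: I_def convergent_LIMSEQ_iff)
  have "has_stochastic_integral M Y g a b I"
    unfolding has_stochastic_integral_iff_left_sums
  proof (intro conjI allI impI I)
    fix \<epsilon> :: real assume \<epsilon>: "0 < \<epsilon>"
    show "\<exists>d>0. \<forall>m q. interval_partition a b m q \<and> (\<forall>i<m. q (Suc i) - q i < d) \<longrightarrow>
       prob {\<omega> \<in> space M. \<epsilon> < \<bar>left_sum g m q (\<lambda>t. Y t \<omega>) - I \<omega>\<bar>} < \<epsilon>"
    proof (intro exI conjI allI impI)
      show "0 < \<delta> (\<epsilon> / 2)" using \<delta>[of "\<epsilon> / 2"] \<epsilon> by (simp add: close_def)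
      fix m q assume q: "interval_partition a b m q \<and> (\<forall>i<m. q (Suc i) - q i < \<delta> (\<epsilon> / 2))"
      have [measurable]: "(\<lambda>\<omega>. left_sum g m q (\<lambda>t. Y t \<omega>)) \<in> borel_measurable M"
        using left_sum_measurable q ab by blast
      have "(\<lambda>k. prob {\<omega> \<in> space M. \<epsilon> / 2 < \<bar>S k \<omega> - I \<omega>\<bar>}) \<longlonglongrightarrow> 0"
        using \<epsilon> by (intro AE_tendsto_imp_prob_tendsto AEI) auto
      then have ev: "\<forall>\<^sub>F k in sequentially. prob {\<omega> \<in> space M. \<epsilon> / 2 < \<bar>S k \<omega> - I \<omega>\<bar>} < \<epsilon> / 2"
        by (rule order_tendstoD) (use \<epsilon> in auto)
      have "\<exists>k. (\<forall>i. p k (Suc i) - p k i < \<delta> (\<epsilon> / 2)) \<and> prob {\<omega> \<in> space M. \<epsilon> / 2 < \<bar>S k \<omega> - I \<omega>\<bar>} < \<epsilon> / 2"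
      proof -
        have "e \<longlonglongrightarrow> 0" unfolding e_def by (rule LIMSEQ_realpow_zero) auto
        then have "\<forall>\<^sub>F k in sequentially. e k < \<delta> (\<epsilon> / 2)"
          by (rule order_tendstoD) (use \<delta>[of "\<epsilon> / 2"] \<epsilon> in \<open>simp add: close_def\<close>)
        with ev have "\<forall>\<^sub>F k in sequentially. e k < \<delta> (\<epsilon> / 2)
            \<and> prob {\<omega> \<in> space M. \<epsilon> / 2 < \<bar>S k \<omega> - I \<omega>\<bar>} < \<epsilon> / 2"
          by eventually_elim simp
        then obtain k where k: "e k < \<delta> (\<epsilon> / 2)" "prob {\<omega> \<in> space M. \<epsilon> / 2 < \<bar>S k \<omega> - I \<omega>\<bar>} < \<epsilon> / 2"
          using eventually_happens'[OF sequentially_bot] by blast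
        moreover have "p k (Suc i) - p k i < \<delta> (\<epsilon> / 2)" for i
        proof -
          have "p k (Suc i) - p k i = (b - a) / real (n k)" by (simp add: p_def distrib_left)
          then show ?thesis using n(2)[of k] \<mu>(3)[of k] k(1) by linarith
        qed
        ultimately show ?thesis by blast
      qed
      then obtain k where k: "\<And>i. p k (Suc i) - p k i < \<delta> (\<epsilon> / 2)"
        "prob {\<omega> \<in> space M. \<epsilon> / 2 < \<bar>S k \<omega> - I \<omega>\<bar>} < \<epsilon> / 2" by blast
      have "prob {\<omega> \<in> space M. \<epsilon> < \<bar>left_sum g m q (\<lambda>t. Y t \<omega>) - I \<omega>\<bar>}
        \<le> prob {\<omega> \<in> space M. \<epsilon> / 2 < \<bar>left_sum g m q (\<lambda>t. Y t \<omega>) - S k \<omega>\<bar>}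
          + prob {\<omega> \<in> space M. \<epsilon> / 2 < \<bar>S k \<omega> - I \<omega>\<bar>}"
        using prob_abs_sum_gt[of "\<lambda>\<omega>. left_sum g m q (\<lambda>t. Y t \<omega>) - S k \<omega>" "\<lambda>\<omega>. S k \<omega> - I \<omega>" "\<epsilon> / 2" "\<epsilon> / 2"]
        by simp
      also have "\<dots> < \<epsilon> / 2 + \<epsilon> / 2"
        using \<delta>[of "\<epsilon> / 2"] \<epsilon> q p[of k] k by (intro add_strict_mono) (auto simp: close_def S_def)
      finally show "prob {\<omega> \<in> space M. \<epsilon> < \<bar>left_sum g m q (\<lambda>t. Y t \<omega>) - I \<omega>\<bar>} < \<epsilon>" by simp
    qed
  qed
  then show ?thesis by blast
qed

end

section \<open>Paths of unbounded variation\<close>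

text \<open>The grid with cells of length \<open>2 * pi / 2 ^ k\<close>. It is also used beyond
\<open>2 * pi\<close>.\<close>
definition dyadic :: "nat \<Rightarrow> nat \<Rightarrow> real" where
  "dyadic k i = 2 * pi * real i / 2 ^ k"

lemma dyadic_0 [simp]: "dyadic k 0 = 0"
  by (simp add: dyadic_def)

lemma dyadic_nonneg [simp]: "0 \<le> dyadic k i"
  by (simp add: dyadic_def)

lemma dyadic_step: "dyadic k (Suc i) - dyadic k i = 2 * pi / 2 ^ k"
  by (simp add: dyadic_def field_simps)

lemma dyadic_mono: "i \<le> j \<Longrightarrow> dyadic k i \<le> dyadic k j"
  by (simp add: dyadic_def divide_right_mono)

lemma dyadic_refine: "dyadic (Suc k) (2 * i) = dyadic k i"
  by (simp add: dyadic_def)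

text \<open>A path with one-sided limits is bounded near each point; bounds on neighbouring
intervals combine.\<close>
lemma cadlag_bounded:
  assumes y: "cadlag y"
  obtains K where "0 \<le> K" "\<And>t. 0 \<le> t \<Longrightarrow> t \<le> T \<Longrightarrow> \<bar>y t\<bar> \<le> K"
proof -
  \<comment> \<open>The bisection argument also looks at intervals that reach below 0, where nothing is known of \<open>y\<close>.\<close>
  define P where "P u v \<longleftrightarrow> (\<exists>K. \<forall>t. u \<le> t \<and> t \<le> v \<and> 0 \<le> t \<longrightarrow> \<bar>y t\<bar> \<le> K)" for u v
  have "0 \<le> max 0 T" by simp
  then have "P 0 (max 0 T)"
  proof (induction rule: Bolzano)
    case (trans a b c)
    then obtain K L where K: "\<And>t. a \<le> t \<Longrightarrow> t \<le> b \<Longrightarrow> 0 \<le> t \<Longrightarrow> \<bar>y t\<bar> \<le> K"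
      and L: "\<And>t. b \<le> t \<Longrightarrow> t \<le> c \<Longrightarrow> 0 \<le> t \<Longrightarrow> \<bar>y t\<bar> \<le> L"
      unfolding P_def by blast
    have "\<bar>y t\<bar> \<le> max K L" if "a \<le> t" "t \<le> c" "0 \<le> t" for t
      using K[of t] L[of t] that by (cases "t \<le> b") auto
    then show ?case unfolding P_def by blast
  next
    case (local x)
    then have x: "0 \<le> x" by simp
    have "(y \<longlongrightarrow> y x) (at_right x)" using y x by (simp add: cadlag_def)
    from tendstoD[OF this, of 1] obtain d where d: "x < d" "\<And>t. x < t \<Longrightarrow> t < d \<Longrightarrow> \<bar>y t - y x\<bar> < 1"
      unfolding eventually_at_right_field dist_real_def by auto
    obtain d' l where d': "d' < x" "\<And>t. 0 \<le> t \<Longrightarrow> d' < t \<Longrightarrow> t < x \<Longrightarrow> \<bar>y t - l\<bar> < 1"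
    proof (cases "x = 0")
      case True
      then show ?thesis using that[of "-1"] by auto
    next
      case False
      then have "0 < x" using x by simp
      then obtain l where "(y \<longlongrightarrow> l) (at_left x)" using y unfolding cadlag_def by blast
      from tendstoD[OF this, of 1] obtain d' where "d' < x" "\<And>t. d' < t \<Longrightarrow> t < x \<Longrightarrow> \<bar>y t - l\<bar> < 1"
        unfolding eventually_at_left_field dist_real_def by auto
      then show ?thesis using that by blast
    qed
    show ?case
    proof (intro exI[of _ "min (d - x) (x - d')"] conjI allI impI)
      show "0 < min (d - x) (x - d')" using d d' by simp
      fix a b assume ab: "a \<le> x \<and> x \<le> b \<and> b - a < min (d - x) (x - d')"
      have "\<bar>y t\<bar> \<le> \<bar>y x\<bar> + \<bar>l\<bar> + 1" if t: "a \<le> t" "t \<le> b" "0 \<le> t" for t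
      proof -
        consider "t < x" | "t = x" | "x < t" by linarith
        then show ?thesis
        proof cases
          case 1
          then have "\<bar>y t - l\<bar> < 1" using d'(2)[of t] ab t by auto
          then show ?thesis by linarith
        next
          case 3
          then have "\<bar>y t - y x\<bar> < 1" using d(2)[of t] ab t by auto
          then show ?thesis by linarith
        qed auto
      qed
      then show "P a b" unfolding P_def by blast
    qed
  qed
  then obtain K where K: "\<And>t. 0 \<le> t \<Longrightarrow> t \<le> max 0 T \<Longrightarrow> \<bar>y t\<bar> \<le> K" unfolding P_def by auto
  have "\<bar>y t\<bar> \<le> max 0 K" if "0 \<le> t" "t \<le> T" for t
    using K[of t] that by simp
  then show ?thesis by (intro that[of "max 0 K"]) auto
qed

lemma abs_diff_le_sum_steps:
  fixes f :: "nat \<Rightarrow> real"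
  assumes "a \<le> b"
  shows "\<bar>f b - f a\<bar> \<le> (\<Sum>j=a..<b. \<bar>f (Suc j) - f j\<bar>)"
  using sum_Suc_diff'[OF assms, of f] sum_abs[of "\<lambda>j. f (Suc j) - f j" "{a..<b}"] by simp

text \<open>As the path is bounded, truncation changes the sums at most by a constant factor. The
nodes of an arbitrary partition are then approximated from the right by dyadic points, where right
continuity applies.\<close>
lemma bounded_variation_of_dyadic_sums:
  fixes J :: nat
  assumes y: "cadlag y"
    and S: "\<And>k. (\<Sum>i<J * 2 ^ k. min 1 \<bar>y (dyadic k (Suc i)) - y (dyadic k i)\<bar>) \<le> S"
  shows "bounded_variation_on 0 (2 * pi * real J) y"
proof -
  let ?T = "2 * pi * real J"
  obtain K where K: "0 \<le> K" "\<And>t. 0 \<le> t \<Longrightarrow> t \<le> ?T \<Longrightarrow> \<bar>y t\<bar> \<le> K"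
    using cadlag_bounded[OF y, of ?T] by blast
  have end_point: "dyadic k (J * 2 ^ k) = ?T" for k by (simp add: dyadic_def)
  have grid: "(\<Sum>i<J * 2 ^ k. \<bar>y (dyadic k (Suc i)) - y (dyadic k i)\<bar>) \<le> (1 + 2 * K) * S" for k
  proof -
    have "(\<Sum>i<J * 2 ^ k. \<bar>y (dyadic k (Suc i)) - y (dyadic k i)\<bar>)
        \<le> (\<Sum>i<J * 2 ^ k. (1 + 2 * K) * min 1 \<bar>y (dyadic k (Suc i)) - y (dyadic k i)\<bar>)"
    proof (rule sum_mono)
      fix i assume i: "i \<in> {..<J * 2 ^ k}"
      have "dyadic k i \<le> ?T" "dyadic k (Suc i) \<le> ?T"
        using i dyadic_mono[of i "J * 2 ^ k" k] dyadic_mono[of "Suc i" "J * 2 ^ k" k]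
        unfolding end_point by auto
      then have "\<bar>y (dyadic k (Suc i))\<bar> \<le> K" "\<bar>y (dyadic k i)\<bar> \<le> K"
        using K(2) by auto
      then have "\<bar>y (dyadic k (Suc i)) - y (dyadic k i)\<bar> \<le> 2 * K" by linarith
      then show "\<bar>y (dyadic k (Suc i)) - y (dyadic k i)\<bar> \<le> (1 + 2 * K) * min 1 \<bar>y (dyadic k (Suc i)) - y (dyadic k i)\<bar>"
        using K(1) by (auto simp: min_def algebra_simps)
    qed
    also have "\<dots> = (1 + 2 * K) * (\<Sum>i<J * 2 ^ k. min 1 \<bar>y (dyadic k (Suc i)) - y (dyadic k i)\<bar>)"
      by (simp add: sum_distrib_left)
    also have "\<dots> \<le> (1 + 2 * K) * S" using K(1) S by (intro mult_left_mono) auto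
    finally show ?thesis .
  qed
  show ?thesis
    unfolding bounded_variation_on_def
  proof (intro exI allI impI)
    fix n p assume p: "interval_partition 0 ?T n p"
    \<comment> \<open>\<open>dyadic k (idx k i)\<close> is the first point of the \<open>k\<close>-th grid that is not to the left of \<open>p i\<close>.\<close>
    define idx where "idx k i = nat \<lceil>p i * 2 ^ k / (2 * pi)\<rceil>" for k i
    have p0: "0 \<le> p i" if "i \<le> n" for i using partition_nonneg(1)[OF p that] .
    have idx_mono: "idx k i \<le> idx k (Suc i)" if "i < n" for i k
      using p that unfolding idx_def interval_partition_def
      by (intro nat_mono ceiling_mono divide_right_mono mult_right_mono) auto
    have idx_n: "idx k n = J * 2 ^ k" for k
    proof -
      have "p n * 2 ^ k / (2 * pi) = real (J * 2 ^ k)"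
        using p by (simp add: interval_partition_def)
      then show ?thesis unfolding idx_def by (simp only: ceiling_of_nat nat_int)
    qed
    have coarse: "(\<Sum>i<m. \<bar>y (dyadic k (idx k (Suc i))) - y (dyadic k (idx k i))\<bar>)
        \<le> (\<Sum>j<idx k m. \<bar>y (dyadic k (Suc j)) - y (dyadic k j)\<bar>)" if "m \<le> n" for m k
      using that
    proof (induction m)
      case (Suc m)
      let ?f = "\<lambda>j. \<bar>y (dyadic k (Suc j)) - y (dyadic k j)\<bar>"
      have "idx k m \<le> idx k (Suc m)" using idx_mono Suc.prems by simp
      then have "(\<Sum>j<idx k (Suc m). ?f j) = (\<Sum>j<idx k m. ?f j) + (\<Sum>j=idx k m..<idx k (Suc m). ?f j)"
        by (simp add: lessThan_atLeast0 sum.atLeastLessThan_concat)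
      then show ?case
        using Suc abs_diff_le_sum_steps[OF \<open>idx k m \<le> idx k (Suc m)\<close>, of "\<lambda>j. y (dyadic k j)"] by simp
    qed simp
    have lim: "(\<lambda>k. y (dyadic k (idx k i))) \<longlonglongrightarrow> y (p i)" if i: "i \<le> n" for i
    proof -
      have lower: "p i \<le> dyadic k (idx k i)" and upper: "dyadic k (idx k i) \<le> p i + 2 * pi * (1 / 2) ^ k" for k
      proof -
        let ?x = "p i * 2 ^ k / (2 * pi)"
        have "0 \<le> ?x" using p0[OF i] by simp
        then have "?x \<le> real (idx k i)" "real (idx k i) \<le> ?x + 1"
          unfolding idx_def by linarith+
        then have "2 * pi * ?x / 2 ^ k \<le> 2 * pi * real (idx k i) / 2 ^ k"
          "2 * pi * real (idx k i) / 2 ^ k \<le> 2 * pi * (?x + 1) / 2 ^ k"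
          by (intro divide_right_mono mult_left_mono; simp)+
        then show "p i \<le> dyadic k (idx k i)" "dyadic k (idx k i) \<le> p i + 2 * pi * (1 / 2) ^ k"
          by (simp_all add: dyadic_def power_divide add_divide_distrib distrib_left)
      qed
      have half: "(\<lambda>k. (1 / 2 :: real) ^ k) \<longlonglongrightarrow> 0" by (rule LIMSEQ_realpow_zero) auto
      have "(\<lambda>k. p i + 2 * pi * (1 / 2) ^ k) \<longlonglongrightarrow> p i"
        using tendsto_add[OF tendsto_const[of "p i"] tendsto_mult[OF tendsto_const[of "2 * pi"] half]] by simp
      then have "(\<lambda>k. dyadic k (idx k i)) \<longlonglongrightarrow> p i"
        by (rule tendsto_sandwich[OF always_eventually always_eventually tendsto_const, rotated 2])
          (use lower upper in blast)+
      moreover have "continuous (at (p i) within {p i..}) y"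
        using y p0[OF i] by (simp add: cadlag_def continuous_within at_within_Ici_at_right)
      ultimately show ?thesis
        using lower unfolding continuous_within_sequentially by (auto simp: comp_def)
    qed
    show "(\<Sum>i<n. \<bar>y (p (Suc i)) - y (p i)\<bar>) \<le> (1 + 2 * K) * S"
    proof (rule LIMSEQ_le_const2)
      show "(\<lambda>k. \<Sum>i<n. \<bar>y (dyadic k (idx k (Suc i))) - y (dyadic k (idx k i))\<bar>) \<longlonglongrightarrow> (\<Sum>i<n. \<bar>y (p (Suc i)) - y (p i)\<bar>)"
        by (intro tendsto_intros lim) auto
      show "\<exists>N. \<forall>k\<ge>N. (\<Sum>i<n. \<bar>y (dyadic k (idx k (Suc i))) - y (dyadic k (idx k i))\<bar>) \<le> (1 + 2 * K) * S"
        using coarse[of n] grid by (auto simp: idx_n intro: order_trans)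
    qed
  qed
qed

lemma bounded_variation_on_mono:
  assumes bv: "bounded_variation_on 0 T y" and t: "0 \<le> t" "t \<le> T"
  shows "bounded_variation_on 0 t y"
proof -
  obtain B where B: "\<And>n p. interval_partition 0 T n p \<Longrightarrow> (\<Sum>i<n. \<bar>y (p (Suc i)) - y (p i)\<bar>) \<le> B"
    using bv unfolding bounded_variation_on_def by blast
  show ?thesis
    unfolding bounded_variation_on_def
  proof (intro exI allI impI)
    fix n p assume p: "interval_partition 0 t n p"
    then have "interval_partition 0 T (Suc n) (p(Suc n := T))"
      using t by (auto simp: interval_partition_def less_Suc_eq)
    from B[OF this] show "(\<Sum>i<n. \<bar>y (p (Suc i)) - y (p i)\<bar>) \<le> B"
      by simp
  qed
qed

context levy_process
begin

lemma expectation_increment_cong: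
  assumes "0 \<le> s" "s \<le> t" and [measurable]: "f \<in> borel_measurable borel"
  shows "expectation (\<lambda>\<omega>. f (Y t \<omega> - Y s \<omega>)) = (expectation (\<lambda>\<omega>. f (Y (t - s) \<omega> - Y 0 \<omega>)) :: real)"
proof -
  have "expectation (\<lambda>\<omega>. f (Y t \<omega> - Y s \<omega>)) = integral\<^sup>L (distr M borel (\<lambda>\<omega>. Y t \<omega> - Y s \<omega>)) f"
    using assms by (subst integral_distr) auto
  also have "distr M borel (\<lambda>\<omega>. Y t \<omega> - Y s \<omega>) = distr M borel (\<lambda>\<omega>. Y (t - s) \<omega> - Y 0 \<omega>)"
    using stationary_increments[of s "t - s"] assms by simp
  also have "integral\<^sup>L \<dots> f = expectation (\<lambda>\<omega>. f (Y (t - s) \<omega> - Y 0 \<omega>))"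
    using assms by (subst integral_distr) auto
  finally show ?thesis .
qed

text \<open>A substitute for the mean absolute increment, which may be infinite.\<close>
definition truncated_mean :: "real \<Rightarrow> real" where
  "truncated_mean h = expectation (\<lambda>\<omega>. min 1 \<bar>Y h \<omega> - Y 0 \<omega>\<bar>)"

text \<open>The truncated dyadic sums increase under refinement because \<open>min 1
\<bar>x\<bar>\<close> is subadditive, and their means over \<open>J\<close> turns of the circle are
at most \<open>J * B\<close>. By monotone convergence their limit is almost surely finite.\<close>
lemma locally_bounded_variation_if_truncated_means_bounded:
  assumes B: "\<And>k. 2 ^ k * truncated_mean (2 * pi / 2 ^ k) \<le> B"
  shows "AE \<omega> in M. locally_bounded_variation (\<lambda>t. Y t \<omega>)"
proof -
  define F where "F J k \<omega> = (\<Sum>i<J * 2 ^ k. min 1 \<bar>Y (dyadic k (Suc i)) \<omega> - Y (dyadic k i) \<omega>\<bar>)"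
    for J k :: nat and \<omega>
  have [measurable]: "F J k \<in> borel_measurable M" for J k
    unfolding F_def[abs_def] by measurable
  have F0: "0 \<le> F J k \<omega>" for J k \<omega> unfolding F_def by (intro sum_nonneg) auto
  have "F J k \<omega> \<le> F J (Suc k) \<omega>" for J k \<omega>
  proof -
    let ?f = "\<lambda>i. min 1 \<bar>Y (dyadic (Suc k) (Suc i)) \<omega> - Y (dyadic (Suc k) i) \<omega>\<bar>"
    have "F J k \<omega> \<le> (\<Sum>i<J * 2 ^ k. ?f (2 * i) + ?f (Suc (2 * i)))"
      unfolding F_def
    proof (rule sum_mono)
      fix i
      have "dyadic k i = dyadic (Suc k) (2 * i)" "dyadic k (Suc i) = dyadic (Suc k) (Suc (Suc (2 * i)))"
        using dyadic_refine[of k i] dyadic_refine[of k "Suc i"] by auto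
      then show "min 1 \<bar>Y (dyadic k (Suc i)) \<omega> - Y (dyadic k i) \<omega>\<bar> \<le> ?f (2 * i) + ?f (Suc (2 * i))"
        by (auto simp: min_def)
    qed
    also have "\<dots> = (\<Sum>i<J * 2 ^ k. sum ?f {i * 2..<i * 2 + 2})"
      by (intro sum.cong) (auto simp: numeral_2_eq_2 mult.commute)
    also have "\<dots> = F J (Suc k) \<omega>"
      unfolding F_def by (subst sum.nat_group) (simp add: mult_ac)
    finally show ?thesis .
  qed
  then have mono: "incseq (\<lambda>k. F J k \<omega>)" for J \<omega> by (simp add: incseq_Suc_iff)
  have bounded: "AE \<omega> in M. \<exists>S. \<forall>k. F J k \<omega> \<le> S" for J
  proof -
    have "(\<integral>\<^sup>+\<omega>. ennreal (F J k \<omega>) \<partial>M) \<le> ennreal (real J * B)" for k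
    proof -
      have i: "integrable M (\<lambda>\<omega>. min 1 \<bar>Y (dyadic k (Suc i)) \<omega> - Y (dyadic k i) \<omega>\<bar>)" for i
        by (rule integrable_const_bound[where B=1]) auto
      have "integrable M (F J k)"
        unfolding F_def[abs_def] using i by (intro Bochner_Integration.integrable_sum) auto
      then have "(\<integral>\<^sup>+\<omega>. ennreal (F J k \<omega>) \<partial>M) = ennreal (expectation (F J k))"
        using F0 by (intro nn_integral_eq_integral) auto
      also have "expectation (F J k)
          = (\<Sum>i<J * 2 ^ k. expectation (\<lambda>\<omega>. min 1 \<bar>Y (dyadic k (Suc i)) \<omega> - Y (dyadic k i) \<omega>\<bar>))"
        unfolding F_def using i by (rule Bochner_Integration.integral_sum)
      also have "\<dots> = (\<Sum>i<J * 2 ^ k. truncated_mean (2 * pi / 2 ^ k))"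
        using expectation_increment_cong[OF dyadic_nonneg dyadic_mono[OF le_SucI[OF order_refl]],
            of "\<lambda>x. min 1 \<bar>x\<bar>"]
        unfolding truncated_mean_def dyadic_step by (intro sum.cong refl) simp
      also have "\<dots> = real J * (2 ^ k * truncated_mean (2 * pi / 2 ^ k))" by simp
      also have "\<dots> \<le> real J * B" using B by (intro mult_left_mono) auto
      finally show ?thesis by (simp add: ennreal_leI)
    qed
    then have "(\<integral>\<^sup>+\<omega>. (SUP k. ennreal (F J k \<omega>)) \<partial>M) \<le> ennreal (real J * B)"
      using mono by (subst nn_integral_monotone_convergence_SUP)
        (auto intro!: SUP_least simp: incseq_def le_fun_def ennreal_leI)
    then have "(\<integral>\<^sup>+\<omega>. (SUP k. ennreal (F J k \<omega>)) \<partial>M) \<noteq> \<infinity>"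
      by (auto simp: top_unique)
    then have "AE \<omega> in M. (SUP k. ennreal (F J k \<omega>)) \<noteq> \<infinity>"
      by (intro nn_integral_PInf_AE) auto
    then show ?thesis
    proof eventually_elim
      case (elim \<omega>)
      then obtain S where S: "0 \<le> S" "(SUP k. ennreal (F J k \<omega>)) = ennreal S"
        by (cases "SUP k. ennreal (F J k \<omega>)") auto
      have "ennreal (F J k \<omega>) \<le> ennreal S" for k
        unfolding S(2)[symmetric] by (rule SUP_upper) simp
      then show ?case using S(1) by (intro exI[of _ S]) simp
    qed
  qed
  have "AE \<omega> in M. \<forall>J. \<exists>S. \<forall>k. F J k \<omega> \<le> S"
    using bounded by (simp add: AE_all_countable)
  with cadlag_paths show ?thesis
  proof eventually_elim
    case (elim \<omega>)
    show ?case
      unfolding locally_bounded_variation_def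
    proof (intro allI impI)
      fix T :: real assume T: "0 < T"
      obtain J where J: "T / (2 * pi) < real J" using reals_Archimedean2 by blast
      obtain S where "\<And>k. F J k \<omega> \<le> S" using elim(2) by blast
      then have "bounded_variation_on 0 (2 * pi * real J) (\<lambda>t. Y t \<omega>)"
        by (intro bounded_variation_of_dyadic_sums[OF elim(1)]) (simp add: F_def)
      moreover have "T \<le> 2 * pi * real J" using J by (simp add: field_simps)
      ultimately show "bounded_variation_on 0 T (\<lambda>t. Y t \<omega>)"
        using bounded_variation_on_mono T by auto
    qed
  qed
qed

end

section \<open>A wave whose translates realise all phases\<close>

lemma cos_shift: "cos (y - 2 * pi * of_int n) = cos (y::real)"
  by (simp add: cos_diff cos_int_2pin sin_int_2pin)

lemma abs_cos_diff_le: "\<bar>cos x - cos y\<bar> \<le> \<bar>x - y\<bar>" for x y :: real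
proof -
  have "\<bar>cos x - cos y\<bar> = 2 * \<bar>sin ((x + y) / 2)\<bar> * \<bar>sin ((y - x) / 2)\<bar>"
    by (simp add: cos_diff_cos abs_mult)
  also have "\<dots> \<le> 2 * 1 * \<bar>(y - x) / 2\<bar>"
    by (intro mult_mono abs_sin_x_le_abs_x) auto
  finally show ?thesis by simp
qed

definition centre :: "nat \<Rightarrow> nat \<Rightarrow> real" where
  "centre m a = 2 * pi * (real a + 1 / 2) / real m"

text \<open>A continuous \<open>2 * pi\<close>-periodic bump over the \<open>a\<close>-th of
\<open>m\<close> equal windows: 1 at the centre, 0 outside the window, and at least
\<open>1/2\<close> on the middle half.\<close>
definition bump :: "nat \<Rightarrow> nat \<Rightarrow> real \<Rightarrow> real" where
  "bump m a x = max 0 (cos (x - centre m a) - cos (pi / real m)) / (1 - cos (pi / real m))"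

lemma bump_denominator_pos: "0 < m \<Longrightarrow> 0 < 1 - cos (pi / real m)"
  using cos_monotone_0_pi[of 0 "pi / real m"] by (simp add: field_simps)

lemma bump_bounds: "0 < m \<Longrightarrow> 0 \<le> bump m a x" "0 < m \<Longrightarrow> bump m a x \<le> 1"
  using bump_denominator_pos[of m] by (auto simp: bump_def divide_le_eq)

lemma bump_lipschitz:
  assumes "0 < m"
  shows "\<bar>bump m a x - bump m a y\<bar> \<le> \<bar>x - y\<bar> / (1 - cos (pi / real m))"
proof -
  let ?d = "1 - cos (pi / real m)"
  have "\<bar>max 0 (cos (x - centre m a) - cos (pi / real m)) - max 0 (cos (y - centre m a) - cos (pi / real m))\<bar>
    \<le> \<bar>cos (x - centre m a) - cos (y - centre m a)\<bar>"
    by (auto simp: max_def)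
  also have "\<dots> \<le> \<bar>x - y\<bar>" using abs_cos_diff_le[of "x - centre m a" "y - centre m a"] by simp
  finally show ?thesis
    using bump_denominator_pos[OF assms]
    by (simp add: bump_def diff_divide_distrib[symmetric] divide_right_mono)
qed

lemma bump_shift: "bump m a (x - 2 * pi * of_int n) = bump m a x"
  using cos_shift[of "x - centre m a" n] by (simp add: bump_def algebra_simps)

lemma bump_eq_0:
  assumes m: "0 < m" and x: "pi / real m \<le> \<bar>x - centre m a\<bar>" "\<bar>x - centre m a\<bar> \<le> 2 * pi - pi / real m"
  shows "bump m a x = 0"
proof -
  let ?t = "\<bar>x - centre m a\<bar>"
  have pm: "0 \<le> pi / real m" "pi / real m \<le> pi" using m by (auto simp: field_simps)
  have "cos ?t \<le> cos (pi / real m)"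
  proof (cases "?t \<le> pi")
    case True
    then show ?thesis using x pm by (intro cos_monotone_0_pi_le) auto
  next
    case False
    have "cos (2 * pi - ?t) \<le> cos (pi / real m)"
      using False x pm by (intro cos_monotone_0_pi_le) auto
    then show ?thesis by (simp add: cos_diff)
  qed
  then have "cos (x - centre m a) \<le> cos (pi / real m)" by (simp only: cos_abs_real)
  then show ?thesis by (simp add: bump_def)
qed

text \<open>With \<open>u = cos (pi / (2 * m))\<close> the value at the end of the middle half is
\<open>(1 + u - 2 u\<^sup>2) / (2 - 2 u\<^sup>2) = (1 + 2 u) / (2 (1 + u))\<close>.\<close>
lemma bump_ge_half:
  assumes m: "0 < m" and x: "\<bar>x - centre m a\<bar> \<le> pi / (2 * real m)"
  shows "1 / 2 \<le> bump m a x"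
proof -
  define u where "u = cos (pi / (2 * real m))"
  have pm: "pi / (2 * real m) \<le> pi / 2" "0 < pi / (2 * real m)"
    using m by (auto simp: field_simps)
  have u: "0 \<le> u" "u < 1"
    using pm cos_ge_zero[of "pi / (2 * real m)"] cos_monotone_0_pi[of 0 "pi / (2 * real m)"]
    by (auto simp: u_def)
  have "cos (pi / real m) = 2 * u\<^sup>2 - 1"
    using cos_double_cos[of "pi / (2 * real m)"] by (simp add: u_def)
  moreover have "u \<le> cos (x - centre m a)"
  proof -
    have "cos (pi / (2 * real m)) \<le> cos \<bar>x - centre m a\<bar>"
      using x pm by (intro cos_monotone_0_pi_le) auto
    then show ?thesis unfolding u_def by (simp only: cos_abs_real)
  qed
  ultimately have "(u - (2 * u\<^sup>2 - 1)) / (2 - 2 * u\<^sup>2) \<le> bump m a x"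
    using bump_denominator_pos[OF m] unfolding bump_def
    by (simp add: divide_right_mono)
  moreover have "(u - (2 * u\<^sup>2 - 1)) / (2 - 2 * u\<^sup>2) \<ge> 1 / 2"
  proof -
    have "u\<^sup>2 < 1" using u by (simp add: power_less_one_iff abs_square_less_1)
    moreover have "u\<^sup>2 \<le> u" using u by (simp add: power2_eq_square mult_left_le)
    ultimately show ?thesis by (simp add: le_divide_eq)
  qed
  ultimately show ?thesis by linarith
qed

lemma bump_outside_window:
  assumes m: "0 < m" and ab: "a < m" "b < m" "a \<noteq> b"
    and x: "2 * pi * real b / real m \<le> x" "x \<le> 2 * pi * (real b + 1) / real m"
  shows "bump m a x = 0"
proof (rule bump_eq_0[OF m])
  define t where "t = x * real m / (2 * pi)"
  have t: "real b \<le> t" "t \<le> real b + 1" and xt: "x = 2 * pi * t / real m"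
    using x m by (auto simp: t_def field_simps)
  have eq: "x - centre m a = 2 * pi / real m * (t - real a - 1 / 2)"
    by (simp add: xt centre_def algebra_simps diff_divide_distrib)
  have abs: "\<bar>x - centre m a\<bar> = 2 * pi / real m * \<bar>t - real a - 1 / 2\<bar>"
    unfolding eq by (simp add: abs_mult)
  have "1 / 2 \<le> \<bar>t - real a - 1 / 2\<bar>"
  proof (cases "a < b")
    case True
    then have "real a + 1 \<le> real b" by simp
    then show ?thesis using t by linarith
  next
    case False
    then have "real b + 1 \<le> real a" using ab by simp
    then show ?thesis using t by linarith
  qed
  then have "2 * pi / real m * (1 / 2) \<le> \<bar>x - centre m a\<bar>"
    unfolding abs using m by (intro mult_left_mono) auto
  then show "pi / real m \<le> \<bar>x - centre m a\<bar>" by simp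
  have "real a + 1 \<le> real m" "real b + 1 \<le> real m" using ab by simp_all
  then have "\<bar>t - real a - 1 / 2\<bar> \<le> real m - 1 / 2" using t by (simp add: abs_le_iff)
  then have "\<bar>x - centre m a\<bar> \<le> 2 * pi / real m * (real m - 1 / 2)"
    unfolding abs using m by (intro mult_left_mono) auto
  also have "\<dots> = 2 * pi - pi / real m" using m by (simp add: field_simps)
  finally show "\<bar>x - centre m a\<bar> \<le> 2 * pi - pi / real m" .
qed

definition carrier_wave :: "nat \<Rightarrow> nat \<Rightarrow> real \<Rightarrow> real" where
  "carrier_wave m q x = (\<Sum>a<m. bump m a x * cos (real q ^ Suc a * x))"

lemma carrier_wave_shift: "carrier_wave m q (x - 2 * pi * of_int n) = carrier_wave m q x"
proof -
  have "real q ^ Suc a * (x - 2 * pi * of_int n)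
      = real q ^ Suc a * x - 2 * pi * of_int (int q ^ Suc a * n)" for a
    by (simp add: algebra_simps)
  then show ?thesis
    unfolding carrier_wave_def bump_shift by (simp only: cos_shift)
qed

lemma continuous_carrier_wave: "0 < m \<Longrightarrow> continuous_on UNIV (carrier_wave m q)"
  unfolding carrier_wave_def[abs_def] bump_def[abs_def]
  using bump_denominator_pos[of m] by (intro continuous_intros) auto

text \<open>At every point at most one of the bumps is different from 0.\<close>
lemma abs_carrier_wave_le_1:
  assumes m: "0 < m"
  shows "\<bar>carrier_wave m q x\<bar> \<le> 1"
proof -
  \<comment> \<open>\<open>y\<close> is \<open>x\<close> reduced to \<open>[0, 2\<pi>)\<close>, and \<open>b\<close> the index of the window that contains it.\<close>
  define y where "y = x - 2 * pi * of_int \<lfloor>x / (2 * pi)\<rfloor>"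
  define b where "b = nat \<lfloor>y * real m / (2 * pi)\<rfloor>"
  have y: "0 \<le> y" "y < 2 * pi"
    using floor_divide_lower[of "2 * pi" x] floor_divide_upper[of "2 * pi" x]
    by (auto simp: y_def algebra_simps)
  then have "0 \<le> y * real m / (2 * pi)" "y * real m / (2 * pi) < real m"
    using m by (auto simp: field_simps)
  then have b: "real b \<le> y * real m / (2 * pi)" "y * real m / (2 * pi) < real b + 1" "b < m"
    unfolding b_def by linarith+
  then have "bump m a y = 0" if "a < m" "a \<noteq> b" for a
    using m that by (intro bump_outside_window[of m a b]) (auto simp: field_simps)
  then have "carrier_wave m q y = (\<Sum>a\<in>{b}. bump m a y * cos (real q ^ Suc a * y))"
    unfolding carrier_wave_def using b(3) by (intro sum.mono_neutral_right) auto
  also have "\<bar>\<dots>\<bar> \<le> 1 * 1"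
    using bump_bounds[OF m, of b y] by (simp add: abs_mult mult_le_one)
  finally show ?thesis using carrier_wave_shift[of m q x] by (simp add: y_def)
qed

text \<open>The translation that retards the \<open>a\<close>-th cosine by \<open>\<tau> a\<close>
quarter turns, for all \<open>a\<close> at the same time.\<close>
definition phase_shift :: "nat \<Rightarrow> nat \<Rightarrow> (nat \<Rightarrow> nat) \<Rightarrow> real" where
  "phase_shift m q \<tau> = (\<Sum>a<m. real (\<tau> a) * (pi / 2) / real q ^ Suc a)"

lemma phase_shift_bounds:
  assumes q: "0 < q" and \<tau>: "\<And>a. a < m \<Longrightarrow> \<tau> a < 4"
  shows "0 \<le> phase_shift m q \<tau>" "phase_shift m q \<tau> \<le> 6 * real m / real q"
proof -
  show "0 \<le> phase_shift m q \<tau>" unfolding phase_shift_def by (intro sum_nonneg) auto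
  have "phase_shift m q \<tau> \<le> (\<Sum>a<m. 6 / real q)"
    unfolding phase_shift_def
  proof (rule sum_mono)
    fix a assume "a \<in> {..<m}"
    then have "real (\<tau> a) * (pi / 2) \<le> 3 * (4 / 2)"
      using \<tau>[of a] pi_less_4 by (intro mult_mono divide_right_mono) auto
    moreover have "real q \<le> real q ^ Suc a" using q by (simp add: self_le_power)
    ultimately show "real (\<tau> a) * (pi / 2) / real q ^ Suc a \<le> 6 / real q"
      using q by (intro frac_le) auto
  qed
  then show "phase_shift m q \<tau> \<le> 6 * real m / real q" by (simp add: mult.commute)
qed

text \<open>Multiplied by \<open>q ^ Suc b\<close>, the terms of the shift with \<open>a < b\<close>
are multiples of \<open>2 * pi\<close> because 4 divides \<open>q\<close>, the term with \<open>a =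
b\<close> is the desired phase, and the terms with \<open>a > b\<close> are of order
\<open>1/q\<close>.\<close>
lemma phase_shift_phase:
  assumes q: "0 < q" "4 dvd q" and \<tau>: "\<And>a. a < m \<Longrightarrow> \<tau> a < 4" and b: "b < m"
  shows "\<bar>cos (real q ^ Suc b * (x - phase_shift m q \<tau>)) - cos (real q ^ Suc b * x - real (\<tau> b) * (pi / 2))\<bar>
    \<le> 6 * real m / real q"
proof -
  let ?c = "\<lambda>a. real q ^ Suc b * (real (\<tau> a) * (pi / 2) / real q ^ Suc a)"
  have int: "\<exists>n::int. ?c a = 2 * pi * of_int n" if "a < b" for a
  proof -
    obtain s where s: "q = 4 * s" using q(2) by auto
    have "Suc b = Suc a + Suc (b - a - 1)" using that by simp
    then have "real q ^ Suc b = real q ^ Suc a * (4 * real s * real q ^ (b - a - 1))"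
      by (simp only: power_add power_Suc) (simp add: s)
    then have "?c a = 2 * pi * (real s * real q ^ (b - a - 1) * real (\<tau> a))"
      using q(1) by simp
    also have "\<dots> = 2 * pi * of_int (int s * int q ^ (b - a - 1) * int (\<tau> a))" by simp
    finally show ?thesis by blast
  qed
  then obtain n :: "nat \<Rightarrow> int" where n: "\<And>a. a < b \<Longrightarrow> ?c a = 2 * pi * of_int (n a)" by metis
  define r where "r = (\<Sum>a=Suc b..<m. ?c a)"
  have r: "0 \<le> r" "r \<le> 6 * real m / real q"
  proof -
    show "0 \<le> r" unfolding r_def by (intro sum_nonneg) auto
    have "r \<le> (\<Sum>a=Suc b..<m. 6 / real q)"
      unfolding r_def
    proof (rule sum_mono)
      fix a assume a: "a \<in> {Suc b..<m}"
      have "Suc a = Suc b + (a - b)" using a by simp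
      then have e: "real q ^ Suc a = real q ^ Suc b * real q ^ (a - b)" by (simp only: power_add)
      have "?c a = real (\<tau> a) * (pi / 2) / real q ^ (a - b)"
        unfolding e using q(1) by simp
      also have "\<dots> \<le> 6 / real q"
      proof (intro frac_le)
        have "real (\<tau> a) * (pi / 2) \<le> 3 * (4 / 2)"
          using \<tau>[of a] a pi_less_4 by (intro mult_mono divide_right_mono) auto
        then show "real (\<tau> a) * (pi / 2) \<le> 6" by simp
        show "real q \<le> real q ^ (a - b)" using a q(1) by (intro self_le_power) auto
      qed (use q(1) in auto)
      finally show "?c a \<le> 6 / real q" .
    qed
    also have "\<dots> = real (m - Suc b) * (6 / real q)" by simp
    also have "\<dots> \<le> real m * (6 / real q)" by (intro mult_right_mono) auto
    finally show "r \<le> 6 * real m / real q" by (simp add: mult.commute)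
  qed
  have "real q ^ Suc b * phase_shift m q \<tau> = (\<Sum>a<m. ?c a)"
    unfolding phase_shift_def by (simp add: sum_distrib_left)
  also have "\<dots> = (\<Sum>a<b. ?c a) + (\<Sum>a=b..<m. ?c a)"
    using b by (simp only: lessThan_atLeast0 sum.atLeastLessThan_concat[OF le0 less_imp_le])
  also have "(\<Sum>a=b..<m. ?c a) = ?c b + r"
    using b by (simp only: r_def sum.atLeast_Suc_lessThan)
  also have "?c b = real (\<tau> b) * (pi / 2)" using q(1) by simp
  also have "(\<Sum>a<b. ?c a) = 2 * pi * of_int (\<Sum>a<b. n a)"
    using n by (simp add: sum_distrib_left)
  finally have "real q ^ Suc b * (x - phase_shift m q \<tau>)
      = (real q ^ Suc b * x - real (\<tau> b) * (pi / 2) - r) - 2 * pi * of_int (\<Sum>a<b. n a)"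
    by (simp add: right_diff_distrib)
  then have "cos (real q ^ Suc b * (x - phase_shift m q \<tau>)) = cos (real q ^ Suc b * x - real (\<tau> b) * (pi / 2) - r)"
    by (simp only: cos_shift)
  then show ?thesis
    using abs_cos_diff_le[of "real q ^ Suc b * x - real (\<tau> b) * (pi / 2) - r" "real q ^ Suc b * x - real (\<tau> b) * (pi / 2)"] r
    by simp
qed

text \<open>For fixed \<open>m\<close> the error tends to 0 as \<open>q\<close> grows, uniformly in
\<open>x\<close> and in the phases.\<close>
lemma carrier_wave_translate:
  assumes m: "0 < m" and q: "0 < q" "4 dvd q" and \<tau>: "\<And>a. a < m \<Longrightarrow> \<tau> a < 4"
  shows "\<bar>carrier_wave m q (x - phase_shift m q \<tau>)
      - (\<Sum>a<m. bump m a x * cos (real q ^ Suc a * x - real (\<tau> a) * (pi / 2)))\<bar>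
    \<le> 6 * (real m)\<^sup>2 * (1 / (1 - cos (pi / real m)) + 1) / real q"
proof -
  let ?z = "phase_shift m q \<tau>" and ?d = "1 - cos (pi / real m)"
  have "\<bar>carrier_wave m q (x - ?z) - (\<Sum>a<m. bump m a x * cos (real q ^ Suc a * x - real (\<tau> a) * (pi / 2)))\<bar>
    \<le> (\<Sum>a<m. \<bar>bump m a (x - ?z) * cos (real q ^ Suc a * (x - ?z))
          - bump m a x * cos (real q ^ Suc a * x - real (\<tau> a) * (pi / 2))\<bar>)"
    unfolding carrier_wave_def sum_subtractf[symmetric] by (rule sum_abs)
  also have "\<dots> \<le> (\<Sum>a<m. (6 * real m / real q) / ?d + 6 * real m / real q)"
  proof (rule sum_mono)
    fix a assume a: "a \<in> {..<m}"
    let ?A = "bump m a (x - ?z)" and ?B = "bump m a x" and ?C = "cos (real q ^ Suc a * (x - ?z))"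
      and ?D = "cos (real q ^ Suc a * x - real (\<tau> a) * (pi / 2))"
    have "\<bar>?A - ?B\<bar> \<le> \<bar>x - ?z - x\<bar> / ?d" by (rule bump_lipschitz[OF m])
    also have "\<dots> \<le> (6 * real m / real q) / ?d"
      using phase_shift_bounds[OF q(1), of m \<tau>] \<tau> bump_denominator_pos[OF m]
      by (intro divide_right_mono) auto
    finally have AB: "\<bar>?A - ?B\<bar> \<le> (6 * real m / real q) / ?d" .
    have CD: "\<bar>?C - ?D\<bar> \<le> 6 * real m / real q"
      using phase_shift_phase[OF q, of m \<tau> a x] \<tau> a by simp
    have "\<bar>?A * ?C - ?B * ?D\<bar> = \<bar>(?A - ?B) * ?C + ?B * (?C - ?D)\<bar>"
      by (simp add: algebra_simps)
    also have "\<dots> \<le> \<bar>?A - ?B\<bar> * \<bar>?C\<bar> + \<bar>?B\<bar> * \<bar>?C - ?D\<bar>"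
      by (rule order_trans[OF abs_triangle_ineq]) (simp add: abs_mult)
    also have "\<dots> \<le> \<bar>?A - ?B\<bar> * 1 + 1 * \<bar>?C - ?D\<bar>"
      using bump_bounds[OF m, of a x] by (intro add_mono mult_left_mono mult_right_mono) auto
    finally show "\<bar>?A * ?C - ?B * ?D\<bar> \<le> (6 * real m / real q) / ?d + 6 * real m / real q"
      using AB CD by simp
  qed
  also have "\<dots> = 6 * (real m)\<^sup>2 * (1 / ?d + 1) / real q"
  proof -
    have "real m * (6 * real m / real q / D + 6 * real m / real q)
        = 6 * (real m)\<^sup>2 * (1 / D + 1) / real q" for D
      by (simp add: power2_eq_square distrib_left add_divide_distrib mult_ac)
    then show ?thesis by simp
  qed
  finally show ?thesis .
qed

section \<open>Resonance of the wave with the noise\<close>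

lemma dyadic_partition: "interval_partition 0 (2 * pi) (2 ^ k) (dyadic k)"
  by (simp add: interval_partition_def dyadic_mono) (simp add: dyadic_def)

lemma dyadic_scale: "dyadic (k + j) (t * 2 ^ j) = dyadic k t"
  by (simp add: dyadic_def power_add)

text \<open>The left sum on the \<open>k\<close>-th dyadic grid for the value at \<open>z\<close> of
the mild solution at time \<open>2 * pi\<close>. Unlike the limit it is defined for every path and
exactly linear in \<open>f\<close>.\<close>
definition conv_sum :: "nat \<Rightarrow> (real \<Rightarrow> real) \<Rightarrow> real \<Rightarrow> (real \<Rightarrow> real) \<Rightarrow> real" where
  "conv_sum k f z y = left_sum (\<lambda>s. rotation (2 * pi - s) f z) (2 ^ k) (dyadic k) y"

text \<open>The cells of the grid of level \<open>\<mu> + 2 + j\<close> that make up the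
\<open>a\<close>-th of \<open>2 ^ \<mu>\<close> windows. The two extra levels make the quarters of a
window consist of whole cells.\<close>
definition window :: "nat \<Rightarrow> nat \<Rightarrow> nat set" where
  "window j a = {4 * a * 2 ^ j ..< 4 * (a + 1) * 2 ^ j}"

definition mid_window :: "nat \<Rightarrow> nat \<Rightarrow> nat set" where
  "mid_window j a = {(4 * a + 1) * 2 ^ j ..< (4 * a + 3) * 2 ^ j}"

lemma mid_window_subset: "mid_window j a \<subseteq> window j a"
proof -
  have "4 * a * 2 ^ j \<le> (4 * a + 1) * 2 ^ j" "(4 * a + 3) * 2 ^ j \<le> 4 * (a + 1) * (2 ^ j :: nat)"
    by (intro mult_right_mono; simp)+
  then show ?thesis unfolding mid_window_def window_def by (intro ivl_subset[THEN iffD2] disjI2 conjI)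
qed

lemma window_subset:
  assumes "a < 2 ^ \<mu>"
  shows "window j a \<subseteq> {..<2 ^ (\<mu> + 2 + j)}"
proof -
  have "4 * (a + 1) * 2 ^ j \<le> 4 * 2 ^ \<mu> * (2 ^ j :: nat)"
    using assms by (intro mult_right_mono mult_left_mono) auto
  also have "\<dots> = 2 ^ (\<mu> + 2 + j)" by (simp add: power_add)
  finally show ?thesis unfolding window_def by auto
qed

lemma disjoint_windows: "disjoint_family_on (window j) A"
proof -
  have "window j a \<inter> window j b = {}" if "a < b" for a b
  proof -
    have "4 * (a + 1) * 2 ^ j \<le> 4 * b * (2 ^ j :: nat)"
      using that by (intro mult_right_mono mult_left_mono) auto
    then show ?thesis unfolding window_def by auto
  qed
  then show ?thesis unfolding disjoint_family_on_def by (metis inf_commute linorder_neqE_nat)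
qed

lemma bump_off_window:
  assumes a: "a < 2 ^ \<mu>" and i: "i < 2 ^ (\<mu> + 2 + j)" "i \<notin> window j a"
  shows "bump (2 ^ \<mu>) a (dyadic (\<mu> + 2 + j) i) = 0"
proof -
  \<comment> \<open>the window that contains the \<open>i\<close>-th cell\<close>
  define b where "b = i div (4 * 2 ^ j)"
  have b1: "b * (4 * 2 ^ j) \<le> i" "i < (b + 1) * (4 * 2 ^ j)"
    using div_mult_mod_eq[of i "4 * 2 ^ j"] mod_less_divisor[of "4 * 2 ^ j" i]
    unfolding b_def by (simp, simp add: dividend_less_div_times)
  have b2: "b < 2 ^ \<mu>"
    using i(1) unfolding b_def by (intro less_mult_imp_div_less) (simp add: power_add mult_ac)
  have ab: "a \<noteq> b" using b1 i(2) by (auto simp: window_def algebra_simps)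
  have 1: "real b * (4 * 2 ^ j) \<le> real i" "real i \<le> (real b + 1) * (4 * 2 ^ j)"
  proof -
    have "real (b * (4 * 2 ^ j)) \<le> real i" "real i \<le> real ((b + 1) * (4 * 2 ^ j))"
      using b1 by (simp_all only: of_nat_le_iff less_imp_le)
    then show "real b * (4 * 2 ^ j) \<le> real i" "real i \<le> (real b + 1) * (4 * 2 ^ j)"
      by (simp_all only: of_nat_mult of_nat_add of_nat_power of_nat_numeral of_nat_1)
  qed
  show ?thesis
  proof (rule bump_outside_window[OF _ a b2 ab])
    have "2 * pi * real b / real (2 ^ \<mu>) = 2 * pi * (real b * (4 * 2 ^ j)) / 2 ^ (\<mu> + 2 + j)"
      by (simp add: power_add)
    also have "\<dots> \<le> dyadic (\<mu> + 2 + j) i"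
      unfolding dyadic_def using 1 by (intro divide_right_mono mult_left_mono) auto
    finally show "2 * pi * real b / real (2 ^ \<mu>) \<le> dyadic (\<mu> + 2 + j) i" .
    have "dyadic (\<mu> + 2 + j) i \<le> 2 * pi * ((real b + 1) * (4 * 2 ^ j)) / 2 ^ (\<mu> + 2 + j)"
      unfolding dyadic_def using 1 by (intro divide_right_mono mult_left_mono) auto
    also have "\<dots> = 2 * pi * (real b + 1) / real (2 ^ \<mu>)" by (simp add: power_add)
    finally show "dyadic (\<mu> + 2 + j) i \<le> 2 * pi * (real b + 1) / real (2 ^ \<mu>)" .
  qed simp
qed

lemma bump_mid_window:
  assumes "i \<in> mid_window j a"
  shows "1 / 2 \<le> bump (2 ^ \<mu>) a (dyadic (\<mu> + 2 + j) i)"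
proof (rule bump_ge_half)
  have "(4 * a + 1) * 2 ^ j \<le> i" "i \<le> (4 * a + 3) * 2 ^ j" using assms by (auto simp: mid_window_def)
  then have "dyadic (\<mu> + 2) (4 * a + 1) \<le> dyadic (\<mu> + 2 + j) i" "dyadic (\<mu> + 2 + j) i \<le> dyadic (\<mu> + 2) (4 * a + 3)"
    using dyadic_mono[of _ _ "\<mu> + 2 + j"] dyadic_scale[of "\<mu> + 2" j] by metis+
  moreover have "dyadic (\<mu> + 2) (4 * a + 1) = centre (2 ^ \<mu>) a - pi / (2 * real (2 ^ \<mu>))"
    "dyadic (\<mu> + 2) (4 * a + 3) = centre (2 ^ \<mu>) a + pi / (2 * real (2 ^ \<mu>))"
    by (simp_all add: dyadic_def centre_def power_add field_simps)
  ultimately show "\<bar>dyadic (\<mu> + 2 + j) i - centre (2 ^ \<mu>) a\<bar> \<le> pi / (2 * real (2 ^ \<mu>))"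
    by (simp only: abs_le_iff) linarith
qed simp

lemma cos_quarter_phases:
  fixes t :: real
  shows "cos (t - real 0 * (pi / 2)) = cos t" "cos (t - real 1 * (pi / 2)) = sin t"
    "cos (t - real 2 * (pi / 2)) = - cos t" "cos (t - real 3 * (pi / 2)) = - sin t"
proof -
  have "cos (3 * pi / 2) = 0" "sin (3 * pi / 2) = - 1"
    using cos_3over2_pi sin_3over2_pi by simp_all
  then show "cos (t - real 0 * (pi / 2)) = cos t" "cos (t - real 1 * (pi / 2)) = sin t"
    "cos (t - real 2 * (pi / 2)) = - cos t" "cos (t - real 3 * (pi / 2)) = - sin t"
    by (simp_all add: cos_diff)
qed

text \<open>This is why both phases of the wave are used: where one of the weights degenerates the
other does not.\<close>
lemma half_le_abs_cos_or_sin: "1 / 2 \<le> \<bar>cos t\<bar> \<or> 1 / 2 \<le> \<bar>sin (t::real)\<bar>"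
proof (rule ccontr)
  assume "\<not> ?thesis"
  then have "\<bar>cos t\<bar>\<^sup>2 < (1 / 2)\<^sup>2" "\<bar>sin t\<bar>\<^sup>2 < (1 / 2)\<^sup>2"
    by (intro power_strict_mono; simp)+
  then show False using sin_cos_squared_add[of t] by (simp add: power_divide)
qed

context levy_process
begin

definition grid_increment :: "nat \<Rightarrow> nat \<Rightarrow> 'w \<Rightarrow> real" where
  "grid_increment k i \<omega> = Y (dyadic k (Suc i)) \<omega> - Y (dyadic k i) \<omega>"

lemma grid_increment_measurable [measurable]: "grid_increment k i \<in> borel_measurable M"
  unfolding grid_increment_def[abs_def] by (rule increment_measurable) auto

lemma grid_increment_indep: "indep_vars (\<lambda>_. borel) (grid_increment k) {..<2 ^ k}"
  using partition_indep[OF dyadic_partition] unfolding grid_increment_def[abs_def] by simp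

text \<open>At each cell of the middle half of the window one of the two weights has modulus at
least \<open>1/4\<close>, so \<open>sector_comparison\<close> bounds the two weighted sums below by
the increment of \<open>Y\<close> over that middle half. The error is linear in the length \<open>2
* pi / 2 ^ \<mu>\<close> of the window, so that it stays bounded after summation over the \<open>2 ^
\<mu>\<close> windows.\<close>
lemma window_expectation:
  fixes c s :: "nat \<Rightarrow> real"
  assumes C: "0 < C"
    "\<And>s t. 0 \<le> s \<Longrightarrow> s \<le> t \<Longrightarrow> expectation (\<lambda>\<omega>. min 1 ((Y t \<omega> - Y s \<omega>)\<^sup>2)) \<le> C * (t - s)"
    "\<And>s t. 0 \<le> s \<Longrightarrow> s \<le> t \<Longrightarrow> \<bar>expectation (\<lambda>\<omega>. sin (Y t \<omega> - Y s \<omega>))\<bar> \<le> C * (t - s)"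
    and a: "a < 2 ^ \<mu>" and k: "k = \<mu> + 2 + j"
    and cs: "\<And>i. \<bar>c i\<bar> \<le> 1" "\<And>i. \<bar>s i\<bar> \<le> 1"
    and large: "\<And>i. i \<in> mid_window j a \<Longrightarrow> 1 / 4 \<le> \<bar>c i\<bar> \<or> 1 / 4 \<le> \<bar>s i\<bar>"
  shows "truncated_mean (2 * pi / 2 ^ Suc \<mu>) / 16 - 26 * pi * C / 2 ^ \<mu>
    \<le> expectation (\<lambda>\<omega>. min 1 (\<bar>\<Sum>i\<in>window j a. c i * grid_increment k i \<omega>\<bar> + \<bar>\<Sum>i\<in>window j a. s i * grid_increment k i \<omega>\<bar>))"
proof -
  let ?I = "window j a" and ?J = "mid_window j a"
  let ?U = "\<lambda>\<omega>. \<Sum>i\<in>?I. c i * grid_increment k i \<omega>" and ?V = "\<lambda>\<omega>. \<Sum>i\<in>?I. s i * grid_increment k i \<omega>"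
  let ?Q = "\<lambda>\<omega>. min 1 (\<bar>?U \<omega>\<bar> + \<bar>?V \<omega>\<bar>)"
  have ind: "indep_vars (\<lambda>_. borel) (grid_increment k) ?I"
    using grid_increment_indep[of k] window_subset[OF a] unfolding k by (rule indep_vars_subset)
  have v: "expectation (\<lambda>\<omega>. min 1 ((grid_increment k i \<omega>)\<^sup>2)) \<le> C * (2 * pi / 2 ^ k)"
    "\<bar>expectation (\<lambda>\<omega>. sin (grid_increment k i \<omega>))\<bar> \<le> C * (2 * pi / 2 ^ k)" for i
  proof -
    have "dyadic k i \<le> dyadic k (Suc i)" by (simp add: dyadic_mono)
    from C(2)[OF dyadic_nonneg this] C(3)[OF dyadic_nonneg this]
    show "expectation (\<lambda>\<omega>. min 1 ((grid_increment k i \<omega>)\<^sup>2)) \<le> C * (2 * pi / 2 ^ k)"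
      "\<bar>expectation (\<lambda>\<omega>. sin (grid_increment k i \<omega>))\<bar> \<le> C * (2 * pi / 2 ^ k)"
      unfolding grid_increment_def dyadic_step by auto
  qed
  have total: "(\<Sum>i\<in>?I. C * (2 * pi / 2 ^ k)) = 2 * pi * C / 2 ^ \<mu>"
  proof -
    have "card ?I = 4 * 2 ^ j" by (simp add: window_def algebra_simps)
    then show ?thesis by (simp add: k power_add)
  qed
  have J: "(\<Sum>i\<in>?J. grid_increment k i \<omega>) = Y (dyadic (\<mu> + 2) (4 * a + 3)) \<omega> - Y (dyadic (\<mu> + 2) (4 * a + 1)) \<omega>" for \<omega>
  proof -
    have "(4 * a + 1) * 2 ^ j \<le> (4 * a + 3) * (2 ^ j :: nat)" by (intro mult_right_mono) auto
    from sum_Suc_diff'[OF this, of "\<lambda>i. Y (dyadic k i) \<omega>"]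
    show ?thesis unfolding mid_window_def grid_increment_def k dyadic_scale .
  qed
  have step: "dyadic (\<mu> + 2) (4 * a + 3) - dyadic (\<mu> + 2) (4 * a + 1) = 2 * pi / 2 ^ Suc \<mu>"
    by (simp add: dyadic_def power_add field_simps)
  have tm: "expectation (\<lambda>\<omega>. min 1 \<bar>\<Sum>i\<in>?J. grid_increment k i \<omega>\<bar>) = truncated_mean (2 * pi / 2 ^ Suc \<mu>)"
    unfolding J truncated_mean_def step[symmetric]
    using expectation_increment_cong[OF dyadic_nonneg dyadic_mono, of "4 * a + 1" "4 * a + 3" "\<lambda>x. min 1 \<bar>x\<bar>" "\<mu> + 2"]
    by simp
  have [measurable]: "?U \<in> borel_measurable M" "?V \<in> borel_measurable M" by measurable
  have le: "expectation (\<lambda>\<omega>. min 1 \<bar>?U \<omega>\<bar>) \<le> expectation ?Q" "expectation (\<lambda>\<omega>. min 1 \<bar>?V \<omega>\<bar>) \<le> expectation ?Q"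
    by (intro integral_mono integrable_const_bound[where B=1]; auto)+
  have "1 / 4 * expectation (\<lambda>\<omega>. min 1 \<bar>\<Sum>i\<in>?J. grid_increment k i \<omega>\<bar>)
    \<le> 2 * (expectation (\<lambda>\<omega>. min 1 \<bar>?U \<omega>\<bar>) + expectation (\<lambda>\<omega>. min 1 \<bar>?V \<omega>\<bar>))
       + (12 + 2 * (1 / 4)) * (\<Sum>i\<in>?I. C * (2 * pi / 2 ^ k))"
    using v cs large mid_window_subset by (intro sector_comparison ind) (auto simp: window_def)
  then have "truncated_mean (2 * pi / 2 ^ Suc \<mu>) / 4 \<le> 4 * expectation ?Q + 25 / 2 * (2 * pi * C / 2 ^ \<mu>)"
    unfolding tm total using le by simp
  moreover have "0 \<le> pi * C / 2 ^ \<mu>" using C(1) by simp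
  ultimately show ?thesis by (simp add: field_simps)
qed

text \<open>Given the path, choose in each window the quarter turn for which the weighted sum equals
\<open>max \<bar>U a\<bar> \<bar>V a\<bar>\<close>. So if all phase patterns give sums of modulus at
most \<open>R\<close>, then \<open>\<Sum>a. Q a \<le> 2 R\<close> with \<open>Q a = min 1 (\<bar>U
a\<bar> + \<bar>V a\<bar>)\<close>, an event that \<open>prob_sum_le_exp\<close> makes unlikely. The
bound does not depend on \<open>j\<close>, that is, on how fine the grid is, nor on
\<open>q\<close>.\<close>
lemma resonance_prob:
  fixes \<mu> j q :: nat
  assumes C: "0 < C"
    "\<And>s t. 0 \<le> s \<Longrightarrow> s \<le> t \<Longrightarrow> expectation (\<lambda>\<omega>. min 1 ((Y t \<omega> - Y s \<omega>)\<^sup>2)) \<le> C * (t - s)"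
    "\<And>s t. 0 \<le> s \<Longrightarrow> s \<le> t \<Longrightarrow> \<bar>expectation (\<lambda>\<omega>. sin (Y t \<omega> - Y s \<omega>))\<bar> \<le> C * (t - s)"
  defines "k \<equiv> \<mu> + 2 + j"
  defines "T \<equiv> \<lambda>\<tau> \<omega>. \<Sum>i<2 ^ k. (\<Sum>a<2 ^ \<mu>. bump (2 ^ \<mu>) a (dyadic k i)
       * cos (real q ^ Suc a * dyadic k i - real (\<tau> a) * (pi / 2))) * grid_increment k i \<omega>"
  shows "prob {\<omega> \<in> space M. \<forall>\<tau>\<in>{..<2 ^ \<mu>} \<rightarrow>\<^sub>E {..<4}. \<bar>T \<tau> \<omega>\<bar> \<le> R}
    \<le> exp (2 * R - (2 ^ Suc \<mu> * truncated_mean (2 * pi / 2 ^ Suc \<mu>) / 64 - 13 * pi * C))"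
proof -
  define c s where "c a i = bump (2 ^ \<mu>) a (dyadic k i) * cos (real q ^ Suc a * dyadic k i)"
    and "s a i = bump (2 ^ \<mu>) a (dyadic k i) * sin (real q ^ Suc a * dyadic k i)" for a i
  define U V where "U a \<omega> = (\<Sum>i\<in>window j a. c a i * grid_increment k i \<omega>)"
    and "V a \<omega> = (\<Sum>i\<in>window j a. s a i * grid_increment k i \<omega>)" for a \<omega>
  define Q where "Q a \<omega> = min 1 (\<bar>U a \<omega>\<bar> + \<bar>V a \<omega>\<bar>)" for a \<omega>
  have [measurable]: "U a \<in> borel_measurable M" "V a \<in> borel_measurable M" for a
    unfolding U_def[abs_def] V_def[abs_def] by measurable
  then have [measurable]: "Q a \<in> borel_measurable M" for a
    unfolding Q_def[abs_def] by measurable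
  have EQ: "truncated_mean (2 * pi / 2 ^ Suc \<mu>) / 16 - 26 * pi * C / 2 ^ \<mu> \<le> expectation (Q a)" if a: "a < 2 ^ \<mu>" for a
    unfolding Q_def[abs_def] U_def V_def
  proof (rule window_expectation[OF C a])
    show "k = \<mu> + 2 + j" by (simp add: k_def)
    show "\<bar>c a i\<bar> \<le> 1" "\<bar>s a i\<bar> \<le> 1" for i
      using bump_bounds[of "2 ^ \<mu>" a "dyadic k i"] unfolding c_def s_def abs_mult
      by (auto intro!: mult_le_one)
    fix i assume "i \<in> mid_window j a"
    then have b: "1 / 2 \<le> \<bar>bump (2 ^ \<mu>) a (dyadic k i)\<bar>"
      unfolding k_def by (rule order_trans[OF bump_mid_window abs_ge_self])
    have "1 / 2 * (1 / 2) \<le> \<bar>c a i\<bar> \<or> 1 / 2 * (1 / 2) \<le> \<bar>s a i\<bar>"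
      using half_le_abs_cos_or_sin[of "real q ^ Suc a * dyadic k i"] mult_mono[OF b]
      unfolding c_def s_def abs_mult by force
    then show "1 / 4 \<le> \<bar>c a i\<bar> \<or> 1 / 4 \<le> \<bar>s a i\<bar>" by simp
  qed
  have indQ: "indep_vars (\<lambda>_. borel) Q {..<2 ^ \<mu>}"
  proof -
    have "indep_vars (\<lambda>a. PiM (window j a) (\<lambda>_. borel)) (\<lambda>a \<omega>. restrict (\<lambda>i. grid_increment k i \<omega>) (window j a)) {..<2 ^ \<mu>}"
      using window_subset disjoint_windows unfolding k_def
      by (intro indep_vars_restrict[OF grid_increment_indep]) auto
    then have "indep_vars (\<lambda>_. borel) (\<lambda>a \<omega>. (\<lambda>x. min 1 (\<bar>\<Sum>i\<in>window j a. c a i * x i\<bar> + \<bar>\<Sum>i\<in>window j a. s a i * x i\<bar>))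
        (restrict (\<lambda>i. grid_increment k i \<omega>) (window j a))) {..<2 ^ \<mu>}"
      by (rule indep_vars_compose2) measurable
    moreover have "(\<lambda>a \<omega>. (\<lambda>x. min 1 (\<bar>\<Sum>i\<in>window j a. c a i * x i\<bar> + \<bar>\<Sum>i\<in>window j a. s a i * x i\<bar>))
        (restrict (\<lambda>i. grid_increment k i \<omega>) (window j a))) = Q"
      by (auto simp: fun_eq_iff Q_def U_def V_def cong: sum.cong)
    ultimately show ?thesis by simp
  qed
  have T: "T \<tau> \<omega> = (\<Sum>a<2 ^ \<mu>. \<Sum>i\<in>window j a. bump (2 ^ \<mu>) a (dyadic k i)
      * cos (real q ^ Suc a * dyadic k i - real (\<tau> a) * (pi / 2)) * grid_increment k i \<omega>)" for \<tau> \<omega>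
  proof -
    have "T \<tau> \<omega> = (\<Sum>a<2 ^ \<mu>. \<Sum>i<2 ^ k. bump (2 ^ \<mu>) a (dyadic k i)
      * cos (real q ^ Suc a * dyadic k i - real (\<tau> a) * (pi / 2)) * grid_increment k i \<omega>)"
      unfolding T_def sum_distrib_right by (rule sum.swap)
    also have "\<dots> = (\<Sum>a<2 ^ \<mu>. \<Sum>i\<in>window j a. bump (2 ^ \<mu>) a (dyadic k i)
      * cos (real q ^ Suc a * dyadic k i - real (\<tau> a) * (pi / 2)) * grid_increment k i \<omega>)"
      using window_subset bump_off_window unfolding k_def
      by (intro sum.cong refl sum.mono_neutral_right) auto
    finally show ?thesis .
  qed
  have choose: "\<exists>\<tau>\<in>{..<2 ^ \<mu>} \<rightarrow>\<^sub>E {..<4}. (\<Sum>a<2 ^ \<mu>. Q a \<omega>) \<le> 2 * T \<tau> \<omega>" for \<omega>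
  proof -
    \<comment> \<open>The quarter turns 0, 1, 2, 3 produce the sums \<open>U a\<close>, \<open>V a\<close>, \<open>- U a\<close>, \<open>- V a\<close>.\<close>
    define \<tau> :: "nat \<Rightarrow> nat" where "\<tau> a = (if \<bar>V a \<omega>\<bar> \<le> \<bar>U a \<omega>\<bar> then (if 0 \<le> U a \<omega> then 0 else 2)
      else (if 0 \<le> V a \<omega> then 1 else 3))" for a
    have "T (restrict \<tau> {..<2 ^ \<mu>}) \<omega> = (\<Sum>a<2 ^ \<mu>. max \<bar>U a \<omega>\<bar> \<bar>V a \<omega>\<bar>)"
      unfolding T
    proof (rule sum.cong[OF refl])
      fix a assume "a \<in> {..<2 ^ \<mu> :: nat}"
      then have "(\<Sum>i\<in>window j a. bump (2 ^ \<mu>) a (dyadic k i)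
          * cos (real q ^ Suc a * dyadic k i - real (restrict \<tau> {..<2 ^ \<mu>} a) * (pi / 2)) * grid_increment k i \<omega>)
        = (if \<tau> a = 0 then U a \<omega> else if \<tau> a = 1 then V a \<omega> else if \<tau> a = 2 then - U a \<omega> else - V a \<omega>)"
        unfolding \<tau>_def restrict_def U_def V_def c_def s_def
        using cos_quarter_phases by (auto simp: sum_negf)
      also have "\<dots> = max \<bar>U a \<omega>\<bar> \<bar>V a \<omega>\<bar>" by (auto simp: \<tau>_def max_def)
      finally show "(\<Sum>i\<in>window j a. bump (2 ^ \<mu>) a (dyadic k i)
          * cos (real q ^ Suc a * dyadic k i - real (restrict \<tau> {..<2 ^ \<mu>} a) * (pi / 2)) * grid_increment k i \<omega>)
        = max \<bar>U a \<omega>\<bar> \<bar>V a \<omega>\<bar>" .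
    qed
    moreover have "(\<Sum>a<2 ^ \<mu>. Q a \<omega>) \<le> (\<Sum>a<2 ^ \<mu>. 2 * max \<bar>U a \<omega>\<bar> \<bar>V a \<omega>\<bar>)"
      by (intro sum_mono) (auto simp: Q_def min_def max_def)
    ultimately have "(\<Sum>a<2 ^ \<mu>. Q a \<omega>) \<le> 2 * T (restrict \<tau> {..<2 ^ \<mu>}) \<omega>"
      by (simp add: sum_distrib_left)
    moreover have "restrict \<tau> {..<2 ^ \<mu>} \<in> {..<2 ^ \<mu>} \<rightarrow>\<^sub>E {..<4}" by (auto simp: \<tau>_def)
    ultimately show ?thesis by blast
  qed
  have "prob {\<omega> \<in> space M. \<forall>\<tau>\<in>{..<2 ^ \<mu>} \<rightarrow>\<^sub>E {..<4}. \<bar>T \<tau> \<omega>\<bar> \<le> R}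
    \<le> prob {\<omega> \<in> space M. (\<Sum>a<2 ^ \<mu>. Q a \<omega>) \<le> 2 * R}"
  proof (rule finite_measure_mono)
    show "{\<omega> \<in> space M. \<forall>\<tau>\<in>{..<2 ^ \<mu>} \<rightarrow>\<^sub>E {..<4}. \<bar>T \<tau> \<omega>\<bar> \<le> R}
      \<subseteq> {\<omega> \<in> space M. (\<Sum>a<2 ^ \<mu>. Q a \<omega>) \<le> 2 * R}"
    proof safe
      fix \<omega> assume *: "\<forall>\<tau>\<in>{..<2 ^ \<mu>} \<rightarrow>\<^sub>E {..<4}. \<bar>T \<tau> \<omega>\<bar> \<le> R"
      obtain \<tau> where \<tau>: "\<tau> \<in> {..<2 ^ \<mu>} \<rightarrow>\<^sub>E {..<4}" "(\<Sum>a<2 ^ \<mu>. Q a \<omega>) \<le> 2 * T \<tau> \<omega>"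
        using choose[of \<omega>] by blast
      with * have "\<bar>T \<tau> \<omega>\<bar> \<le> R" by blast
      then show "(\<Sum>a<2 ^ \<mu>. Q a \<omega>) \<le> 2 * R" using \<tau>(2) by linarith
    qed
  qed measurable
  also have "\<dots> \<le> exp (2 * R - (\<Sum>a<2 ^ \<mu>. expectation (Q a)) / 2)"
    by (rule prob_sum_le_exp[OF _ indQ]) (auto simp: Q_def)
  also have "\<dots> \<le> exp (2 * R - (2 ^ Suc \<mu> * truncated_mean (2 * pi / 2 ^ Suc \<mu>) / 64 - 13 * pi * C))"
  proof -
    have "(\<Sum>a<(2::nat) ^ \<mu>. truncated_mean (2 * pi / 2 ^ Suc \<mu>) / 16 - 26 * pi * C / 2 ^ \<mu>)
        \<le> (\<Sum>a<2 ^ \<mu>. expectation (Q a))"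
      using EQ by (intro sum_mono) auto
    moreover have "(\<Sum>a<(2::nat) ^ \<mu>. truncated_mean (2 * pi / 2 ^ Suc \<mu>) / 16 - 26 * pi * C / 2 ^ \<mu>)
      = 2 ^ \<mu> * truncated_mean (2 * pi / 2 ^ Suc \<mu>) / 16 - 26 * pi * C"
      by (simp add: field_simps)
    ultimately show ?thesis by simp
  qed
  finally show ?thesis .
qed

end

section \<open>A residual set of integrands\<close>

lemma has_stochastic_integral_dyadic:
  assumes "has_stochastic_integral M Y g 0 (2 * pi) I" and \<epsilon>: "0 < \<epsilon>"
  shows "\<forall>\<^sub>F k in sequentially.
    measure M {\<omega> \<in> space M. \<epsilon> < \<bar>left_sum g (2 ^ k) (dyadic k) (\<lambda>t. Y t \<omega>) - I \<omega>\<bar>} < \<epsilon>"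
proof -
  obtain \<delta> where \<delta>: "0 < \<delta>" "\<forall>n p. interval_partition 0 (2 * pi) n p \<and> (\<forall>i<n. p (Suc i) - p i < \<delta>)
      \<longrightarrow> measure M {\<omega> \<in> space M. \<epsilon> < \<bar>left_sum g n p (\<lambda>t. Y t \<omega>) - I \<omega>\<bar>} < \<epsilon>"
    using assms unfolding has_stochastic_integral_iff_left_sums by blast
  have half: "(\<lambda>k. (1 / 2 :: real) ^ k) \<longlonglongrightarrow> 0" by (rule LIMSEQ_realpow_zero) auto
  have "(\<lambda>k. 2 * pi / 2 ^ k) \<longlonglongrightarrow> 0"
    using tendsto_mult[OF tendsto_const[of "2 * pi"] half] by (simp add: power_divide)
  then have "\<forall>\<^sub>F k in sequentially. 2 * pi / 2 ^ k < \<delta>"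
    using \<delta>(1) by (rule order_tendstoD)
  then show ?thesis
    by eventually_elim (use \<delta>(2) dyadic_partition dyadic_step in \<open>simp only: simp_thms\<close>)
qed

text \<open>Baire's theorem in the form needed: every ball of \<open>E\<close> contains a smaller
ball inside \<open>W R\<close>.\<close>
lemma Baire_closed_subspace:
  fixes E :: "'a::complete_space set" and W :: "nat \<Rightarrow> 'a set"
  assumes E: "closed E" "E \<noteq> {}"
    and dense: "\<And>R F r. F \<in> E \<Longrightarrow> 0 < r \<Longrightarrow>
      \<exists>G\<in>E. dist F G < r \<and> (\<exists>s>0. \<forall>H\<in>E. dist G H < s \<longrightarrow> H \<in> W R)"
  shows "\<exists>F\<in>E. \<forall>R. F \<in> W R"
proof -
  define T where "T R = {G\<in>E. \<exists>s>0. \<forall>H\<in>E. dist G H < s \<longrightarrow> H \<in> W R}" for R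
  have "openin (top_of_set E) (T R)" for R
    unfolding openin_euclidean_subtopology_iff
  proof (intro conjI ballI)
    fix G assume G: "G \<in> T R"
    then obtain s where s: "0 < s" "\<And>H. H \<in> E \<Longrightarrow> dist G H < s \<Longrightarrow> H \<in> W R" by (auto simp: T_def)
    show "\<exists>e>0. \<forall>G'\<in>E. dist G' G < e \<longrightarrow> G' \<in> T R"
    proof (intro exI[of _ "s / 2"] conjI ballI impI)
      fix G' assume G': "G' \<in> E" "dist G' G < s / 2"
      have "H \<in> W R" if "H \<in> E" "dist G' H < s / 2" for H
        using dist_triangle[of G H G'] G'(2) that by (intro s(2)) (auto simp: dist_commute)
      then show "G' \<in> T R" unfolding T_def using G'(1) s(1) by (auto intro!: exI[of _ "s / 2"])
    qed (use s in simp)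
  qed (auto simp: T_def)
  moreover have "top_of_set E closure_of (T R) = topspace (top_of_set E)" for R
  proof -
    have "F \<in> closure (T R)" if F: "F \<in> E" for F
      unfolding closure_approachable
    proof (intro allI impI)
      fix e :: real assume "0 < e"
      then obtain G where "G \<in> E" "dist F G < e" "\<exists>s>0. \<forall>H\<in>E. dist G H < s \<longrightarrow> H \<in> W R"
        using dense[OF F, of e R] by blast
      then show "\<exists>G\<in>T R. dist G F < e"
        by (intro bexI[of _ G]) (auto simp: T_def dist_commute)
    qed
    then have "E \<subseteq> closure (T R)" by blast
    moreover have "T R \<subseteq> E" by (auto simp: T_def)
    ultimately show ?thesis
      by (auto simp: closure_of_subtopology Int_absorb1)
  qed
  moreover have "completely_metrizable_space (top_of_set E)"
    using E(1) by (intro completely_metrizable_space_closedin completely_metrizable_space_euclidean) auto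
  ultimately have "top_of_set E closure_of (\<Inter>(range T)) = topspace (top_of_set E)"
    by (intro Baire_category disjI1) auto
  then have "\<Inter>(range T) \<noteq> {}" using E(2) by force
  then obtain F where F: "\<And>R. F \<in> T R" by auto
  then have "F \<in> W R" for R by (force simp: T_def)
  moreover have "F \<in> E" using F[of 0] by (simp add: T_def)
  ultimately show ?thesis by blast
qed

lemma circle_continuous_rotation:
  assumes "f \<in> circle_continuous"
  shows "continuous_on A (\<lambda>s. rotation (t - s) f z)"
proof -
  have "continuous_on UNIV f" using assms by (simp add: circle_continuous_def)
  then show ?thesis
    unfolding rotation_def by (rule continuous_on_compose2) (auto intro!: continuous_intros)
qed

lemma conv_sum_add_scaled:
  "conv_sum k (\<lambda>x. f x + c * g x) z y = conv_sum k f z y + c * conv_sum k g z y"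
  unfolding conv_sum_def left_sum_def rotation_def sum_distrib_left sum.distrib[symmetric]
  by (intro sum.cong refl) (simp add: algebra_simps)

context levy_process
begin

lemma conv_sum_measurable [measurable]:
  "(\<lambda>\<omega>. conv_sum k f z (\<lambda>t. Y t \<omega>)) \<in> borel_measurable M"
  unfolding conv_sum_def by (rule left_sum_measurable[OF dyadic_partition]) simp

lemma conv_sum_small:
  assumes \<epsilon>: "0 < \<epsilon>"
  obtains \<delta> where "0 < \<delta>"
    "\<And>k d. (\<And>i::nat. \<bar>d i\<bar> \<le> \<delta>) \<Longrightarrow> prob {\<omega> \<in> space M. 1 < \<bar>\<Sum>i<2 ^ k. d i * grid_increment k i \<omega>\<bar>} \<le> \<epsilon>"
proof -
  define e where "e = min 1 \<epsilon>"
  have e: "0 < e" "e \<le> 1" "e \<le> \<epsilon>" using \<epsilon> by (auto simp: e_def)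
  obtain \<delta> where \<delta>: "0 < \<delta>"
    "\<And>n p d. interval_partition 0 (2 * pi) n p \<Longrightarrow> (\<And>i. i < n \<Longrightarrow> \<bar>d i\<bar> \<le> \<delta>) \<Longrightarrow>
       prob {\<omega> \<in> space M. \<bar>\<Sum>i<n. d i * (Y (p (Suc i)) \<omega> - Y (p i) \<omega>)\<bar> > e} < e"
    using weighted_increments_small[OF e(1), of 0 "2 * pi"] by auto
  show ?thesis
  proof (rule that[OF \<delta>(1)])
    fix k and d :: "nat \<Rightarrow> real" assume d: "\<And>i. \<bar>d i\<bar> \<le> \<delta>"
    have "prob {\<omega> \<in> space M. 1 < \<bar>\<Sum>i<2 ^ k. d i * grid_increment k i \<omega>\<bar>}
      \<le> prob {\<omega> \<in> space M. e < \<bar>\<Sum>i<2 ^ k. d i * grid_increment k i \<omega>\<bar>}"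
      using e by (intro finite_measure_mono) auto
    also have "\<dots> < e" unfolding grid_increment_def by (intro \<delta>(2) dyadic_partition d)
    finally show "prob {\<omega> \<in> space M. 1 < \<bar>\<Sum>i<2 ^ k. d i * grid_increment k i \<omega>\<bar>} \<le> \<epsilon>" using e by simp
  qed
qed

lemma truncated_mean_le_1: "0 \<le> h \<Longrightarrow> truncated_mean h \<le> 1"
proof -
  assume "0 \<le> h"
  then have "truncated_mean h \<le> expectation (\<lambda>_. 1)"
    unfolding truncated_mean_def by (intro integral_mono integrable_const_bound[where B=1]) auto
  then show ?thesis by (simp add: prob_space)
qed

text \<open>The number of windows is chosen first, so large that the bound of
\<open>resonance_prob\<close> is at most \<open>\<epsilon> / 2\<close>. Only then \<open>q\<close>
is taken so large that for each of the \<open>4 ^ m\<close> phase patterns the translated wave is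
close enough to the ideal one. The remaining \<open>\<epsilon> / 2\<close> is shared between these
patterns.\<close>
lemma resonant_function:
  assumes unbounded: "\<And>B. \<exists>k. B < 2 ^ k * truncated_mean (2 * pi / 2 ^ k)"
    and \<epsilon>: "0 < \<epsilon>"
  obtains g Z where "g \<in> circle_continuous" "\<And>x. \<bar>g x\<bar> \<le> 1" "finite Z" "Z \<subseteq> {0..2 * pi}"
    "\<forall>\<^sub>F k in sequentially. prob {\<omega> \<in> space M. \<forall>z\<in>Z. \<bar>conv_sum k g z (\<lambda>t. Y t \<omega>)\<bar> \<le> R} \<le> \<epsilon>"
proof -
  obtain C where C: "0 < C"
    "\<And>s t. 0 \<le> s \<Longrightarrow> s \<le> t \<Longrightarrow> expectation (\<lambda>\<omega>. min 1 ((Y t \<omega> - Y s \<omega>)\<^sup>2)) \<le> C * (t - s)"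
    "\<And>s t. 0 \<le> s \<Longrightarrow> s \<le> t \<Longrightarrow> \<bar>expectation (\<lambda>\<omega>. sin (Y t \<omega> - Y s \<omega>))\<bar> \<le> C * (t - s)"
    by (rule increment_moment_bounds) blast
  \<comment> \<open>The lower bound 1 excludes \<open>K = 0\<close>, so that there is a level \<open>\<mu> = K - 1\<close> whose windows have middle halves of length
    \<open>2 * pi / 2 ^ K\<close>.\<close>
  obtain K where K: "max 1 (64 * (2 * (R + 1) + 13 * pi * C - ln (\<epsilon> / 2))) < 2 ^ K * truncated_mean (2 * pi / 2 ^ K)"
    using unbounded by blast
  have "K \<noteq> 0" using K truncated_mean_le_1[of "2 * pi"] by (intro notI) simp
  then obtain \<mu> where \<mu>: "K = Suc \<mu>" by (cases K) auto
  define D where "D = 2 ^ Suc \<mu> * truncated_mean (2 * pi / 2 ^ Suc \<mu>)"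
  have expo: "exp (2 * (R + 1) - (D / 64 - 13 * pi * C)) \<le> \<epsilon> / 2"
  proof -
    have "64 * (2 * (R + 1) + 13 * pi * C - ln (\<epsilon> / 2)) < D"
      using K unfolding \<mu> D_def[symmetric] by simp
    then have "2 * (R + 1) - (D / 64 - 13 * pi * C) \<le> ln (\<epsilon> / 2)"
      by (simp add: field_simps)
    then have "exp (2 * (R + 1) - (D / 64 - 13 * pi * C)) \<le> exp (ln (\<epsilon> / 2))"
      by (simp only: exp_le_cancel_iff)
    then show ?thesis using \<epsilon> by simp
  qed
  define m :: nat where "m = 2 ^ \<mu>"
  have m: "0 < m" by (simp add: m_def)
  define P where "P = {..<m} \<rightarrow>\<^sub>E {..<4::nat}"
  have finP: "finite P" unfolding P_def by (intro finite_PiE) auto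
  define N where "N = real (card P) + 1"
  have N: "0 < N" by (simp add: N_def)
  obtain \<delta> where \<delta>: "0 < \<delta>"
    "\<And>k d. (\<And>i::nat. \<bar>d i\<bar> \<le> \<delta>) \<Longrightarrow> prob {\<omega> \<in> space M. 1 < \<bar>\<Sum>i<2 ^ k. d i * grid_increment k i \<omega>\<bar>} \<le> \<epsilon> / (2 * N)"
    using conv_sum_small[of "\<epsilon> / (2 * N)"] \<epsilon> N by auto
  define A where "A = 6 * (real m)\<^sup>2 * (1 / (1 - cos (pi / real m)) + 1)"
  obtain s where s: "max (A / \<delta>) (6 * real m) < real s" using reals_Archimedean2 by blast
  have s0: "0 < real s" using s by (smt (verit) of_nat_0_le_iff)
  define q where "q = 4 * s"
  have q: "0 < q" "4 dvd q" "A / real q \<le> \<delta>" "6 * real m / real q \<le> 2 * pi"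
  proof -
    show "0 < q" "4 dvd q" using s0 by (auto simp: q_def)
    have "A < \<delta> * real s" using s \<delta>(1) by (simp add: field_simps)
    also have "\<dots> \<le> \<delta> * real q" using \<delta>(1) by (simp add: q_def)
    finally show "A / real q \<le> \<delta>" using s0 by (simp add: q_def field_simps)
    have "6 * real m \<le> 1 * real q" using s by (simp add: q_def)
    also have "\<dots> \<le> 2 * pi * real q" using pi_gt3 by (intro mult_right_mono) auto
    finally show "6 * real m / real q \<le> 2 * pi" using s0 by (simp add: q_def field_simps)
  qed
  define g where "g x = carrier_wave m q (- x)" for x
  define Z where "Z = phase_shift m q ` P"
  have \<tau>: "\<tau> a < 4" if "\<tau> \<in> P" "a < m" for \<tau> a using that by (auto simp: P_def)
  show ?thesis
  proof (rule that[of g Z])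
    have "g (x + 2 * pi) = g x" for x
      using carrier_wave_shift[of m q "- x" 1] by (simp add: g_def)
    moreover have "continuous_on UNIV g"
      unfolding g_def[abs_def] by (rule continuous_on_compose2[OF continuous_carrier_wave[OF m]])
        (auto intro!: continuous_intros)
    ultimately show "g \<in> circle_continuous" by (simp add: circle_continuous_def)
    show "\<bar>g x\<bar> \<le> 1" for x unfolding g_def by (rule abs_carrier_wave_le_1[OF m])
    show "finite Z" using finP by (simp add: Z_def)
    show "Z \<subseteq> {0..2 * pi}"
    proof
      fix z assume "z \<in> Z"
      then obtain \<tau> where "\<tau> \<in> P" "z = phase_shift m q \<tau>" by (auto simp: Z_def)
      with phase_shift_bounds[OF q(1), of m \<tau>] \<tau> q(4) show "z \<in> {0..2 * pi}" by auto
    qed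
    show "\<forall>\<^sub>F k in sequentially. prob {\<omega> \<in> space M. \<forall>z\<in>Z. \<bar>conv_sum k g z (\<lambda>t. Y t \<omega>)\<bar> \<le> R} \<le> \<epsilon>"
      unfolding eventually_sequentially
    proof (intro exI allI impI)
      fix k assume "\<mu> + 2 \<le> k"
      then obtain j where k: "k = \<mu> + 2 + j" using le_Suc_ex by blast
      define T where "T \<tau> \<omega> = (\<Sum>i<2 ^ k. (\<Sum>a<m. bump m a (dyadic k i)
         * cos (real q ^ Suc a * dyadic k i - real (\<tau> a) * (pi / 2))) * grid_increment k i \<omega>)" for \<tau> \<omega>
      have [measurable]: "T \<tau> \<in> borel_measurable M" for \<tau>
        unfolding T_def[abs_def] by measurable
      have conv: "conv_sum k g z (\<lambda>t. Y t \<omega>) = (\<Sum>i<2 ^ k. carrier_wave m q (dyadic k i - z) * grid_increment k i \<omega>)" for z \<omega>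
      proof -
        have "carrier_wave m q (- (z + (2 * pi - s))) = carrier_wave m q (s - z)" for s
          using carrier_wave_shift[of m q "s - z" 1] by (simp add: algebra_simps)
        then show ?thesis by (simp add: conv_sum_def left_sum_def rotation_def g_def grid_increment_def)
      qed
      have "prob {\<omega> \<in> space M. \<forall>z\<in>Z. \<bar>conv_sum k g z (\<lambda>t. Y t \<omega>)\<bar> \<le> R}
        = prob {\<omega> \<in> space M. \<forall>\<tau>\<in>P. \<bar>conv_sum k g (phase_shift m q \<tau>) (\<lambda>t. Y t \<omega>)\<bar> \<le> R}"
        by (simp add: Z_def)
      also have "\<dots> \<le> prob {\<omega> \<in> space M. \<forall>\<tau>\<in>P. \<bar>T \<tau> \<omega>\<bar> \<le> R + 1} + card P * (\<epsilon> / (2 * N))"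
      proof (rule prob_all_le_perturb[OF finP])
        fix \<tau> assume \<tau>P: "\<tau> \<in> P"
        let ?z = "phase_shift m q \<tau>"
        define d where "d i = (\<Sum>a<m. bump m a (dyadic k i) * cos (real q ^ Suc a * dyadic k i - real (\<tau> a) * (pi / 2)))
            - carrier_wave m q (dyadic k i - ?z)" for i
        have "\<bar>d i\<bar> \<le> A / real q" for i
          unfolding d_def A_def by (subst abs_minus_commute)
            (rule carrier_wave_translate[OF m q(1,2) \<tau>[OF \<tau>P]])
        then have "\<bar>d i\<bar> \<le> \<delta>" for i using q(3) order_trans by blast
        moreover have "T \<tau> \<omega> - conv_sum k g ?z (\<lambda>t. Y t \<omega>) = (\<Sum>i<2 ^ k. d i * grid_increment k i \<omega>)" for \<omega>
          unfolding T_def conv d_def by (simp add: sum_subtractf[symmetric] left_diff_distrib)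
        ultimately show "prob {\<omega> \<in> space M. 1 < \<bar>T \<tau> \<omega> - conv_sum k g ?z (\<lambda>t. Y t \<omega>)\<bar>} \<le> \<epsilon> / (2 * N)"
          using \<delta>(2) by simp
      qed auto
      also have "\<dots> \<le> \<epsilon> / 2 + \<epsilon> / 2"
      proof (rule add_mono)
        have "prob {\<omega> \<in> space M. \<forall>\<tau>\<in>P. \<bar>T \<tau> \<omega>\<bar> \<le> R + 1} \<le> exp (2 * (R + 1) - (D / 64 - 13 * pi * C))"
          unfolding P_def T_def m_def k D_def by (rule resonance_prob[OF C])
        then show "prob {\<omega> \<in> space M. \<forall>\<tau>\<in>P. \<bar>T \<tau> \<omega>\<bar> \<le> R + 1} \<le> \<epsilon> / 2"
          using expo by (rule order_trans)
        show "card P * (\<epsilon> / (2 * N)) \<le> \<epsilon> / 2"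
          using \<epsilon> N by (simp add: N_def field_simps)
      qed
      finally show "prob {\<omega> \<in> space M. \<forall>z\<in>Z. \<bar>conv_sum k g z (\<lambda>t. Y t \<omega>)\<bar> \<le> R} \<le> \<epsilon>" by simp
    qed
  qed
qed

text \<open>The open condition of the Baire argument, up to taking interiors: on a finite set of
points the approximate solutions exceed \<open>R\<close> except with probability \<open>1 / (R +
1)\<close>. It is enough to have this on infinitely many grids, which is all that the construction
gives, because the multiple of a resonant function that has to be added depends on the grid.\<close>
definition resonates :: "nat \<Rightarrow> (real \<Rightarrow> real) \<Rightarrow> bool" where
  "resonates R f \<longleftrightarrow> (\<exists>Z. finite Z \<and> Z \<subseteq> {0..2 * pi} \<and> (\<exists>\<^sub>F k in sequentially.
     prob {\<omega> \<in> space M. \<forall>z\<in>Z. \<bar>conv_sum k f z (\<lambda>t. Y t \<omega>)\<bar> \<le> real R} \<le> 1 / (real R + 1)))"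

text \<open>Adding \<open>f\<close> could cancel the large values produced by \<open>g\<close>. But
for a path on which the convolution with \<open>g\<close> is large somewhere, two different
multiples of \<open>g\<close> cannot both be cancelled, so the \<open>K\<close> events that the
\<open>i\<close>-th multiple is cancelled are disjoint there, and one of them has probability at
most \<open>1/K\<close>.\<close>
lemma resonating_scale:
  assumes fin: "finite Z" and r: "0 < r" and K: "0 < K"
    and g: "prob {\<omega> \<in> space M. \<forall>z\<in>Z. \<bar>conv_sum k g z (\<lambda>t. Y t \<omega>)\<bar> \<le> 2 * S * real K / r} \<le> \<epsilon>"
  shows "\<exists>i\<in>{1..K}. prob {\<omega> \<in> space M. \<forall>z\<in>Z. \<bar>conv_sum k (\<lambda>x. f x + r * real i / real K * g x) z (\<lambda>t. Y t \<omega>)\<bar> \<le> S}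
    \<le> 1 / real K + \<epsilon>"
proof -
  let ?G = "\<lambda>z \<omega>. conv_sum k g z (\<lambda>t. Y t \<omega>)" and ?F = "\<lambda>z \<omega>. conv_sum k f z (\<lambda>t. Y t \<omega>)"
  define A where "A i = {\<omega> \<in> space M. \<forall>z\<in>Z. \<bar>?F z \<omega> + r * real i / real K * ?G z \<omega>\<bar> \<le> S}" for i :: nat
  define L where "L = {\<omega> \<in> space M. \<forall>z\<in>Z. \<bar>?G z \<omega>\<bar> \<le> 2 * S * real K / r}"
  have [measurable]: "A i \<in> sets M" "L \<in> sets M" for i
    unfolding A_def L_def using fin by measurable
  have disj: "disjoint_family_on (\<lambda>i. A i - L) {1..K}"
    unfolding disjoint_family_on_def
  proof (intro ballI impI equals0I)
    fix i i' \<omega> assume ii: "i \<noteq> i'" and \<omega>: "\<omega> \<in> (A i - L) \<inter> (A i' - L)"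
    then obtain z where z: "z \<in> Z" "2 * S * real K / r < \<bar>?G z \<omega>\<bar>"
      by (auto simp: A_def L_def not_le)
    have b: "\<bar>?F z \<omega> + r * real i / real K * ?G z \<omega>\<bar> \<le> S" "\<bar>?F z \<omega> + r * real i' / real K * ?G z \<omega>\<bar> \<le> S"
      using \<omega> z(1) by (auto simp: A_def)
    have "\<bar>r * (real i - real i') / real K * ?G z \<omega>\<bar> \<le> 2 * S"
    proof -
      define u where "u l = ?F z \<omega> + r * real l / real K * ?G z \<omega>" for l :: nat
      have "r * (real i - real i') / real K * ?G z \<omega> = u i - u i'"
        by (simp add: u_def right_diff_distrib left_diff_distrib diff_divide_distrib)
      moreover have "\<bar>u i - u i'\<bar> \<le> 2 * S" using b unfolding u_def[symmetric] by linarith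
      ultimately show ?thesis by simp
    qed
    moreover have "2 * S < \<bar>r * (real i - real i') / real K * ?G z \<omega>\<bar>"
    proof -
      have "1 \<le> \<bar>real i - real i'\<bar>" using ii by linarith
      then have "r / real K * 1 \<le> r / real K * \<bar>real i - real i'\<bar>"
        using r by (intro mult_left_mono) auto
      moreover have "2 * S < r / real K * \<bar>?G z \<omega>\<bar>" using z(2) r K by (simp add: field_simps)
      ultimately have "2 * S < r / real K * \<bar>real i - real i'\<bar> * \<bar>?G z \<omega>\<bar>"
        using mult_right_mono[of "r / real K * 1" "r / real K * \<bar>real i - real i'\<bar>" "\<bar>?G z \<omega>\<bar>"] by linarith
      then show ?thesis using r by (simp add: abs_mult abs_divide)
    qed
    ultimately show False by linarith
  qed
  have "(\<Sum>i\<in>{1..K}. prob (A i - L)) = prob (\<Union>i\<in>{1..K}. A i - L)"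
    by (intro finite_measure_finite_Union[symmetric] disj) auto
  also have "\<dots> \<le> 1" by (rule prob_le_1)
  finally have sum: "(\<Sum>i\<in>{1..K}. prob (A i - L)) \<le> 1" .
  have "\<exists>i\<in>{1..K}. prob (A i - L) \<le> 1 / real K"
  proof (rule ccontr)
    assume "\<not> ?thesis"
    then have "(\<Sum>i\<in>{1..K}. 1 / real K) < (\<Sum>i\<in>{1..K}. prob (A i - L))"
      using K by (intro sum_strict_mono) (auto simp: not_le)
    then show False using sum K by simp
  qed
  then obtain i where i: "i \<in> {1..K}" "prob (A i - L) \<le> 1 / real K" by blast
  have "prob (A i) \<le> prob ((A i - L) \<union> L)" by (intro finite_measure_mono) auto
  also have "\<dots> \<le> prob (A i - L) + prob L" by (intro measure_Un_le) auto
  also have "\<dots> \<le> 1 / real K + \<epsilon>" using i(2) g unfolding L_def by simp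
  finally have "prob (A i) \<le> 1 / real K + \<epsilon>" .
  then show ?thesis using i(1) unfolding A_def conv_sum_add_scaled by blast
qed

end

definition periodic_bcontfun :: "(real \<Rightarrow>\<^sub>C real) set" where
  "periodic_bcontfun = {F. apply_bcontfun F \<in> circle_continuous}"

lemma closed_periodic_bcontfun: "closed periodic_bcontfun"
proof -
  have eval: "(\<lambda>n. apply_bcontfun (S n) x) \<longlonglongrightarrow> apply_bcontfun F x"
    if "S \<longlonglongrightarrow> F" for S and F :: "real \<Rightarrow>\<^sub>C real" and x
    by (rule metric_tendsto_imp_tendsto[OF that]) (simp add: dist_bounded)
  show ?thesis
    unfolding closed_sequential_limits
  proof (intro allI impI, elim conjE)
    fix S F assume S: "\<forall>n. S n \<in> periodic_bcontfun" and lim: "S \<longlonglongrightarrow> F"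
    have "apply_bcontfun (S n) (x + 2 * pi) = apply_bcontfun (S n) x" for n x
      using S by (auto simp: periodic_bcontfun_def circle_continuous_def)
    then have "apply_bcontfun F (x + 2 * pi) = apply_bcontfun F x" for x
      using LIMSEQ_unique eval[OF lim, of "x + 2 * pi"] eval[OF lim, of x] by simp
    then show "F \<in> periodic_bcontfun"
      by (auto simp: periodic_bcontfun_def circle_continuous_def)
  qed
qed

context levy_process
begin

text \<open>The approximate convolutions depend continuously on \<open>f\<close>, in probability and
uniformly in the grid.\<close>
lemma conv_sum_uniformly_small:
  assumes \<epsilon>: "0 < \<epsilon>"
  obtains \<delta> where "0 < \<delta>"
    "\<And>f g k z. (\<And>x. \<bar>f x - g x\<bar> \<le> \<delta>) \<Longrightarrow>
      prob {\<omega> \<in> space M. 1 < \<bar>conv_sum k f z (\<lambda>t. Y t \<omega>) - conv_sum k g z (\<lambda>t. Y t \<omega>)\<bar>} \<le> \<epsilon>"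
proof -
  obtain \<delta> where \<delta>: "0 < \<delta>"
    "\<And>k d. (\<And>i::nat. \<bar>d i\<bar> \<le> \<delta>) \<Longrightarrow> prob {\<omega> \<in> space M. 1 < \<bar>\<Sum>i<2 ^ k. d i * grid_increment k i \<omega>\<bar>} \<le> \<epsilon>"
    using conv_sum_small[OF \<epsilon>] by blast
  show ?thesis
  proof (rule that[OF \<delta>(1)])
    fix f g :: "real \<Rightarrow> real" and k z
    assume fg: "\<And>x. \<bar>f x - g x\<bar> \<le> \<delta>"
    have "conv_sum k f z (\<lambda>t. Y t \<omega>) - conv_sum k g z (\<lambda>t. Y t \<omega>)
        = (\<Sum>i<2 ^ k. (f (z + (2 * pi - dyadic k i)) - g (z + (2 * pi - dyadic k i))) * grid_increment k i \<omega>)" for \<omega>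
      by (simp add: conv_sum_def left_sum_def rotation_def grid_increment_def sum_subtractf left_diff_distrib)
    then show "prob {\<omega> \<in> space M. 1 < \<bar>conv_sum k f z (\<lambda>t. Y t \<omega>) - conv_sum k g z (\<lambda>t. Y t \<omega>)\<bar>} \<le> \<epsilon>"
      using \<delta>(2)[of "\<lambda>i. f (z + (2 * pi - dyadic k i)) - g (z + (2 * pi - dyadic k i))" k] fg by simp
  qed
qed

text \<open>A small multiple of a resonant function is added to \<open>F\<close>; which of the
\<open>K\<close> multiples works depends on the grid, but one of them works for infinitely many
grids. As the resulting property holds with margin, it persists in a neighbourhood.\<close>
lemma resonates_dense_interior:
  assumes unbounded: "\<And>B. \<exists>k. B < 2 ^ k * truncated_mean (2 * pi / 2 ^ k)"
    and F: "F \<in> periodic_bcontfun" and r: "0 < r"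
  shows "\<exists>G\<in>periodic_bcontfun. dist F G < r
    \<and> (\<exists>s>0. \<forall>H\<in>periodic_bcontfun. dist G H < s \<longrightarrow> resonates R (apply_bcontfun H))"
proof -
  define \<epsilon> where "\<epsilon> = 1 / (real R + 1)"
  have \<epsilon>: "0 < \<epsilon>" by (simp add: \<epsilon>_def)
  define K where "K = 4 * (R + 1)"
  have K: "0 < K" "1 / real K = \<epsilon> / 4" by (simp_all add: K_def \<epsilon>_def field_simps)
  define S where "S = real R + 1"
  have \<epsilon>4: "0 < \<epsilon> / 4" and r2: "0 < r / 2" using \<epsilon> r by auto
  obtain g Z where g: "g \<in> circle_continuous" "\<And>x. \<bar>g x\<bar> \<le> 1" and Z: "finite Z" "Z \<subseteq> {0..2 * pi}"
    and small: "\<forall>\<^sub>F k in sequentially. prob {\<omega> \<in> space M. \<forall>z\<in>Z. \<bar>conv_sum k g z (\<lambda>t. Y t \<omega>)\<bar> \<le> 2 * S * real K / (r / 2)} \<le> \<epsilon> / 4"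
    by (rule resonant_function[OF unbounded \<epsilon>4, where R="2 * S * real K / (r / 2)"]) blast
  let ?f = "\<lambda>i x. apply_bcontfun F x + r / 2 * real i / real K * g x"
  let ?bad = "\<lambda>i k. prob {\<omega> \<in> space M. \<forall>z\<in>Z. \<bar>conv_sum k (?f i) z (\<lambda>t. Y t \<omega>)\<bar> \<le> S} \<le> \<epsilon> / 2"
  have "\<exists>i\<in>{1..K}. \<exists>\<^sub>F k in sequentially. ?bad i k"
  proof (rule ccontr)
    assume "\<not> ?thesis"
    then have "\<forall>i\<in>{1..K}. \<forall>\<^sub>F k in sequentially. \<not> ?bad i k" by (simp add: not_frequently)
    then have "\<forall>\<^sub>F k in sequentially. \<forall>i\<in>{1..K}. \<not> ?bad i k" by (intro eventually_ball_finite) auto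
    with small have "\<forall>\<^sub>F k in sequentially. False"
    proof eventually_elim
      case (elim k)
      from resonating_scale[OF Z(1) r2 K(1) elim(1), of "apply_bcontfun F"] elim(2) K(2)
      show False by auto
    qed
    then show False by simp
  qed
  then obtain i where i: "i \<in> {1..K}" and freq: "\<exists>\<^sub>F k in sequentially. ?bad i k" by blast
  define c where "c = r / 2 * real i / real K"
  have "real i \<le> real K" using i by simp
  then have "r / 2 * real i \<le> r / 2 * real K" using r by (intro mult_left_mono) auto
  then have c: "0 \<le> c" "c \<le> r / 2"
    using r K(1) by (auto simp: c_def divide_le_eq)
  have gb: "g \<in> bcontfun"
    using g by (intro bcontfun_normI[of _ 1]) (auto simp: circle_continuous_def)
  define G where "G = F + c *\<^sub>R Bcontfun g"
  have G: "apply_bcontfun G = ?f i"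
    by (simp add: G_def c_def fun_eq_iff Bcontfun_inverse[OF gb])
  have GE: "G \<in> periodic_bcontfun"
    using F g(1) K(1) unfolding periodic_bcontfun_def mem_Collect_eq G circle_continuous_def
    by (auto intro!: continuous_intros)
  have "dist F G \<le> c"
  proof (rule dist_bound)
    fix x
    have "c * \<bar>g x\<bar> \<le> c * 1" using g(2) c(1) by (intro mult_left_mono) auto
    then show "dist (apply_bcontfun F x) (apply_bcontfun G x) \<le> c"
      using c(1) unfolding G c_def[symmetric] by (simp add: dist_real_def abs_mult)
  qed
  then have dist: "dist F G < r" using c(2) r by linarith
  define N where "N = real (card Z) + 1"
  have N: "0 < N" by (simp add: N_def)
  have \<epsilon>N: "0 < \<epsilon> / (2 * N)" using \<epsilon> N by simp
  obtain s where s: "0 < s" "\<And>f g k z. (\<And>x. \<bar>f x - g x\<bar> \<le> s) \<Longrightarrow>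
      prob {\<omega> \<in> space M. 1 < \<bar>conv_sum k f z (\<lambda>t. Y t \<omega>) - conv_sum k g z (\<lambda>t. Y t \<omega>)\<bar>} \<le> \<epsilon> / (2 * N)"
    using conv_sum_uniformly_small[OF \<epsilon>N] by blast
  have "resonates R (apply_bcontfun H)" if H: "dist G H < s" for H
    unfolding resonates_def
  proof (intro exI[of _ Z] conjI Z)
    show "\<exists>\<^sub>F k in sequentially. prob {\<omega> \<in> space M. \<forall>z\<in>Z. \<bar>conv_sum k (apply_bcontfun H) z (\<lambda>t. Y t \<omega>)\<bar> \<le> real R}
       \<le> 1 / (real R + 1)"
      using freq
    proof (rule frequently_elim1)
      fix k assume bad: "?bad i k"
      have "\<bar>apply_bcontfun G x - apply_bcontfun H x\<bar> \<le> s" for x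
        using dist_bounded[of G x H] H by (simp add: dist_real_def)
      then have "prob {\<omega> \<in> space M. \<forall>z\<in>Z. \<bar>conv_sum k (apply_bcontfun H) z (\<lambda>t. Y t \<omega>)\<bar> \<le> real R}
        \<le> prob {\<omega> \<in> space M. \<forall>z\<in>Z. \<bar>conv_sum k (apply_bcontfun G) z (\<lambda>t. Y t \<omega>)\<bar> \<le> real R + 1}
          + card Z * (\<epsilon> / (2 * N))"
        by (intro prob_all_le_perturb Z(1) s(2)) auto
      also have "\<dots> \<le> \<epsilon> / 2 + \<epsilon> / 2"
      proof (rule add_mono)
        show "prob {\<omega> \<in> space M. \<forall>z\<in>Z. \<bar>conv_sum k (apply_bcontfun G) z (\<lambda>t. Y t \<omega>)\<bar> \<le> real R + 1} \<le> \<epsilon> / 2"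
          using bad unfolding G S_def .
        show "card Z * (\<epsilon> / (2 * N)) \<le> \<epsilon> / 2" using \<epsilon> N by (simp add: N_def field_simps)
      qed
      finally show "prob {\<omega> \<in> space M. \<forall>z\<in>Z. \<bar>conv_sum k (apply_bcontfun H) z (\<lambda>t. Y t \<omega>)\<bar> \<le> real R} \<le> 1 / (real R + 1)"
        by (simp only: field_sum_of_halves \<epsilon>_def)
    qed
  qed
  then show ?thesis using GE dist s(1) by blast
qed

lemma mild_solution_exists:
  assumes f: "f \<in> circle_continuous"
  shows "\<exists>X. mild_solution M Y f X"
proof -
  have "\<exists>I. has_stochastic_integral M Y (\<lambda>s. rotation (t - s) f z) 0 t I" if "0 \<le> t" for t z
    using that by (intro stochastic_integral_exists circle_continuous_rotation[OF f]) auto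
  then have "\<exists>X. \<forall>t z. 0 \<le> t \<longrightarrow> has_stochastic_integral M Y (\<lambda>s. rotation (t - s) f z) 0 t (X t z)"
    by metis
  then show ?thesis unfolding mild_solution_def by blast
qed

text \<open>The solution is the limit in probability of the approximate ones, so it exceeds \<open>R
- 1\<close> on the finite set \<open>Z R\<close> except with probability \<open>2 / (R + 1)\<close>.
Only countably many points \<open>z\<close> are involved, hence the choice of versions does not
matter.\<close>
lemma mild_solution_unbounded:
  assumes res: "\<And>R. resonates R f" and X: "mild_solution M Y f X"
  shows "AE \<omega> in M. \<forall>n::nat. \<exists>z\<in>{0..2 * pi}. real n < \<bar>X (2 * pi) z \<omega>\<bar>"
proof -
  have int: "has_stochastic_integral M Y (\<lambda>s. rotation (2 * pi - s) f z) 0 (2 * pi) (X (2 * pi) z)"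
    if "z \<in> {0..2 * pi}" for z
    using X that by (simp add: mild_solution_def)
  then have [measurable]: "X (2 * pi) z \<in> borel_measurable M" if "z \<in> {0..2 * pi}" for z
    using that by (auto simp: has_stochastic_integral_def)
  obtain Z where Z: "\<And>R. finite (Z R)" "\<And>R. Z R \<subseteq> {0..2 * pi}"
    "\<And>R. \<exists>\<^sub>F k in sequentially. prob {\<omega> \<in> space M. \<forall>z\<in>Z R. \<bar>conv_sum k f z (\<lambda>t. Y t \<omega>)\<bar> \<le> real R} \<le> 1 / (real R + 1)"
  proof -
    have "\<forall>R. \<exists>Z. finite Z \<and> Z \<subseteq> {0..2 * pi} \<and> (\<exists>\<^sub>F k in sequentially.
       prob {\<omega> \<in> space M. \<forall>z\<in>Z. \<bar>conv_sum k f z (\<lambda>t. Y t \<omega>)\<bar> \<le> real R} \<le> 1 / (real R + 1))"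
      using res unfolding resonates_def by blast
    from choice[OF this] show ?thesis using that by blast
  qed
  have rv [measurable]: "X (2 * pi) z \<in> borel_measurable M" if "z \<in> Z R" for z R
    using Z(2) that by (auto intro!: \<open>\<And>z. z \<in> {0..2 * pi} \<Longrightarrow> X (2 * pi) z \<in> borel_measurable M\<close>)
  have bound: "prob {\<omega> \<in> space M. \<forall>z\<in>Z R. \<bar>X (2 * pi) z \<omega>\<bar> \<le> real R - 1} \<le> 2 / (real R + 1)" for R
  proof -
    define N where "N = real (card (Z R)) + 1"
    define \<eta> where "\<eta> = 1 / ((real R + 1) * N)"
    have N: "1 \<le> N" "0 < N" by (simp_all add: N_def)
    have \<eta>: "0 < \<eta>" "\<eta> \<le> 1" using N mult_mono[of 1 "real R + 1" 1 N] by (simp_all add: \<eta>_def)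
    have "\<forall>\<^sub>F k in sequentially. \<forall>z\<in>Z R.
        prob {\<omega> \<in> space M. \<eta> < \<bar>conv_sum k f z (\<lambda>t. Y t \<omega>) - X (2 * pi) z \<omega>\<bar>} < \<eta>"
    proof (intro eventually_ball_finite Z(1) ballI)
      fix z assume "z \<in> Z R"
      then have "z \<in> {0..2 * pi}" using Z(2) by blast
      from has_stochastic_integral_dyadic[OF int[OF this] \<eta>(1)]
      show "\<forall>\<^sub>F k in sequentially.
          prob {\<omega> \<in> space M. \<eta> < \<bar>conv_sum k f z (\<lambda>t. Y t \<omega>) - X (2 * pi) z \<omega>\<bar>} < \<eta>"
        unfolding conv_sum_def .
    qed
    with Z(3)[of R] obtain k where
      k: "prob {\<omega> \<in> space M. \<forall>z\<in>Z R. \<bar>conv_sum k f z (\<lambda>t. Y t \<omega>)\<bar> \<le> real R} \<le> 1 / (real R + 1)"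
      and near: "\<And>z. z \<in> Z R \<Longrightarrow> prob {\<omega> \<in> space M. \<eta> < \<bar>conv_sum k f z (\<lambda>t. Y t \<omega>) - X (2 * pi) z \<omega>\<bar>} < \<eta>"
      using frequently_ex[OF frequently_eventually_frequently] by blast
    have "prob {\<omega> \<in> space M. \<forall>z\<in>Z R. \<bar>X (2 * pi) z \<omega>\<bar> \<le> real R - 1}
      \<le> prob {\<omega> \<in> space M. \<forall>z\<in>Z R. \<bar>conv_sum k f z (\<lambda>t. Y t \<omega>)\<bar> \<le> (real R - 1) + 1} + card (Z R) * \<eta>"
    proof (rule prob_all_le_perturb[OF Z(1)])
      fix z assume z: "z \<in> Z R"
      have "prob {\<omega> \<in> space M. 1 < \<bar>conv_sum k f z (\<lambda>t. Y t \<omega>) - X (2 * pi) z \<omega>\<bar>}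
        \<le> prob {\<omega> \<in> space M. \<eta> < \<bar>conv_sum k f z (\<lambda>t. Y t \<omega>) - X (2 * pi) z \<omega>\<bar>}"
        using \<eta>(2) rv[OF z] by (intro finite_measure_mono) auto
      then show "prob {\<omega> \<in> space M. 1 < \<bar>conv_sum k f z (\<lambda>t. Y t \<omega>) - X (2 * pi) z \<omega>\<bar>} \<le> \<eta>"
        using near[OF z] by linarith
    qed (use rv in auto)
    also have "\<dots> \<le> 1 / (real R + 1) + 1 / (real R + 1)"
    proof (rule add_mono)
      have "card (Z R) * \<eta> \<le> N * \<eta>" using \<eta>(1) by (intro mult_right_mono) (auto simp: N_def)
      also have "N * \<eta> = 1 / (real R + 1)" using N by (simp add: \<eta>_def)
      finally show "card (Z R) * \<eta> \<le> 1 / (real R + 1)" .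
    qed (use k in simp)
    finally show ?thesis by simp
  qed
  have "AE \<omega> in M. \<exists>z\<in>{0..2 * pi}. real n < \<bar>X (2 * pi) z \<omega>\<bar>" for n :: nat
  proof -
    define A where "A = {\<omega> \<in> space M. \<forall>R. \<forall>z\<in>Z R. \<bar>X (2 * pi) z \<omega>\<bar> \<le> real n}"
    have [measurable]: "A \<in> sets M"
      unfolding A_def using Z(1) rv by (intro sets.sets_Collect_countable_All sets.sets_Collect_finite_All) auto
    have "prob A \<le> 2 / (real R + 1)" if "n + 1 \<le> R" for R
    proof -
      have "A \<subseteq> {\<omega> \<in> space M. \<forall>z\<in>Z R. \<bar>X (2 * pi) z \<omega>\<bar> \<le> real R - 1}"
        using that by (fastforce simp: A_def)
      then have "prob A \<le> prob {\<omega> \<in> space M. \<forall>z\<in>Z R. \<bar>X (2 * pi) z \<omega>\<bar> \<le> real R - 1}"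
        using Z(1) rv by (intro finite_measure_mono sets.sets_Collect_finite_All) auto
      then show ?thesis using bound[of R] by linarith
    qed
    moreover have "(\<lambda>R. 2 / (real R + 1)) \<longlonglongrightarrow> 0"
      using tendsto_mult[OF tendsto_const[of 2] LIMSEQ_inverse_real_of_nat] by (simp add: field_simps)
    ultimately have "prob A \<le> 0"
      by (intro LIMSEQ_le_const[of "\<lambda>R. 2 / (real R + 1)"]) auto
    then have "AE \<omega> in M. \<omega> \<notin> A"
      using prob_eq_0[of A] by (simp add: measure_le_0_iff)
    then show ?thesis
    proof (rule AE_mp, intro AE_I2 impI)
      fix \<omega> assume "\<omega> \<in> space M" "\<omega> \<notin> A"
      then obtain R z where "z \<in> Z R" "real n < \<bar>X (2 * pi) z \<omega>\<bar>" by (auto simp: A_def not_le)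
      then show "\<exists>z\<in>{0..2 * pi}. real n < \<bar>X (2 * pi) z \<omega>\<bar>" using Z(2) by blast
    qed
  qed
  then show ?thesis by (simp add: AE_all_countable)
qed

text \<open>Otherwise almost every path would have both locally bounded and locally unbounded
variation.\<close>
lemma truncated_means_unbounded:
  assumes "AE \<omega> in M. \<not> locally_bounded_variation (\<lambda>t. Y t \<omega>)"
  shows "\<exists>k. B < 2 ^ k * truncated_mean (2 * pi / 2 ^ k)"
proof (rule ccontr)
  assume "\<not> ?thesis"
  then have "AE \<omega> in M. locally_bounded_variation (\<lambda>t. Y t \<omega>)"
    by (intro locally_bounded_variation_if_truncated_means_bounded) (auto simp: not_less)
  with assms have "AE \<omega> in M. False" by eventually_elim simp
  then show False by simp
qed

end

lemma in_circle_continuous_bounded: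
  assumes "in_circle_continuous x"
  shows "\<exists>n::nat. \<forall>z\<in>{0..2 * pi}. \<bar>x z\<bar> \<le> real n"
proof -
  obtain g where g: "g \<in> circle_continuous" "\<And>z. z \<in> {0..2 * pi} \<Longrightarrow> x z = g z"
    using assms unfolding in_circle_continuous_def by blast
  have "continuous_on {0..2 * pi} g"
    using g(1) unfolding circle_continuous_def by (auto intro: continuous_on_subset)
  then have "bounded (g ` {0..2 * pi})"
    by (intro compact_imp_bounded compact_continuous_image) auto
  then obtain B where B: "\<And>z. z \<in> {0..2 * pi} \<Longrightarrow> \<bar>g z\<bar> \<le> B"
    unfolding bounded_iff by (metis imageI real_norm_def)
  obtain n :: nat where "B \<le> real n" using real_arch_simple by blast
  then show ?thesis using B g(2) by (intro exI[of _ n]) force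
qed

section \<open>Loss of continuity\<close>

theorem theorem6p1:
  fixes M :: "'w measure" and Y :: "real \<Rightarrow> 'w \<Rightarrow> real"
  assumes "levy_process M Y"
    and "AE \<omega> in M. \<not> locally_bounded_variation (\<lambda>t. Y t \<omega>)"
  shows "\<exists>f\<in>circle_continuous.
           (\<exists>X. mild_solution M Y f X) \<and>
           (\<forall>X. mild_solution M Y f X \<longrightarrow>
              (AE \<omega> in M. \<not> (\<forall>t\<ge>0. in_circle_continuous (\<lambda>z. X t z \<omega>))))"
proof -
  interpret levy_process M Y by fact
  have "0 \<in> periodic_bcontfun"
    by (simp add: periodic_bcontfun_def circle_continuous_def)
  then have "\<exists>F\<in>periodic_bcontfun. \<forall>R. F \<in> {F. resonates R (apply_bcontfun F)}"
    using resonates_dense_interior[OF truncated_means_unbounded[OF assms(2)]]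
    by (intro Baire_closed_subspace closed_periodic_bcontfun) (blast, simp)
  then obtain F where F: "F \<in> periodic_bcontfun" "\<And>R. resonates R (apply_bcontfun F)" by auto
  show ?thesis
  proof (intro bexI conjI allI impI)
    show f: "apply_bcontfun F \<in> circle_continuous" using F(1) by (simp add: periodic_bcontfun_def)
    show "\<exists>X. mild_solution M Y (apply_bcontfun F) X" by (rule mild_solution_exists[OF f])
    fix X assume "mild_solution M Y (apply_bcontfun F) X"
    from mild_solution_unbounded[OF F(2) this]
    show "AE \<omega> in M. \<not> (\<forall>t\<ge>0. in_circle_continuous (\<lambda>z. X t z \<omega>))"
    proof eventually_elim
      case (elim \<omega>)
      have "\<not> in_circle_continuous (\<lambda>z. X (2 * pi) z \<omega>)"
        using in_circle_continuous_bounded[of "\<lambda>z. X (2 * pi) z \<omega>"] elim by (meson not_le)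
      then show ?case using pi_ge_zero by (auto intro!: exI[of _ "2 * pi"])
    qed
  qed
qed

end
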